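(* Let $R$ be a ring, $\delta$ a derivation on $R$, $M$ a right $R$-module and $d$ a $\delta$-derivation on $M$. (1) The extension of $\delta$ on any right ring of quotients of $R$ with respect to a hereditary and faithful torsion theory agrees with the extension of $\delta$ on $Q^r_{\mathrm{max}}(R)$. In particular, the extensions of $\delta$ on $Q^r_{\mathrm{tot}}(R)$ and $Q^r_{\mathrm{max}}(R)$ agree. (2) The extension of $d$ on any module of quotients of $M$ with respect to a differential, hereditary and faithful torsion theory agrees with the extension of $d$ on the module of quotients of $M$ with respect to the Lambek torsion theory. In particular, the extensions of $d$ on the modules of quotients of $M$ with respect to the Lambek torsion theory and the maximal perfect torsion theory agree. (3) If $R$ is right Ore and $Q^r_{\mathrm{cl}}(R)$ is its classical right ring of quotients, then the extension of $\delta$ on $Q^r_{\mathrm{cl}}(R)$ agrees with the extensions of $\delta$ on $Q^r_{\mathrm{max}}(R)$ and $Q^r_{\mathrm{tot}}(R)$. (4) The extensions of $\delta$ on $Q^r_{\mathrm{max}}(R)$ and $Q^r_{\mathrm{Gol}}(R)$ agree. Moreover, the extension of $\delta$ on any right ring of quotients of $R$ with respect to a hereditary and faithful torsion theory agrees with the extension of $\delta$ on $Q^r_{\mathrm{Gol}}(R)$.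
   Context: Rings are associative with identity and modules are unital; torsion theories here are for right $R$-modules. Derivations. A derivation on $R$ is an additive map $\delta:R\to R$ with $\delta(rs)=\delta(r)s+r\delta(s)$. For a right $R$-module $M$, a $\delta$-derivation on $M$ is an additive map $d:M\to M$ with $d(xr)=d(x)r+x\delta(r)$ for all $x\in M$, $r\in R$. Modules of quotients. A Gabriel filter $\mathfrak{F}$ of right ideals corresponds to a hereditary torsion theory with torsion submodule $\mathcal{T}(M)=\{x\in M : \{r\in R: xr=0\}\in\mathfrak{F}\}$. It is faithful if $\mathcal{T}(R)=0$. The module of quotients is $M_{\mathfrak{F}}=\varinjlim_{I\in\mathfrak{F}}\mathrm{Hom}_R(I,M/\mathcal{T}(M))$, and $q_M:M\to M_{\mathfrak{F}}$ sends $m$ to the class of left multiplication by $m+\mathcal{T}(M)$. For $M=R$, $R_{\mathfrak{F}}$ is a ring, the right ring of quotients. Differential. $\mathfrak{F}$ (or its torsion theory) is differential if for every derivation $\delta$ on $R$ and every $I\in\mathfrak{F}$ there is $J\in\mathfrak{F}$ with $\delta(J)\subseteq I$. Extensions and agreement. A $\delta$-derivation $d$ on $M$ extends to $M_{\mathfrak{F}}$ if there is a $\delta$-derivation $d'$ on the right $R$-module $M_{\mathfrak{F}}$ with $d'q_M=q_Md$ (such a $d'$ is unique if it exists). For $\mathfrak{F}_1\subseteq\mathfrak{F}_2$ with torsion submodules $\mathcal{T}_1(M)\subseteq\mathcal{T}_2(M)$ and maps $q_i:M\to M_{\mathfrak{F}_i}$, let $q_{12}:M_{\mathfrak{F}_1}\to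 M_{\mathfrak{F}_2}$ be the $R$-homomorphism sending the class of $f:I\to M/\mathcal{T}_1(M)$ ($I\in\mathfrak{F}_1$) to the class of the composite of $f$ with the projection $M/\mathcal{T}_1(M)\to M/\mathcal{T}_2(M)$; then $q_{12}q_1=q_2$. The extensions of $d$ on $M_{\mathfrak{F}_1}$ and $M_{\mathfrak{F}_2}$ agree if $d$ extends to $\delta$-derivations $d_i$ on $M_{\mathfrak{F}_i}$ with $d_1q_1=q_1d$, $d_2q_2=q_2d$ and $d_2q_{12}=q_{12}d_1$. For rings of quotients this is applied with $M=R$ and $d=\delta$. Particular theories. - Lambek torsion theory: the one cogenerated by the injective envelope $E(R)$ of the right module $R$; its filter is the set of dense right ideals, and it is the largest faithful hereditary torsion theory. Its right ring of quotients is $Q^r_{\mathrm{max}}(R)$. - Perfect: $\mathfrak{F}$ is perfect if $M_{\mathfrak{F}}\cong M\otimes_R R_{\mathfrak{F}}$ canonically for every right $R$-module $M$; then $R_{\mathfrak{F}}$ is a perfect right ring of quotients. $Q^r_{\mathrm{tot}}(R)$ is the largest perfect right ring of quotients contained in $Q^r_{\mathrm{max}}(R)$ (the directed union of all perfect right rings of quotients contained in $Q^r_{\mathrm{max}}(R)$). It is the right ring of quotients with respect to the torsion theory in which $M$ is torsion iff $M\otimes_R Q^r_{\mathrm{tot}}(R)=0$; this is the maximal perfect torsion theory. - Classical: with $T$ the set of regular elements of $R$, $R$ is right Ore if $rT\cap tR\neq\emptyset$ for all $t\in T$, $r\in R$. The classical torsion theory is the one in which $M$ is torsion iff every $m\in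 M$ satisfies $mt=0$ for some $t\in T$; its right ring of quotients is $Q^r_{\mathrm{cl}}(R)$. - Goldie torsion theory: the hereditary torsion theory whose torsion-free class is the class of nonsingular right modules; it is larger than every hereditary faithful torsion theory. Its right ring of quotients is $Q^r_{\mathrm{Gol}}(R)$. *)

theory Defs
  imports "HOL-Algebra.Algebra"
begin

section \<open>Right modules over a noncommutative ring\<close>

text \<open>
  The library's \<^locale>\<open>module\<close> requires a commutative ring of scalars. Right modules are set up in
  parallel to it; the library record \<open>module\<close>, whose scalars act from the left, is used below only
  to present left modules.
\<close>

record ('a, 'm) rmodule = "'m ring" +
  act :: "'m \<Rightarrow> 'a \<Rightarrow> 'm" (infixl \<open>\<bullet>\<index>\<close> 70)

locale right_module = R?: ring R + M?: abelian_group M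
  for R :: "('a, 'b) ring_scheme" (structure)
    and M :: "('a, 'm, 'c) rmodule_scheme" (structure) +
  assumes act_closed [simp, intro]:
      "\<lbrakk>x \<in> carrier M; r \<in> carrier R\<rbrakk> \<Longrightarrow> x \<bullet>\<^bsub>M\<^esub> r \<in> carrier M"
    and act_l_distr:
      "\<lbrakk>x \<in> carrier M; y \<in> carrier M; r \<in> carrier R\<rbrakk>
        \<Longrightarrow> (x \<oplus>\<^bsub>M\<^esub> y) \<bullet>\<^bsub>M\<^esub> r = x \<bullet>\<^bsub>M\<^esub> r \<oplus>\<^bsub>M\<^esub> y \<bullet>\<^bsub>M\<^esub> r"
    and act_r_distr:
      "\<lbrakk>x \<in> carrier M; r \<in> carrier R; s \<in> carrier R\<rbrakk>
        \<Longrightarrow> x \<bullet>\<^bsub>M\<^esub> (r \<oplus> s) = x \<bullet>\<^bsub>M\<^esub> r \<oplus>\<^bsub>M\<^esub> x \<bullet>\<^bsub>M\<^esub> s"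
    and act_assoc:
      "\<lbrakk>x \<in> carrier M; r \<in> carrier R; s \<in> carrier R\<rbrakk>
        \<Longrightarrow> x \<bullet>\<^bsub>M\<^esub> (r \<otimes> s) = (x \<bullet>\<^bsub>M\<^esub> r) \<bullet>\<^bsub>M\<^esub> s"
    and act_one [simp]: "x \<in> carrier M \<Longrightarrow> x \<bullet>\<^bsub>M\<^esub> \<one> = x"

definition self_module :: "('a, 'b) ring_scheme \<Rightarrow> ('a, 'a) rmodule" where
  "self_module R = \<lparr>carrier = carrier R, monoid.mult = (\<otimes>\<^bsub>R\<^esub>), one = \<one>\<^bsub>R\<^esub>,
                     ring.zero = \<zero>\<^bsub>R\<^esub>, add = (\<oplus>\<^bsub>R\<^esub>), act = (\<otimes>\<^bsub>R\<^esub>)\<rparr>"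

definition rsubmodule ::
    "('a, 'b) ring_scheme \<Rightarrow> ('a, 'm, 'c) rmodule_scheme \<Rightarrow> 'm set \<Rightarrow> bool" where
  "rsubmodule R M N \<longleftrightarrow> additive_subgroup N M \<and>
     (\<forall>x\<in>N. \<forall>r\<in>carrier R. x \<bullet>\<^bsub>M\<^esub> r \<in> N)"

definition right_ideal :: "('a, 'b) ring_scheme \<Rightarrow> 'a set \<Rightarrow> bool" where
  "right_ideal R I \<longleftrightarrow> rsubmodule R (self_module R) I"

definition quot_rmodule ::
    "('a, 'm, 'c) rmodule_scheme \<Rightarrow> 'm set \<Rightarrow> ('a, 'm set) rmodule" where
  "quot_rmodule M N = \<lparr>carrier = a_rcosets\<^bsub>M\<^esub> N, monoid.mult = undefined, one = undefined,
     ring.zero = N, add = set_add M, act = (\<lambda>C r. \<Union>x\<in>C. N +>\<^bsub>M\<^esub> (x \<bullet>\<^bsub>M\<^esub> r))\<rparr>"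

text \<open>Homomorphisms are extensional, so that they are determined by their values on the carrier.\<close>

definition rhom ::
    "('a, 'b) ring_scheme \<Rightarrow> ('a, 'm, 'c) rmodule_scheme \<Rightarrow> ('a, 'n, 'd) rmodule_scheme
      \<Rightarrow> ('m \<Rightarrow> 'n) set" where
  "rhom R M N = {h \<in> carrier M \<rightarrow>\<^sub>E carrier N.
     (\<forall>x\<in>carrier M. \<forall>y\<in>carrier M. h (x \<oplus>\<^bsub>M\<^esub> y) = h x \<oplus>\<^bsub>N\<^esub> h y) \<and>
     (\<forall>x\<in>carrier M. \<forall>r\<in>carrier R. h (x \<bullet>\<^bsub>M\<^esub> r) = h x \<bullet>\<^bsub>N\<^esub> r)}"


section \<open>Derivations\<close>

definition derivation :: "('a, 'b) ring_scheme \<Rightarrow> ('a \<Rightarrow> 'a) \<Rightarrow> bool" where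
  "derivation R \<delta> \<longleftrightarrow> \<delta> \<in> carrier R \<rightarrow> carrier R \<and>
     (\<forall>r\<in>carrier R. \<forall>s\<in>carrier R. \<delta> (r \<oplus>\<^bsub>R\<^esub> s) = \<delta> r \<oplus>\<^bsub>R\<^esub> \<delta> s) \<and>
     (\<forall>r\<in>carrier R. \<forall>s\<in>carrier R. \<delta> (r \<otimes>\<^bsub>R\<^esub> s) = \<delta> r \<otimes>\<^bsub>R\<^esub> s \<oplus>\<^bsub>R\<^esub> r \<otimes>\<^bsub>R\<^esub> \<delta> s)"

definition module_derivation ::
    "('a, 'b) ring_scheme \<Rightarrow> ('a \<Rightarrow> 'a) \<Rightarrow> ('a, 'm, 'c) rmodule_scheme \<Rightarrow> ('m \<Rightarrow> 'm) \<Rightarrow> bool" where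
  "module_derivation R \<delta> M d \<longleftrightarrow> d \<in> carrier M \<rightarrow> carrier M \<and>
     (\<forall>x\<in>carrier M. \<forall>y\<in>carrier M. d (x \<oplus>\<^bsub>M\<^esub> y) = d x \<oplus>\<^bsub>M\<^esub> d y) \<and>
     (\<forall>x\<in>carrier M. \<forall>r\<in>carrier R. d (x \<bullet>\<^bsub>M\<^esub> r) = d x \<bullet>\<^bsub>M\<^esub> r \<oplus>\<^bsub>M\<^esub> x \<bullet>\<^bsub>M\<^esub> \<delta> r)"


section \<open>Gabriel filters and torsion\<close>

definition colon :: "('a, 'b) ring_scheme \<Rightarrow> 'a set \<Rightarrow> 'a \<Rightarrow> 'a set" where
  "colon R I r = {x \<in> carrier R. r \<otimes>\<^bsub>R\<^esub> x \<in> I}"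

definition gabriel_filter :: "('a, 'b) ring_scheme \<Rightarrow> 'a set set \<Rightarrow> bool" where
  "gabriel_filter R F \<longleftrightarrow>
     (\<forall>I\<in>F. right_ideal R I) \<and>
     carrier R \<in> F \<and>
     (\<forall>I J. I \<in> F \<and> right_ideal R J \<and> I \<subseteq> J \<longrightarrow> J \<in> F) \<and>
     (\<forall>I\<in>F. \<forall>J\<in>F. I \<inter> J \<in> F) \<and>
     (\<forall>I\<in>F. \<forall>r\<in>carrier R. colon R I r \<in> F) \<and>
     (\<forall>I J. I \<in> F \<and> right_ideal R J \<and> (\<forall>a\<in>I. colon R J a \<in> F) \<longrightarrow> J \<in> F)"

definition ann :: "('a, 'b) ring_scheme \<Rightarrow> ('a, 'm, 'c) rmodule_scheme \<Rightarrow> 'm \<Rightarrow> 'a set" where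
  "ann R M x = {r \<in> carrier R. x \<bullet>\<^bsub>M\<^esub> r = \<zero>\<^bsub>M\<^esub>}"

definition torsion ::
    "('a, 'b) ring_scheme \<Rightarrow> 'a set set \<Rightarrow> ('a, 'm, 'c) rmodule_scheme \<Rightarrow> 'm set" where
  "torsion R F M = {x \<in> carrier M. ann R M x \<in> F}"

definition faithful :: "('a, 'b) ring_scheme \<Rightarrow> 'a set set \<Rightarrow> bool" where
  "faithful R F \<longleftrightarrow> torsion R F (self_module R) = {\<zero>\<^bsub>R\<^esub>}"

definition differential :: "('a, 'b) ring_scheme \<Rightarrow> 'a set set \<Rightarrow> bool" where
  "differential R F \<longleftrightarrow> (\<forall>\<delta>. derivation R \<delta> \<longrightarrow> (\<forall>I\<in>F. \<exists>J\<in>F. \<delta> ` J \<subseteq> I))"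


section \<open>Modules of quotients\<close>

text \<open>
  The direct limit of the groups \<open>Hom(I, M/T(M))\<close> over \<open>I \<in> F\<close>: its elements are the classes of
  pairs \<open>(I, f)\<close>, two pairs being identified when they agree on a common smaller member of \<open>F\<close>.
\<close>

type_synonym ('a, 'm) germ = "('a set \<times> ('a \<Rightarrow> 'm set)) set"

abbreviation mod_torsion ::
    "('a, 'b) ring_scheme \<Rightarrow> 'a set set \<Rightarrow> ('a, 'm, 'c) rmodule_scheme \<Rightarrow> ('a, 'm set) rmodule" where
  "mod_torsion R F M \<equiv> quot_rmodule M (torsion R F M)"

definition local_homs ::
    "('a, 'b) ring_scheme \<Rightarrow> 'a set set \<Rightarrow> ('a, 'm, 'c) rmodule_scheme \<Rightarrow> ('a, 'm) germ" where
  "local_homs R F M =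
     {(I, f). I \<in> F \<and> f \<in> rhom R ((self_module R)\<lparr>carrier := I\<rparr>) (mod_torsion R F M)}"

definition germ_rel ::
    "('a, 'b) ring_scheme \<Rightarrow> 'a set set \<Rightarrow> ('a, 'm, 'c) rmodule_scheme
      \<Rightarrow> (('a set \<times> ('a \<Rightarrow> 'm set)) \<times> ('a set \<times> ('a \<Rightarrow> 'm set))) set" where
  "germ_rel R F M = {((I, f), (J, g)). (I, f) \<in> local_homs R F M \<and> (J, g) \<in> local_homs R F M \<and>
     (\<exists>K\<in>F. K \<subseteq> I \<inter> J \<and> (\<forall>a\<in>K. f a = g a))}"

definition germ ::
    "('a, 'b) ring_scheme \<Rightarrow> 'a set set \<Rightarrow> ('a, 'm, 'c) rmodule_scheme
      \<Rightarrow> 'a set \<Rightarrow> ('a \<Rightarrow> 'm set) \<Rightarrow> ('a, 'm) germ" where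
  "germ R F M I f = germ_rel R F M `` {(I, restrict f I)}"

text \<open>
  Operations on classes are written as unions over representatives, as in
  \<^theory>\<open>HOL.Equiv_Relations\<close>; the result does not depend on the representatives.
\<close>

definition module_of_quotients ::
    "('a, 'b) ring_scheme \<Rightarrow> 'a set set \<Rightarrow> ('a, 'm, 'c) rmodule_scheme
      \<Rightarrow> ('a, ('a, 'm) germ) rmodule" where
  "module_of_quotients R F M =
     \<lparr>carrier = local_homs R F M // germ_rel R F M, monoid.mult = undefined, one = undefined,
      ring.zero = germ R F M (carrier R) (\<lambda>a. \<zero>\<^bsub>mod_torsion R F M\<^esub>),
      add = (\<lambda>x y. \<Union>(I, f)\<in>x. \<Union>(J, g)\<in>y.
               germ R F M (I \<inter> J) (\<lambda>a. f a \<oplus>\<^bsub>mod_torsion R F M\<^esub> g a)),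
      act = (\<lambda>x r. \<Union>(I, f)\<in>x. germ R F M (colon R I r) (\<lambda>a. f (r \<otimes>\<^bsub>R\<^esub> a)))\<rparr>"

definition quotient_map ::
    "('a, 'b) ring_scheme \<Rightarrow> 'a set set \<Rightarrow> ('a, 'm, 'c) rmodule_scheme \<Rightarrow> 'm \<Rightarrow> ('a, 'm) germ" where
  "quotient_map R F M m =
     germ R F M (carrier R) (\<lambda>a. torsion R F M +>\<^bsub>M\<^esub> (m \<bullet>\<^bsub>M\<^esub> a))"

definition change_filter ::
    "('a, 'b) ring_scheme \<Rightarrow> 'a set set \<Rightarrow> 'a set set \<Rightarrow> ('a, 'm, 'c) rmodule_scheme
      \<Rightarrow> ('a, 'm) germ \<Rightarrow> ('a, 'm) germ" where
  "change_filter R F G M x =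
     (\<Union>(I, f)\<in>x. germ R G M I (\<lambda>a. \<Union>m\<in>f a. torsion R G M +>\<^bsub>M\<^esub> m))"

definition extends_to_quotients ::
    "('a, 'b) ring_scheme \<Rightarrow> 'a set set \<Rightarrow> ('a \<Rightarrow> 'a) \<Rightarrow> ('a, 'm, 'c) rmodule_scheme \<Rightarrow> ('m \<Rightarrow> 'm)
      \<Rightarrow> (('a, 'm) germ \<Rightarrow> ('a, 'm) germ) \<Rightarrow> bool" where
  "extends_to_quotients R F \<delta> M d d' \<longleftrightarrow>
     module_derivation R \<delta> (module_of_quotients R F M) d' \<and>
     (\<forall>m\<in>carrier M. d' (quotient_map R F M m) = quotient_map R F M (d m))"

definition extensions_agree ::
    "('a, 'b) ring_scheme \<Rightarrow> 'a set set \<Rightarrow> 'a set set \<Rightarrow> ('a \<Rightarrow> 'a) \<Rightarrow> ('a, 'm, 'c) rmodule_scheme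
      \<Rightarrow> ('m \<Rightarrow> 'm) \<Rightarrow> bool" where
  "extensions_agree R F1 F2 \<delta> M d \<longleftrightarrow>
     gabriel_filter R F1 \<and> gabriel_filter R F2 \<and> F1 \<subseteq> F2 \<and>
     (\<exists>d1 d2. extends_to_quotients R F1 \<delta> M d d1 \<and> extends_to_quotients R F2 \<delta> M d d2 \<and>
        (\<forall>x\<in>carrier (module_of_quotients R F1 M).
           d2 (change_filter R F1 F2 M x) = change_filter R F1 F2 M (d1 x)))"


section \<open>Tensor products\<close>

definition tensor_relations ::
    "('a, 'b) ring_scheme \<Rightarrow> ('a, 'm, 'c) rmodule_scheme \<Rightarrow> ('a, 'n, 'd) module_scheme
      \<Rightarrow> (('m \<times> 'n) \<Rightarrow>\<^sub>0 int) set" where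
  "tensor_relations R M N =
     {frag_of (x \<oplus>\<^bsub>M\<^esub> y, n) - frag_of (x, n) - frag_of (y, n) | x y n.
        x \<in> carrier M \<and> y \<in> carrier M \<and> n \<in> carrier N} \<union>
     {frag_of (x, n \<oplus>\<^bsub>N\<^esub> p) - frag_of (x, n) - frag_of (x, p) | x n p.
        x \<in> carrier M \<and> n \<in> carrier N \<and> p \<in> carrier N} \<union>
     {frag_of (x \<bullet>\<^bsub>M\<^esub> r, n) - frag_of (x, r \<odot>\<^bsub>N\<^esub> n) | x r n.
        x \<in> carrier M \<and> r \<in> carrier R \<and> n \<in> carrier N}"

definition tensor_kernel ::
    "('a, 'b) ring_scheme \<Rightarrow> ('a, 'm, 'c) rmodule_scheme \<Rightarrow> ('a, 'n, 'd) module_scheme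
      \<Rightarrow> (('m \<times> 'n) \<Rightarrow>\<^sub>0 int) set" where
  "tensor_kernel R M N =
     generate (free_Abelian_group (carrier M \<times> carrier N)) (tensor_relations R M N)"

definition tensor_product ::
    "('a, 'b) ring_scheme \<Rightarrow> ('a, 'm, 'c) rmodule_scheme \<Rightarrow> ('a, 'n, 'd) module_scheme
      \<Rightarrow> (('m \<times> 'n) \<Rightarrow>\<^sub>0 int) set monoid" where
  "tensor_product R M N =
     free_Abelian_group (carrier M \<times> carrier N) Mod tensor_kernel R M N"

definition pure_tensor ::
    "('a, 'b) ring_scheme \<Rightarrow> ('a, 'm, 'c) rmodule_scheme \<Rightarrow> ('a, 'n, 'd) module_scheme
      \<Rightarrow> 'm \<Rightarrow> 'n \<Rightarrow> (('m \<times> 'n) \<Rightarrow>\<^sub>0 int) set" where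
  "pure_tensor R M N x n =
     tensor_kernel R M N #>\<^bsub>free_Abelian_group (carrier M \<times> carrier N)\<^esub> frag_of (x, n)"


section \<open>Perfect filters\<close>

text \<open>
  The product \<open>M \<times> R\<^sub>F \<rightarrow> M\<^sub>F\<close>: if \<open>q\<close> is the class of \<open>g : J \<rightarrow> R/T(R)\<close>, then \<open>m q\<close> is the class of
  \<open>a \<mapsto> m g(a)\<close>, where \<open>m (r + T(R)) = m r + T(M)\<close>. For \<open>M = R\<close> it is the left action of \<open>R\<close> on
  \<open>R\<^sub>F\<close>.
\<close>

definition scale ::
    "('a, 'b) ring_scheme \<Rightarrow> 'a set set \<Rightarrow> ('a, 'm, 'c) rmodule_scheme \<Rightarrow> 'm \<Rightarrow> ('a, 'a) germ
      \<Rightarrow> ('a, 'm) germ" where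
  "scale R F M m q =
     (\<Union>(J, g)\<in>q. germ R F M J (\<lambda>a. \<Union>r\<in>g a. torsion R F M +>\<^bsub>M\<^esub> (m \<bullet>\<^bsub>M\<^esub> r)))"

definition left_quotients ::
    "('a, 'b) ring_scheme \<Rightarrow> 'a set set \<Rightarrow> ('a, ('a, 'a) germ) module" where
  "left_quotients R F =
     \<lparr>carrier = carrier (module_of_quotients R F (self_module R)),
      monoid.mult = undefined, one = undefined,
      ring.zero = \<zero>\<^bsub>module_of_quotients R F (self_module R)\<^esub>,
      add = (\<oplus>\<^bsub>module_of_quotients R F (self_module R)\<^esub>),
      smult = scale R F (self_module R)\<rparr>"

text \<open>
  A formula cannot quantify over all types, hence not over literally all right modules. The type
  argument \<open>'u\<close> stands for an arbitrarily large universe: modules range over those with carrier in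
  \<open>'a set + 'u\<close>. The summand \<open>'a set\<close> guarantees that, whatever \<open>'u\<close> is, every cyclic module
  \<open>R/I\<close> has an isomorphic copy in range.
\<close>

definition perfect_filter :: "'u itself \<Rightarrow> ('a, 'b) ring_scheme \<Rightarrow> 'a set set \<Rightarrow> bool" where
  "perfect_filter U R F \<longleftrightarrow> gabriel_filter R F \<and>
     (\<forall>M :: ('a, 'a set + 'u) rmodule. right_module R M \<longrightarrow>
        (\<exists>\<phi> \<in> iso (tensor_product R M (left_quotients R F)) (add_monoid (module_of_quotients R F M)).
           \<forall>m\<in>carrier M. \<forall>q\<in>carrier (left_quotients R F).
             \<phi> (pure_tensor R M (left_quotients R F) m q) = scale R F M m q))"


section \<open>Particular torsion theories\<close>

text \<open>
  A hereditary torsion theory is given by its filter, consisting of the right ideals \<open>I\<close> for which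
  \<open>R/I\<close> is torsion.
\<close>

abbreviation cyclic_module :: "('a, 'b) ring_scheme \<Rightarrow> 'a set \<Rightarrow> ('a, 'a set) rmodule" where
  "cyclic_module R I \<equiv> quot_rmodule (self_module R) I"

definition cogenerated_filter ::
    "('a, 'b) ring_scheme \<Rightarrow> ('a, 'm, 'c) rmodule_scheme \<Rightarrow> 'a set set" where
  "cogenerated_filter R N = {I. right_ideal R I \<and>
     (\<forall>h\<in>rhom R (cyclic_module R I) N. \<forall>x\<in>carrier (cyclic_module R I). h x = \<zero>\<^bsub>N\<^esub>)}"

definition lambek_filter :: "('a, 'b) ring_scheme \<Rightarrow> 'a set set" where
  "lambek_filter R = {I. right_ideal R I \<and>
     (\<forall>a\<in>carrier R. \<forall>b\<in>carrier R. b \<noteq> \<zero>\<^bsub>R\<^esub> \<longrightarrow>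
        (\<exists>r\<in>carrier R. a \<otimes>\<^bsub>R\<^esub> r \<in> I \<and> b \<otimes>\<^bsub>R\<^esub> r \<noteq> \<zero>\<^bsub>R\<^esub>))}"

text \<open>
  \<open>Q\<^sub>t\<^sub>o\<^sub>t\<close> is the union, inside \<open>Q\<^sub>m\<^sub>a\<^sub>x\<close>, of the images of all faithful perfect rings of quotients.
  Faithfulness is what makes \<open>R\<^sub>F\<close> a subring of \<open>Q\<^sub>m\<^sub>a\<^sub>x\<close>. Only its structure as a left \<open>R\<close>-module
  is used.
\<close>

definition Q_tot :: "'u itself \<Rightarrow> ('a, 'b) ring_scheme \<Rightarrow> ('a, ('a, 'a) germ) module" where
  "Q_tot U R = (left_quotients R (lambek_filter R))
     \<lparr>carrier := \<Union>F\<in>{F. perfect_filter U R F \<and> faithful R F}.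
        change_filter R F (lambek_filter R) (self_module R) ` carrier (left_quotients R F)\<rparr>"

definition tot_filter :: "'u itself \<Rightarrow> ('a, 'b) ring_scheme \<Rightarrow> 'a set set" where
  "tot_filter U R = {I. right_ideal R I \<and>
     trivial_group (tensor_product R (cyclic_module R I) (Q_tot U R))}"

definition regular_elements :: "('a, 'b) ring_scheme \<Rightarrow> 'a set" where
  "regular_elements R = {t \<in> carrier R. \<forall>x\<in>carrier R.
     (t \<otimes>\<^bsub>R\<^esub> x = \<zero>\<^bsub>R\<^esub> \<longrightarrow> x = \<zero>\<^bsub>R\<^esub>) \<and> (x \<otimes>\<^bsub>R\<^esub> t = \<zero>\<^bsub>R\<^esub> \<longrightarrow> x = \<zero>\<^bsub>R\<^esub>)}"

definition right_ore :: "('a, 'b) ring_scheme \<Rightarrow> bool" where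
  "right_ore R \<longleftrightarrow> (\<forall>t\<in>regular_elements R. \<forall>r\<in>carrier R.
     {r \<otimes>\<^bsub>R\<^esub> u | u. u \<in> regular_elements R} \<inter> {t \<otimes>\<^bsub>R\<^esub> s | s. s \<in> carrier R} \<noteq> {})"

definition classical_filter :: "('a, 'b) ring_scheme \<Rightarrow> 'a set set" where
  "classical_filter R = {I. right_ideal R I \<and>
     (\<forall>x\<in>carrier (cyclic_module R I). \<exists>t\<in>regular_elements R.
        x \<bullet>\<^bsub>cyclic_module R I\<^esub> t = \<zero>\<^bsub>cyclic_module R I\<^esub>)}"

definition essential_right_ideal :: "('a, 'b) ring_scheme \<Rightarrow> 'a set \<Rightarrow> bool" where
  "essential_right_ideal R I \<longleftrightarrow> right_ideal R I \<and>
     (\<forall>J. right_ideal R J \<and> J \<noteq> {\<zero>\<^bsub>R\<^esub>} \<longrightarrow> I \<inter> J \<noteq> {\<zero>\<^bsub>R\<^esub>})"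

definition nonsingular :: "('a, 'b) ring_scheme \<Rightarrow> ('a, 'm, 'c) rmodule_scheme \<Rightarrow> bool" where
  "nonsingular R M \<longleftrightarrow> {x \<in> carrier M. essential_right_ideal R (ann R M x)} = {\<zero>\<^bsub>M\<^esub>}"

text \<open>
  The torsion modules of the theory with a given torsion-free class are those without nonzero
  homomorphisms into members of that class.
\<close>

definition goldie_filter :: "'u itself \<Rightarrow> ('a, 'b) ring_scheme \<Rightarrow> 'a set set" where
  "goldie_filter U R = {I. right_ideal R I \<and>
     (\<forall>N :: ('a, 'a set + 'u) rmodule. right_module R N \<and> nonsingular R N \<longrightarrow>
        I \<in> cogenerated_filter R N)}"


section \<open>The Lambek filter and the injective envelope\<close>

text \<open>
  The Lambek theory is the one cogenerated by the injective envelope of the right module \<open>R\<close>. Its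
  filter was defined above as the set of dense right ideals; the two descriptions agree. (By Baer's
  criterion it is enough to test injectivity on the cyclic modules, which have carriers of type
  \<open>'a set\<close>.)
\<close>

definition injective_rmodule ::
    "'n itself \<Rightarrow> ('a, 'b) ring_scheme \<Rightarrow> ('a, 'm, 'c) rmodule_scheme \<Rightarrow> bool" where
  "injective_rmodule U R E \<longleftrightarrow> right_module R E \<and>
     (\<forall>N :: ('a, 'n) rmodule. \<forall>L. right_module R N \<and> rsubmodule R N L \<longrightarrow>
        (\<forall>h\<in>rhom R (N\<lparr>carrier := L\<rparr>) E. \<exists>k\<in>rhom R N E. \<forall>x\<in>L. k x = h x))"

definition injective_envelope ::
    "'n itself \<Rightarrow> ('a, 'b) ring_scheme \<Rightarrow> ('a, 'm, 'c) rmodule_scheme \<Rightarrow> ('a \<Rightarrow> 'm) \<Rightarrow> bool" where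
  "injective_envelope U R E \<iota> \<longleftrightarrow> injective_rmodule U R E \<and>
     \<iota> \<in> rhom R (self_module R) E \<and> inj_on \<iota> (carrier R) \<and>
     (\<forall>L. rsubmodule R E L \<and> L \<noteq> {\<zero>\<^bsub>E\<^esub>} \<longrightarrow> L \<inter> \<iota> ` carrier R \<noteq> {\<zero>\<^bsub>E\<^esub>})"

lemma self_module_simps [simp]:
  "carrier (self_module R) = carrier R"
  "x \<oplus>\<^bsub>self_module R\<^esub> y = x \<oplus>\<^bsub>R\<^esub> y"
  "x \<otimes>\<^bsub>self_module R\<^esub> y = x \<otimes>\<^bsub>R\<^esub> y"
  "\<zero>\<^bsub>self_module R\<^esub> = \<zero>\<^bsub>R\<^esub>"
  "x \<bullet>\<^bsub>self_module R\<^esub> r = x \<otimes>\<^bsub>R\<^esub> r"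
  by (simp_all add: self_module_def)

lemma self_module_coset [simp]: "I +>\<^bsub>self_module R\<^esub> x = I +>\<^bsub>R\<^esub> x"
  by (simp add: a_r_coset_def' )

lemma self_module_rcosets [simp]: "a_rcosets\<^bsub>self_module R\<^esub> I = a_rcosets\<^bsub>R\<^esub> I"
  by (simp add: A_RCOSETS_def')

lemma self_module_set_add [simp]: "set_add (self_module R) = set_add R"
  by (intro ext) (simp add: set_add_def')

lemma right_ideal_iff:
  assumes "ring R"
  shows "right_ideal R I \<longleftrightarrow> abelian_subgroup I R \<and> (\<forall>x\<in>I. \<forall>r\<in>carrier R. x \<otimes>\<^bsub>R\<^esub> r \<in> I)"
proof -
  interpret R: ring R by fact
  have "additive_subgroup I (self_module R) \<longleftrightarrow> additive_subgroup I R"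
    unfolding additive_subgroup_def self_module_def
    by (simp add: subgroup_def m_inv_def)
  moreover have "additive_subgroup I R \<longleftrightarrow> abelian_subgroup I R"
    using R.is_abelian_group abelian_subgroup.axioms(1) abelian_subgroupI3 by blast
  ultimately show ?thesis
    by (simp add: right_ideal_def rsubmodule_def)
qed

lemma cyclic_module_simps:
  assumes "ring R" and I: "right_ideal R I"
  shows "carrier (cyclic_module R I) = {I +>\<^bsub>R\<^esub> x | x. x \<in> carrier R}"
    and "\<zero>\<^bsub>cyclic_module R I\<^esub> = I"
    and "\<And>x y. \<lbrakk>x \<in> carrier R; y \<in> carrier R\<rbrakk> \<Longrightarrow>
      (I +>\<^bsub>R\<^esub> x) \<oplus>\<^bsub>cyclic_module R I\<^esub> (I +>\<^bsub>R\<^esub> y) = I +>\<^bsub>R\<^esub> (x \<oplus>\<^bsub>R\<^esub> y)"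
    and "\<And>x r. \<lbrakk>x \<in> carrier R; r \<in> carrier R\<rbrakk> \<Longrightarrow>
      (I +>\<^bsub>R\<^esub> x) \<bullet>\<^bsub>cyclic_module R I\<^esub> r = I +>\<^bsub>R\<^esub> (x \<otimes>\<^bsub>R\<^esub> r)"
    and "\<And>x y. \<lbrakk>x \<in> carrier R; y \<in> carrier R\<rbrakk> \<Longrightarrow>
      I +>\<^bsub>R\<^esub> x = I +>\<^bsub>R\<^esub> y \<longleftrightarrow> x \<ominus>\<^bsub>R\<^esub> y \<in> I"
proof -
  interpret R: ring R by fact
  interpret I: abelian_subgroup I R using I right_ideal_iff[OF \<open>ring R\<close>] by blast
  have Ir: "x \<otimes>\<^bsub>R\<^esub> r \<in> I" if "x \<in> I" "r \<in> carrier R" for x r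
    using I that right_ideal_iff[OF \<open>ring R\<close>] by blast
  show "carrier (cyclic_module R I) = {I +>\<^bsub>R\<^esub> x | x. x \<in> carrier R}"
    by (auto simp: quot_rmodule_def A_RCOSETS_def')
  show "\<zero>\<^bsub>cyclic_module R I\<^esub> = I" by (simp add: quot_rmodule_def)
  show "(I +>\<^bsub>R\<^esub> x) \<oplus>\<^bsub>cyclic_module R I\<^esub> (I +>\<^bsub>R\<^esub> y) = I +>\<^bsub>R\<^esub> (x \<oplus>\<^bsub>R\<^esub> y)"
    if "x \<in> carrier R" "y \<in> carrier R" for x y
    using that by (simp add: quot_rmodule_def I.a_rcos_sum)
  show eq: "I +>\<^bsub>R\<^esub> x = I +>\<^bsub>R\<^esub> y \<longleftrightarrow> x \<ominus>\<^bsub>R\<^esub> y \<in> I"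
    if "x \<in> carrier R" "y \<in> carrier R" for x y
    using that by (metis I.a_rcos_self I.a_repr_independence' I.a_rcos_module_minus I.a_subgroup R.ring_axioms)
  show "(I +>\<^bsub>R\<^esub> x) \<bullet>\<^bsub>cyclic_module R I\<^esub> r = I +>\<^bsub>R\<^esub> (x \<otimes>\<^bsub>R\<^esub> r)"
    if x: "x \<in> carrier R" and r: "r \<in> carrier R" for x r
  proof -
    have "I +>\<^bsub>R\<^esub> (y \<otimes>\<^bsub>R\<^esub> r) = I +>\<^bsub>R\<^esub> (x \<otimes>\<^bsub>R\<^esub> r)" if y: "y \<in> I +>\<^bsub>R\<^esub> x" for y
    proof -
      obtain i where i: "i \<in> I" "y = i \<oplus>\<^bsub>R\<^esub> x" using y by (auto simp: a_r_coset_def')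
      have ic: "i \<in> carrier R" using i by simp
      have "y \<otimes>\<^bsub>R\<^esub> r \<ominus>\<^bsub>R\<^esub> x \<otimes>\<^bsub>R\<^esub> r = i \<otimes>\<^bsub>R\<^esub> r"
        using ic x r i(2) by (simp add: R.l_distr R.minus_eq R.a_assoc R.r_neg)
      then show ?thesis using eq[of "y \<otimes>\<^bsub>R\<^esub> r" "x \<otimes>\<^bsub>R\<^esub> r"] Ir[OF i(1) r] ic x r i(2) by simp
    qed
    moreover have "x \<in> I +>\<^bsub>R\<^esub> x" using I.a_rcos_self x by blast
    ultimately have "(\<Union>y\<in>I +>\<^bsub>R\<^esub> x. I +>\<^bsub>R\<^esub> (y \<otimes>\<^bsub>R\<^esub> r)) = I +>\<^bsub>R\<^esub> (x \<otimes>\<^bsub>R\<^esub> r)"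
      by blast
    then show ?thesis by (simp add: quot_rmodule_def)
  qed
qed

lemma right_module_cyclic:
  assumes "ring R" and I: "right_ideal R I"
  shows "right_module R (cyclic_module R I)"
proof -
  interpret R: ring R by fact
  note cyc = cyclic_module_simps[OF assms]
  have z: "I = I +>\<^bsub>R\<^esub> \<zero>\<^bsub>R\<^esub>"
    using I right_ideal_iff[OF \<open>ring R\<close>]
    by (metis R.is_abelian_group abelian_group.a_coset_add_zero abelian_subgroup.axioms(1)
        additive_subgroup.a_subset)
  have "abelian_group (cyclic_module R I)"
  proof (rule abelian_groupI)
    show "\<zero>\<^bsub>cyclic_module R I\<^esub> \<in> carrier (cyclic_module R I)"
      using z cyc(1,2) by auto
    show "\<exists>y\<in>carrier (cyclic_module R I). y \<oplus>\<^bsub>cyclic_module R I\<^esub> x = \<zero>\<^bsub>cyclic_module R I\<^esub>"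
      if x: "x \<in> carrier (cyclic_module R I)" for x
    proof -
      obtain a where a: "a \<in> carrier R" "x = I +>\<^bsub>R\<^esub> a" using x cyc(1) by auto
      have "(I +>\<^bsub>R\<^esub> \<ominus>\<^bsub>R\<^esub> a) \<oplus>\<^bsub>cyclic_module R I\<^esub> x = I"
        using a z by (simp add: cyc(3) R.l_neg)
      then show ?thesis using a cyc(1,2) R.a_inv_closed by blast
    qed
    show "\<zero>\<^bsub>cyclic_module R I\<^esub> \<oplus>\<^bsub>cyclic_module R I\<^esub> x = x"
      if x: "x \<in> carrier (cyclic_module R I)" for x
    proof -
      obtain a where a: "a \<in> carrier R" "x = I +>\<^bsub>R\<^esub> a" using x cyc(1) by auto
      have "(I +>\<^bsub>R\<^esub> \<zero>\<^bsub>R\<^esub>) \<oplus>\<^bsub>cyclic_module R I\<^esub> x = x" using a by (simp add: cyc(3))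
      then show ?thesis using z cyc(2) by simp
    qed
  qed (auto simp: cyc(1,3) R.a_ac)
  then show ?thesis
    by (intro right_module.intro right_module_axioms.intro \<open>ring R\<close>)
       (auto simp: cyc(1,3,4) R.l_distr R.r_distr R.m_assoc)
qed

lemma lambek_filter_eq_cogenerated:
  assumes R: "ring R" and E: "injective_envelope TYPE('a set) (R :: ('a, 'b) ring_scheme) (E :: ('a, 'c, 'd) rmodule_scheme) \<iota>"
  shows "lambek_filter R = cogenerated_filter R E"
proof -
  interpret R: ring R by fact
  interpret E: right_module R E
    using E by (simp add: injective_envelope_def injective_rmodule_def)
  have \<iota>c: "\<iota> x \<in> carrier E" if "x \<in> carrier R" for x
    using E that by (auto simp: injective_envelope_def rhom_def)
  have \<iota>add: "\<iota> (x \<oplus>\<^bsub>R\<^esub> y) = \<iota> x \<oplus>\<^bsub>E\<^esub> \<iota> y" if "x \<in> carrier R" "y \<in> carrier R" for x y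
    using E that by (auto simp: injective_envelope_def rhom_def)
  have \<iota>act: "\<iota> (x \<otimes>\<^bsub>R\<^esub> r) = \<iota> x \<bullet>\<^bsub>E\<^esub> r" if "x \<in> carrier R" "r \<in> carrier R" for x r
    using E that by (auto simp: injective_envelope_def rhom_def)
  have \<iota>0: "\<iota> \<zero>\<^bsub>R\<^esub> = \<zero>\<^bsub>E\<^esub>"
    using \<iota>add[of "\<zero>\<^bsub>R\<^esub>" "\<zero>\<^bsub>R\<^esub>"] \<iota>c[of "\<zero>\<^bsub>R\<^esub>"] E.M.add.r_cancel_one' by fastforce
  have \<iota>inj: "x = \<zero>\<^bsub>R\<^esub>" if "x \<in> carrier R" "\<iota> x = \<zero>\<^bsub>E\<^esub>" for x
    using E that \<iota>0 by (auto simp: injective_envelope_def inj_on_def)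
  have act0: "e \<bullet>\<^bsub>E\<^esub> \<zero>\<^bsub>R\<^esub> = \<zero>\<^bsub>E\<^esub>" if "e \<in> carrier E" for e
    using E.act_r_distr[of e "\<zero>\<^bsub>R\<^esub>" "\<zero>\<^bsub>R\<^esub>"] that E.M.add.r_cancel_one' by fastforce
  have cyclic_sub: "rsubmodule R N {n \<bullet>\<^bsub>N\<^esub> r | r. r \<in> carrier R}"
    if N: "right_module R N" and n: "n \<in> carrier N" for N :: "('a, 'x, 'y) rmodule_scheme" and n
  proof -
    interpret N: right_module R N by fact
    have n0: "n \<bullet>\<^bsub>N\<^esub> \<zero>\<^bsub>R\<^esub> = \<zero>\<^bsub>N\<^esub>"
      using N.act_r_distr[of n "\<zero>\<^bsub>R\<^esub>" "\<zero>\<^bsub>R\<^esub>"] n N.M.add.r_cancel_one' by fastforce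
    have neg: "\<ominus>\<^bsub>N\<^esub> (n \<bullet>\<^bsub>N\<^esub> r) = n \<bullet>\<^bsub>N\<^esub> (\<ominus>\<^bsub>R\<^esub> r)" if r: "r \<in> carrier R" for r
    proof -
      have "n \<bullet>\<^bsub>N\<^esub> (\<ominus>\<^bsub>R\<^esub> r) \<oplus>\<^bsub>N\<^esub> n \<bullet>\<^bsub>N\<^esub> r = \<zero>\<^bsub>N\<^esub>"
        using n r n0 by (simp flip: N.act_r_distr add: R.l_neg)
      then show ?thesis using n r by (simp add: N.M.minus_equality)
    qed
    have "subgroup {n \<bullet>\<^bsub>N\<^esub> r | r. r \<in> carrier R} (add_monoid N)"
    proof (rule N.M.add.subgroupI)
      show "{n \<bullet>\<^bsub>N\<^esub> r | r. r \<in> carrier R} \<subseteq> carrier N" using n by auto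
      show "{n \<bullet>\<^bsub>N\<^esub> r | r. r \<in> carrier R} \<noteq> {}" by auto
      show "\<ominus>\<^bsub>N\<^esub> a \<in> {n \<bullet>\<^bsub>N\<^esub> r | r. r \<in> carrier R}"
        if "a \<in> {n \<bullet>\<^bsub>N\<^esub> r | r. r \<in> carrier R}" for a
        using that neg R.a_inv_closed by blast
      show "a \<oplus>\<^bsub>N\<^esub> b \<in> {n \<bullet>\<^bsub>N\<^esub> r | r. r \<in> carrier R}"
        if "a \<in> {n \<bullet>\<^bsub>N\<^esub> r | r. r \<in> carrier R}" "b \<in> {n \<bullet>\<^bsub>N\<^esub> r | r. r \<in> carrier R}" for a b
        using that n by clarsimp (metis N.act_r_distr R.a_closed)
    qed
    moreover have "x \<bullet>\<^bsub>N\<^esub> r \<in> {n \<bullet>\<^bsub>N\<^esub> r | r. r \<in> carrier R}"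
      if x: "x \<in> {n \<bullet>\<^bsub>N\<^esub> r | r. r \<in> carrier R}" and r: "r \<in> carrier R" for x r
    proof -
      obtain s where "s \<in> carrier R" "x = n \<bullet>\<^bsub>N\<^esub> s" using x by auto
      then have "x \<bullet>\<^bsub>N\<^esub> r = n \<bullet>\<^bsub>N\<^esub> (s \<otimes>\<^bsub>R\<^esub> r)" "s \<otimes>\<^bsub>R\<^esub> r \<in> carrier R"
        using n r by (simp_all add: N.act_assoc)
      then show ?thesis by auto
    qed
    ultimately show ?thesis
      unfolding rsubmodule_def additive_subgroup_def by simp
  qed
  have aux: "\<exists>z\<in>S. z \<noteq> c" if "S \<noteq> {c}" "c \<in> S" for S :: "'c set" and c
    using that by blast
  show ?thesis
  proof (intro equalityI subsetI)
    fix I assume I: "I \<in> lambek_filter R"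
    then have rI: "right_ideal R I" by (simp add: lambek_filter_def)
    note cyc = cyclic_module_simps[OF R rI]
    have "h x = \<zero>\<^bsub>E\<^esub>" if h: "h \<in> rhom R (cyclic_module R I) E"
      and x: "x \<in> carrier (cyclic_module R I)" for h x
    proof (rule ccontr)
      assume nz: "h x \<noteq> \<zero>\<^bsub>E\<^esub>"
      have hx: "h x \<in> carrier E" using h x by (auto simp: rhom_def)
      obtain c where c: "c \<in> carrier R" "x = I +>\<^bsub>R\<^esub> c" using x cyc(1) by auto
      let ?L = "{h x \<bullet>\<^bsub>E\<^esub> r | r. r \<in> carrier R}"
      have sub: "rsubmodule R E ?L" using cyclic_sub[OF E.right_module_axioms hx] .
      have "h x \<in> ?L" using hx by (auto intro!: exI[of _ "\<one>\<^bsub>R\<^esub>"])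
      then have "?L \<inter> \<iota> ` carrier R \<noteq> {\<zero>\<^bsub>E\<^esub>}"
        using E sub nz unfolding injective_envelope_def by blast
      moreover have "\<zero>\<^bsub>E\<^esub> \<in> ?L \<inter> \<iota> ` carrier R"
        using act0[OF hx] \<iota>0 by (force intro!: exI[of _ "\<zero>\<^bsub>R\<^esub>"])
      ultimately have "\<exists>z\<in>?L \<inter> \<iota> ` carrier R. z \<noteq> \<zero>\<^bsub>E\<^esub>"
        by (rule aux)
      then obtain z where z: "z \<in> ?L" "z \<in> \<iota> ` carrier R" "z \<noteq> \<zero>\<^bsub>E\<^esub>"
        by (elim bexE IntE)
      then obtain s y where s: "s \<in> carrier R" and y: "y \<in> carrier R"
        and sy: "h x \<bullet>\<^bsub>E\<^esub> s = \<iota> y" "\<iota> y \<noteq> \<zero>\<^bsub>E\<^esub>" by auto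
      have "y \<noteq> \<zero>\<^bsub>R\<^esub>" using sy \<iota>0 by auto
      then obtain r where r: "r \<in> carrier R" "(c \<otimes>\<^bsub>R\<^esub> s) \<otimes>\<^bsub>R\<^esub> r \<in> I" "y \<otimes>\<^bsub>R\<^esub> r \<noteq> \<zero>\<^bsub>R\<^esub>"
        using I c(1) s y by (auto simp: lambek_filter_def)
      have zI: "\<zero>\<^bsub>R\<^esub> \<in> I"
        using rI right_ideal_iff[OF R]
        by (meson abelian_subgroup.axioms(1) additive_subgroup.zero_closed)
      have "I +>\<^bsub>R\<^esub> (c \<otimes>\<^bsub>R\<^esub> (s \<otimes>\<^bsub>R\<^esub> r)) = I +>\<^bsub>R\<^esub> \<zero>\<^bsub>R\<^esub>"
        using cyc(5)[of "c \<otimes>\<^bsub>R\<^esub> (s \<otimes>\<^bsub>R\<^esub> r)" "\<zero>\<^bsub>R\<^esub>"] c s r by (simp add: R.m_assoc R.minus_eq)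
      then have "x \<bullet>\<^bsub>cyclic_module R I\<^esub> (s \<otimes>\<^bsub>R\<^esub> r) = x \<bullet>\<^bsub>cyclic_module R I\<^esub> \<zero>\<^bsub>R\<^esub>"
        using c s r by (simp add: cyc(4))
      then have "h x \<bullet>\<^bsub>E\<^esub> (s \<otimes>\<^bsub>R\<^esub> r) = h x \<bullet>\<^bsub>E\<^esub> \<zero>\<^bsub>R\<^esub>"
        using h x s r by (auto simp: rhom_def) (metis R.m_closed R.zero_closed)
      then have "\<iota> (y \<otimes>\<^bsub>R\<^esub> r) = \<zero>\<^bsub>E\<^esub>"
        using hx s r y sy act0 by (simp add: E.act_assoc \<iota>act)
      then show False using \<iota>inj r y by blast
    qed
    then show "I \<in> cogenerated_filter R E" using rI by (simp add: cogenerated_filter_def)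
  next
    fix I assume I: "I \<in> cogenerated_filter R E"
    then have rI: "right_ideal R I" by (simp add: cogenerated_filter_def)
    note cyc = cyclic_module_simps[OF R rI]
    let ?N = "cyclic_module R I"
    have N: "right_module R ?N" by (rule right_module_cyclic[OF R rI])
    have "\<exists>r\<in>carrier R. a \<otimes>\<^bsub>R\<^esub> r \<in> I \<and> b \<otimes>\<^bsub>R\<^esub> r \<noteq> \<zero>\<^bsub>R\<^esub>"
      if a: "a \<in> carrier R" and b: "b \<in> carrier R" "b \<noteq> \<zero>\<^bsub>R\<^esub>" for a b
    proof (rule ccontr)
      assume "\<not> ?thesis"
      then have *: "b \<otimes>\<^bsub>R\<^esub> r = \<zero>\<^bsub>R\<^esub>" if "r \<in> carrier R" "a \<otimes>\<^bsub>R\<^esub> r \<in> I" for r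
        using that by blast
      have same: "b \<otimes>\<^bsub>R\<^esub> r = b \<otimes>\<^bsub>R\<^esub> s"
        if rs: "r \<in> carrier R" "s \<in> carrier R" and e: "I +>\<^bsub>R\<^esub> (a \<otimes>\<^bsub>R\<^esub> r) = I +>\<^bsub>R\<^esub> (a \<otimes>\<^bsub>R\<^esub> s)" for r s
      proof -
        have "a \<otimes>\<^bsub>R\<^esub> (r \<ominus>\<^bsub>R\<^esub> s) \<in> I"
          using cyc(5)[of "a \<otimes>\<^bsub>R\<^esub> r" "a \<otimes>\<^bsub>R\<^esub> s"] e a rs
          by (simp add: R.minus_eq R.r_distr R.r_minus)
        then have "b \<otimes>\<^bsub>R\<^esub> (r \<ominus>\<^bsub>R\<^esub> s) = \<zero>\<^bsub>R\<^esub>" using *[of "r \<ominus>\<^bsub>R\<^esub> s"] rs by simp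
        then have "b \<otimes>\<^bsub>R\<^esub> r \<ominus>\<^bsub>R\<^esub> b \<otimes>\<^bsub>R\<^esub> s = \<zero>\<^bsub>R\<^esub>"
          using b rs by (simp add: R.minus_eq R.r_distr R.r_minus)
        then show ?thesis using b rs by (simp add: R.r_right_minus_eq)
      qed
      define L where "L = {(I +>\<^bsub>R\<^esub> a) \<bullet>\<^bsub>?N\<^esub> r | r. r \<in> carrier R}"
      have L: "L = {I +>\<^bsub>R\<^esub> (a \<otimes>\<^bsub>R\<^esub> r) | r. r \<in> carrier R}" unfolding L_def by (rule Collect_cong) (use a cyc(4) in metis)
      have sub: "rsubmodule R ?N L"
        unfolding L_def by (rule cyclic_sub[OF N]) (use a cyc(1) in auto)
      define h where "h = (\<lambda>C\<in>L. \<iota> (b \<otimes>\<^bsub>R\<^esub> (SOME r. r \<in> carrier R \<and> C = I +>\<^bsub>R\<^esub> (a \<otimes>\<^bsub>R\<^esub> r))))"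
      have h: "h (I +>\<^bsub>R\<^esub> (a \<otimes>\<^bsub>R\<^esub> r)) = \<iota> (b \<otimes>\<^bsub>R\<^esub> r)" if r: "r \<in> carrier R" for r
      proof -
        let ?s = "SOME s. s \<in> carrier R \<and> I +>\<^bsub>R\<^esub> (a \<otimes>\<^bsub>R\<^esub> r) = I +>\<^bsub>R\<^esub> (a \<otimes>\<^bsub>R\<^esub> s)"
        have "?s \<in> carrier R \<and> I +>\<^bsub>R\<^esub> (a \<otimes>\<^bsub>R\<^esub> r) = I +>\<^bsub>R\<^esub> (a \<otimes>\<^bsub>R\<^esub> ?s)"
          by (rule someI[of _ r]) (simp add: r)
        then have "b \<otimes>\<^bsub>R\<^esub> r = b \<otimes>\<^bsub>R\<^esub> ?s" using same[OF r] by blast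
        moreover have "I +>\<^bsub>R\<^esub> (a \<otimes>\<^bsub>R\<^esub> r) \<in> L" using r L by blast
        ultimately show ?thesis by (simp add: h_def)
      qed
      have "h \<in> rhom R (?N\<lparr>carrier := L\<rparr>) E"
        unfolding rhom_def
      proof (simp, intro conjI ballI)
        have "h C \<in> carrier E" if "C \<in> L" for C
          using that L h \<iota>c b by auto
        moreover have "h C = undefined" if "C \<notin> L" for C
          using that by (simp add: h_def)
        ultimately show "h \<in> L \<rightarrow>\<^sub>E carrier E" by (rule PiE_I)
        fix x assume x: "x \<in> L"
        then obtain r where r: "r \<in> carrier R" "x = I +>\<^bsub>R\<^esub> (a \<otimes>\<^bsub>R\<^esub> r)" using L by auto
        { fix y assume "y \<in> L"
          then obtain s where s: "s \<in> carrier R" "y = I +>\<^bsub>R\<^esub> (a \<otimes>\<^bsub>R\<^esub> s)" using L by auto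
          have "x \<oplus>\<^bsub>?N\<^esub> y = I +>\<^bsub>R\<^esub> (a \<otimes>\<^bsub>R\<^esub> (r \<oplus>\<^bsub>R\<^esub> s))"
            using a r s by (simp add: cyc(3) R.r_distr)
          then show "h (x \<oplus>\<^bsub>?N\<^esub> y) = h x \<oplus>\<^bsub>E\<^esub> h y"
            using h[of r] h[of s] h[of "r \<oplus>\<^bsub>R\<^esub> s"] r s a b by (simp add: R.r_distr \<iota>add) }
        { fix s assume s: "s \<in> carrier R"
          have "x \<bullet>\<^bsub>?N\<^esub> s = I +>\<^bsub>R\<^esub> (a \<otimes>\<^bsub>R\<^esub> (r \<otimes>\<^bsub>R\<^esub> s))"
            using a r s by (simp add: cyc(4) R.m_assoc)
          then show "h (x \<bullet>\<^bsub>?N\<^esub> s) = h x \<bullet>\<^bsub>E\<^esub> s"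
            using h[of r] h[of "r \<otimes>\<^bsub>R\<^esub> s"] r s a b by (simp flip: R.m_assoc add: \<iota>act) }
      qed
      then obtain k where k: "k \<in> rhom R ?N E" "\<forall>x\<in>L. k x = h x"
        using E N sub unfolding injective_envelope_def injective_rmodule_def by meson
      have "I +>\<^bsub>R\<^esub> (a \<otimes>\<^bsub>R\<^esub> \<one>\<^bsub>R\<^esub>) \<in> L" using L by blast
      then have "k (I +>\<^bsub>R\<^esub> (a \<otimes>\<^bsub>R\<^esub> \<one>\<^bsub>R\<^esub>)) = \<iota> b" using k(2) h[of "\<one>\<^bsub>R\<^esub>"] b by simp
      moreover have "k (I +>\<^bsub>R\<^esub> (a \<otimes>\<^bsub>R\<^esub> \<one>\<^bsub>R\<^esub>)) = \<zero>\<^bsub>E\<^esub>"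
      proof -
        have "I +>\<^bsub>R\<^esub> (a \<otimes>\<^bsub>R\<^esub> \<one>\<^bsub>R\<^esub>) \<in> carrier ?N" unfolding cyc(1) using a by blast
        then show ?thesis using I k(1) unfolding cogenerated_filter_def by blast
      qed
      ultimately show False using \<iota>inj b by auto
    qed
    then show "I \<in> lambek_filter R" using rI by (simp add: lambek_filter_def)
  qed
qed

end

theory Submission
  imports Defs
begin

text \<open>
  A Gabriel filter \<open>F\<close> is automatically differential: for \<open>I \<in> F\<close> the right ideal
  \<open>J = {a \<in> I. \<delta> a \<in> I}\<close> satisfies \<open>(J : a) = (I : \<delta> a)\<close> for \<open>a \<in> I\<close>, hence lies in \<open>F\<close>. So every
  derivation \<open>d\<close> extends to \<open>M\<^sub>F\<close> by \<open>f \<mapsto> d f - f \<delta>\<close>, a formula that is compatible with enlarging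
  \<open>F\<close>, and only inclusions between Gabriel filters remain to be shown. The filter of \<open>Q\<^sub>t\<^sub>o\<^sub>t\<close> is
  identified with the closure, under the transitivity axiom of Gabriel filters, of the union of all
  faithful perfect filters: this closure is itself faithful and perfect, because a faithful filter is
  perfect iff \<open>I R\<^sub>F = R\<^sub>F\<close> for all its members \<open>I\<close>, and this condition is preserved by transitivity.
\<close>

section \<open>Gabriel filters\<close>

text \<open>The main obstacle is \<open>Q_tot\<close>. It is a union of images of rings of quotients
  inside the Lambek one, and its filter is defined by vanishing tensor products, so nothing says at
  the outset that this filter satisfies the Gabriel axioms or that the union is itself of the form
  \<open>R_F\<close>. The union of the perfect filters need not satisfy the transitivity axiom,
  hence the closure. The condition \<open>I R_F = R_F\<close> suits such a closure because it is
  finitary: it is a single equation \<open>1 = \<Sum> i_k g_k\<close>, and one such equation can be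
  substituted into another. Its link with tensor products is
  \<open>R/I \<otimes> N = N / I N\<close>. From perfectness to this condition only the modules
  \<open>R/I\<close> are tested, and they have copies in every universe \<open>'a set + 'u\<close>;
  in the other direction the isomorphism is constructed for a module with any carrier type. So the
  perfect faithful filters are the same for every \<open>'u\<close>. The Goldie filter, defined by
  homomorphisms into all nonsingular modules, is likewise replaced by an explicit filter in terms of
  essential right ideals.\<close>

lemma (in ring) right_ideal_alt:
  "right_ideal R I \<longleftrightarrow> I \<subseteq> carrier R \<and> \<zero> \<in> I \<and> (\<forall>x\<in>I. \<forall>y\<in>I. x \<oplus> y \<in> I) \<and>
     (\<forall>x\<in>I. \<forall>r\<in>carrier R. x \<otimes> r \<in> I)" (is "?L \<longleftrightarrow> ?R")
proof
  assume L: ?L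
  then interpret abelian_subgroup I R using right_ideal_iff[OF ring_axioms] by blast
  show ?R using L right_ideal_iff[OF ring_axioms] a_subset by auto
next
  assume R: ?R
  have "\<ominus> x \<in> I" if "x \<in> I" for x
  proof -
    have "x \<otimes> (\<ominus> \<one>) \<in> I" "x \<in> carrier R" using R that by auto
    then show ?thesis by (simp add: r_minus)
  qed
  then have "subgroup I (add_monoid R)"
    using R by (intro add.subgroupI) auto
  then show ?L
    unfolding right_ideal_iff[OF ring_axioms]
    using R is_abelian_group abelian_subgroupI3 additive_subgroup_def by blast
qed

context ring
begin

lemma right_ideal_carrier [simp]: "right_ideal R (carrier R)"
  by (simp add: right_ideal_alt)

lemma right_ideal_subset: "right_ideal R I \<Longrightarrow> I \<subseteq> carrier R"
  by (simp add: right_ideal_alt)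

lemma right_ideal_mem [dest]: "\<lbrakk>right_ideal R I; x \<in> I\<rbrakk> \<Longrightarrow> x \<in> carrier R"
  by (auto simp: right_ideal_alt)

lemma right_ideal_Int: "\<lbrakk>right_ideal R I; right_ideal R J\<rbrakk> \<Longrightarrow> right_ideal R (I \<inter> J)"
  by (auto simp: right_ideal_alt)

lemma right_ideal_colon: "\<lbrakk>right_ideal R I; r \<in> carrier R\<rbrakk> \<Longrightarrow> right_ideal R (colon R I r)"
  by (auto simp: right_ideal_alt colon_def r_distr simp flip: m_assoc)

lemma right_ideal_minus: "\<lbrakk>right_ideal R I; x \<in> I; y \<in> I\<rbrakk> \<Longrightarrow> x \<ominus> y \<in> I"
proof -
  assume I: "right_ideal R I" "x \<in> I" "y \<in> I"
  then have "y \<otimes> (\<ominus> \<one>) \<in> I" "y \<in> carrier R" by (auto simp: right_ideal_alt)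
  then have "\<ominus> y \<in> I" by (simp add: r_minus)
  with I show ?thesis by (auto simp: right_ideal_alt minus_eq)
qed

lemma colon_member: "\<lbrakk>right_ideal R I; a \<in> I\<rbrakk> \<Longrightarrow> colon R I a = carrier R"
  by (auto simp: right_ideal_alt colon_def)

lemma colon_colon:
  "\<lbrakk>r \<in> carrier R; a \<in> carrier R\<rbrakk> \<Longrightarrow> colon R (colon R I r) a = colon R I (r \<otimes> a)"
  by (auto simp: colon_def m_assoc)

lemma colon_one: "right_ideal R I \<Longrightarrow> colon R I \<one> = I"
  by (auto simp: colon_def right_ideal_alt)

text \<open>Upward closure and intersections come out of transitivity: \<open>(J : a)\<close> is all
  of \<open>R\<close> for \<open>a \<in> J\<close>, and \<open>(I \<inter> J : a) = (J : a)\<close>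
  for \<open>a \<in> I\<close>.\<close>

lemma gabriel_filterI:
  assumes "\<And>I. I \<in> F \<Longrightarrow> right_ideal R I"
    and "carrier R \<in> F"
    and "\<And>I r. \<lbrakk>I \<in> F; r \<in> carrier R\<rbrakk> \<Longrightarrow> colon R I r \<in> F"
    and trans: "\<And>I J. \<lbrakk>I \<in> F; right_ideal R J; \<And>a. a \<in> I \<Longrightarrow> colon R J a \<in> F\<rbrakk> \<Longrightarrow> J \<in> F"
  shows "gabriel_filter R F"
proof -
  have up: "J \<in> F" if "I \<in> F" "right_ideal R J" "I \<subseteq> J" for I J
    using that colon_member[of J] assms(2) by (intro trans[OF that(1,2)]) auto
  have "I \<inter> J \<in> F" if "I \<in> F" "J \<in> F" for I J
  proof (rule trans[OF that(1)])
    have I: "right_ideal R I" "right_ideal R J" using that assms(1) by auto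
    then show "right_ideal R (I \<inter> J)" by (rule right_ideal_Int)
    fix a assume a: "a \<in> I"
    then have "colon R (I \<inter> J) a = colon R J a"
      using I by (auto simp: colon_def right_ideal_alt)
    then show "colon R (I \<inter> J) a \<in> F" using assms(3) that a I by auto
  qed
  then have int: "\<forall>I\<in>F. \<forall>J\<in>F. I \<inter> J \<in> F" by simp
  have tr: "\<forall>I J. I \<in> F \<and> right_ideal R J \<and> (\<forall>a\<in>I. colon R J a \<in> F) \<longrightarrow> J \<in> F"
  proof (intro allI impI)
    fix I J assume IJ: "I \<in> F \<and> right_ideal R J \<and> (\<forall>a\<in>I. colon R J a \<in> F)"
    then show "J \<in> F" using trans[of I J] by simp
  qed
  have up': "\<forall>I J. I \<in> F \<and> right_ideal R J \<and> I \<subseteq> J \<longrightarrow> J \<in> F" using up by meson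
  show ?thesis
    unfolding gabriel_filter_def
    by (rule conjI, simp add: assms(1), rule conjI, rule assms(2), rule conjI, rule up', rule conjI, rule int,
        rule conjI, simp add: assms(3), rule tr)
qed

end

locale gabriel = ring R for R :: "('a, 'b) ring_scheme" (structure) +
  fixes F :: "'a set set"
  assumes gabriel: "gabriel_filter R F"
begin

lemma filter_right_ideal: "I \<in> F \<Longrightarrow> right_ideal R I"
  and filter_carrier [simp]: "carrier R \<in> F"
  and filter_up: "\<lbrakk>I \<in> F; right_ideal R J; I \<subseteq> J\<rbrakk> \<Longrightarrow> J \<in> F"
  and filter_Int [simp]: "\<lbrakk>I \<in> F; J \<in> F\<rbrakk> \<Longrightarrow> I \<inter> J \<in> F"
  and filter_colon: "\<lbrakk>I \<in> F; r \<in> carrier R\<rbrakk> \<Longrightarrow> colon R I r \<in> F"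
  and filter_trans: "\<lbrakk>I \<in> F; right_ideal R J; \<And>a. a \<in> I \<Longrightarrow> colon R J a \<in> F\<rbrakk> \<Longrightarrow> J \<in> F"
proof -
  note G = gabriel[unfolded gabriel_filter_def]
  show "I \<in> F \<Longrightarrow> right_ideal R I" "carrier R \<in> F" "\<lbrakk>I \<in> F; J \<in> F\<rbrakk> \<Longrightarrow> I \<inter> J \<in> F"
    "\<lbrakk>I \<in> F; r \<in> carrier R\<rbrakk> \<Longrightarrow> colon R I r \<in> F"
    by (simp_all add: G[THEN conjunct1] G[THEN conjunct2, THEN conjunct1]
        G[THEN conjunct2, THEN conjunct2, THEN conjunct2, THEN conjunct1]
        G[THEN conjunct2, THEN conjunct2, THEN conjunct2, THEN conjunct2, THEN conjunct1])
  show "J \<in> F" if "I \<in> F" "right_ideal R J" "I \<subseteq> J"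
    by (rule G[THEN conjunct2, THEN conjunct2, THEN conjunct1, rule_format, of I J]) (simp add: that)
  show "J \<in> F" if "I \<in> F" "right_ideal R J" "\<And>a. a \<in> I \<Longrightarrow> colon R J a \<in> F"
    by (rule G[THEN conjunct2, THEN conjunct2, THEN conjunct2, THEN conjunct2, THEN conjunct2, rule_format, of I J])
       (simp add: that)
qed

lemma filter_mem: "\<lbrakk>I \<in> F; a \<in> I\<rbrakk> \<Longrightarrow> a \<in> carrier R"
  using filter_right_ideal by blast

lemma filter_subset: "I \<in> F \<Longrightarrow> I \<subseteq> carrier R"
  using filter_right_ideal right_ideal_subset by blast

lemma filter_add: "\<lbrakk>I \<in> F; a \<in> I; b \<in> I\<rbrakk> \<Longrightarrow> a \<oplus> b \<in> I"
  and filter_mult: "\<lbrakk>I \<in> F; a \<in> I; r \<in> carrier R\<rbrakk> \<Longrightarrow> a \<otimes> r \<in> I"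
  and filter_zero: "I \<in> F \<Longrightarrow> \<zero> \<in> I"
  using filter_right_ideal by (auto simp: right_ideal_alt)

lemma derivation_pullback:
  assumes \<delta>: "derivation R \<delta>" and I: "I \<in> F"
  shows "{a \<in> I. \<delta> a \<in> I} \<in> F"
proof (rule filter_trans[OF I])
  have \<delta>c: "\<delta> a \<in> carrier R" if "a \<in> carrier R" for a
    using \<delta> that by (auto simp: derivation_def)
  have \<delta>0: "\<delta> \<zero> = \<zero>"
    using \<delta> \<delta>c[of \<zero>] unfolding derivation_def by (metis add.l_cancel_one zero_closed r_zero)
  have rI: "right_ideal R I" using filter_right_ideal[OF I] .
  show "right_ideal R {a \<in> I. \<delta> a \<in> I}"
    using rI \<delta> \<delta>c \<delta>0 by (auto simp: right_ideal_alt derivation_def subset_iff)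
  fix a assume a: "a \<in> I"
  have ac: "a \<in> carrier R" using rI a by blast
  have "colon R {a \<in> I. \<delta> a \<in> I} a = colon R I (\<delta> a)"
  proof -
    \<comment> \<open>In the product rule for \<open>\<delta> (a \<otimes> r)\<close> the summand
      \<open>a \<otimes> \<delta> r\<close> already lies in the right ideal \<open>I\<close>, so
      only \<open>\<delta> a \<otimes> r\<close> matters.\<close>
    have "\<delta> (a \<otimes> r) \<in> I \<longleftrightarrow> \<delta> a \<otimes> r \<in> I" if r: "r \<in> carrier R" for r
    proof -
      have e: "\<delta> (a \<otimes> r) = \<delta> a \<otimes> r \<oplus> a \<otimes> \<delta> r" using \<delta> ac r by (auto simp: derivation_def)
      have i: "a \<otimes> \<delta> r \<in> I" using rI a \<delta>c[OF r] by (auto simp: right_ideal_alt)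
      have "\<delta> a \<otimes> r = \<delta> (a \<otimes> r) \<ominus> a \<otimes> \<delta> r"
        unfolding e using ac r \<delta>c by (simp add: minus_eq a_assoc r_neg)
      then have "\<delta> a \<otimes> r \<in> I" if "\<delta> (a \<otimes> r) \<in> I" using right_ideal_minus[OF rI that i] by simp
      moreover have "\<delta> (a \<otimes> r) \<in> I" if "\<delta> a \<otimes> r \<in> I"
        unfolding e using that i rI by (simp add: right_ideal_alt)
      ultimately show ?thesis by blast
    qed
    moreover have "a \<otimes> r \<in> I" if "r \<in> carrier R" for r using rI a that by (auto simp: right_ideal_alt)
    ultimately show ?thesis by (auto simp: colon_def)
  qed
  then show "colon R {a \<in> I. \<delta> a \<in> I} a \<in> F" using filter_colon[OF I \<delta>c[OF ac]] by simp
qed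

end

section \<open>Lambek, classical and Goldie filters\<close>

context ring
begin

section \<open>Dense right ideals as an upper bound for faithful filters\<close>

lemma lambek_filterE:
  assumes "I \<in> lambek_filter R" "a \<in> carrier R" "b \<in> carrier R" "b \<noteq> \<zero>"
  obtains r where "r \<in> carrier R" "a \<otimes> r \<in> I" "b \<otimes> r \<noteq> \<zero>"
  using assms unfolding lambek_filter_def mem_Collect_eq by meson

lemma lambek_gabriel: "gabriel_filter R (lambek_filter R)"
proof (rule gabriel_filterI)
  show "carrier R \<in> lambek_filter R"
    by (force simp: lambek_filter_def intro!: bexI[of _ \<one>])
  show "colon R I r \<in> lambek_filter R" if I: "I \<in> lambek_filter R" and r: "r \<in> carrier R" for I r
    unfolding lambek_filter_def
  proof (intro CollectI conjI ballI impI)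
    show "right_ideal R (colon R I r)" using that by (simp add: lambek_filter_def right_ideal_colon)
    fix a b assume ab: "a \<in> carrier R" "b \<in> carrier R" "b \<noteq> \<zero>"
    then have "r \<otimes> a \<in> carrier R" using that by simp
    then obtain s where "s \<in> carrier R" "(r \<otimes> a) \<otimes> s \<in> I" "b \<otimes> s \<noteq> \<zero>"
      using lambek_filterE[OF I _ ab(2,3)] by blast
    then show "\<exists>s\<in>carrier R. a \<otimes> s \<in> colon R I r \<and> b \<otimes> s \<noteq> \<zero>"
      using r ab(1) by (auto simp: colon_def m_assoc)
  qed
  show "J \<in> lambek_filter R"
    if I: "I \<in> lambek_filter R" and J: "right_ideal R J"
      and c: "\<And>a. a \<in> I \<Longrightarrow> colon R J a \<in> lambek_filter R" for I J
    unfolding lambek_filter_def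
  proof (intro CollectI conjI ballI impI J)
    fix a b assume ab: "a \<in> carrier R" "b \<in> carrier R" "b \<noteq> \<zero>"
    then obtain r where r: "r \<in> carrier R" "a \<otimes> r \<in> I" "b \<otimes> r \<noteq> \<zero>"
      using lambek_filterE[OF I] by blast
    then have "b \<otimes> r \<in> carrier R" "\<one> \<in> carrier R" using ab by auto
    \<comment> \<open>Density of \<open>(J : a r)\<close> is applied to the pair
      \<open>\<one>\<close>, \<open>b r\<close>, so that the product \<open>r s\<close> serves for
      \<open>a\<close> and \<open>b\<close>.\<close>
    then obtain s where s: "s \<in> carrier R" "\<one> \<otimes> s \<in> colon R J (a \<otimes> r)" "(b \<otimes> r) \<otimes> s \<noteq> \<zero>"
      using lambek_filterE[OF c[OF r(2)] _ _ r(3)] by blast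
    then show "\<exists>s\<in>carrier R. a \<otimes> s \<in> J \<and> b \<otimes> s \<noteq> \<zero>"
      using r ab by (intro bexI[of _ "r \<otimes> s"]) (auto simp: colon_def m_assoc)
  qed
qed (simp add: lambek_filter_def)

lemma right_ideal_ann: "b \<in> carrier R \<Longrightarrow> right_ideal R (ann R (self_module R) b)"
  by (auto simp: right_ideal_alt ann_def r_distr simp flip: m_assoc)

text \<open>If density of \<open>I\<close> fails at \<open>a\<close>, \<open>b\<close>, then
  \<open>(I : a)\<close> annihilates \<open>b\<close>; so \<open>b\<close> is a nonzero torsion
  element of \<open>R\<close>, against faithfulness.\<close>

lemma faithful_subset_lambek:
  assumes "gabriel_filter R F" and "faithful R F"
  shows "F \<subseteq> lambek_filter R"
proof
  interpret gabriel R F by unfold_locales (rule assms)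
  fix I assume I: "I \<in> F"
  have "\<exists>r\<in>carrier R. a \<otimes> r \<in> I \<and> b \<otimes> r \<noteq> \<zero>"
    if ab: "a \<in> carrier R" "b \<in> carrier R" "b \<noteq> \<zero>" for a b
  proof (rule ccontr)
    assume "\<not> ?thesis"
    then have "colon R I a \<subseteq> ann R (self_module R) b" by (auto simp: colon_def ann_def)
    then have "ann R (self_module R) b \<in> F"
      using filter_up[OF filter_colon[OF I ab(1)] right_ideal_ann] ab by blast
    then show False using ab \<open>faithful R F\<close> by (auto simp: faithful_def torsion_def)
  qed
  then show "I \<in> lambek_filter R" using filter_right_ideal[OF I] by (simp add: lambek_filter_def)
qed

text \<open>Density at \<open>a = \<one>\<close> yields an element of the ideal not killed by
  \<open>b\<close>, so no dense right ideal annihilates a nonzero element.\<close>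

lemma faithful_if_subset_lambek:
  assumes "gabriel_filter R F" and "F \<subseteq> lambek_filter R"
  shows "faithful R F"
proof -
  have "b = \<zero>" if b: "b \<in> carrier R" "ann R (self_module R) b \<in> F" for b
  proof (rule ccontr)
    assume "b \<noteq> \<zero>"
    moreover have "ann R (self_module R) b \<in> lambek_filter R" using b assms by auto
    ultimately obtain r where "\<one> \<otimes> r \<in> ann R (self_module R) b" "b \<otimes> r \<noteq> \<zero>" "r \<in> carrier R"
      using lambek_filterE[OF _ one_closed b(1)] by blast
    then show False by (auto simp: ann_def)
  qed
  moreover have "ann R (self_module R) \<zero> = carrier R" by (auto simp: ann_def)
  then have "ann R (self_module R) \<zero> \<in> F" using assms(1) by (simp add: gabriel_filter_def)
  ultimately show ?thesis by (auto simp: faithful_def torsion_def)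
qed

section \<open>Regular elements and the classical filter\<close>

lemma regular_elementsD:
  assumes "t \<in> regular_elements R"
  shows "t \<in> carrier R" "\<And>x. \<lbrakk>x \<in> carrier R; t \<otimes> x = \<zero>\<rbrakk> \<Longrightarrow> x = \<zero>"
    "\<And>x. \<lbrakk>x \<in> carrier R; x \<otimes> t = \<zero>\<rbrakk> \<Longrightarrow> x = \<zero>"
  using assms unfolding regular_elements_def mem_Collect_eq by meson+

lemma regular_mult:
  assumes "s \<in> regular_elements R" "t \<in> regular_elements R"
  shows "s \<otimes> t \<in> regular_elements R"
proof -
  note * = regular_elementsD(1)[OF assms(1)] regular_elementsD(1)[OF assms(2)]
    regular_elementsD(2,3)[OF assms(1)] regular_elementsD(2,3)[OF assms(2)]
  show ?thesis
    unfolding regular_elements_def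
  proof (intro CollectI conjI ballI impI)
    fix x assume x: "x \<in> carrier R"
    show "x = \<zero>" if "s \<otimes> t \<otimes> x = \<zero>"
      by (rule *(5)[OF x *(3)]) (use that x *(1,2) in \<open>simp_all add: m_assoc\<close>)
    show "x = \<zero>" if "x \<otimes> (s \<otimes> t) = \<zero>"
      by (rule *(4)[OF x *(6)]) (use that x *(1,2) in \<open>simp_all add: m_assoc\<close>)
  qed (simp add: *(1,2))
qed

lemma regular_one: "\<one> \<in> regular_elements R"
  by (simp add: regular_elements_def)

lemma coset_eq_ideal_iff: "\<lbrakk>right_ideal R I; x \<in> carrier R\<rbrakk> \<Longrightarrow> I +> x = I \<longleftrightarrow> x \<in> I"
  using cyclic_module_simps(5)[OF ring_axioms, of I x \<zero>]
  by (simp add: minus_eq a_coset_add_zero right_ideal_subset)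

lemma ann_cyclic_coset:
  assumes "right_ideal R I" "x \<in> carrier R"
  shows "ann R (cyclic_module R I) (I +> x) = colon R I x"
  unfolding ann_def colon_def
  by (intro Collect_cong)
     (use assms in \<open>simp add: cyclic_module_simps(2,4)[OF ring_axioms] coset_eq_ideal_iff cong: conj_cong\<close>)

lemma classical_filter_alt:
  "I \<in> classical_filter R \<longleftrightarrow>
     right_ideal R I \<and> (\<forall>x\<in>carrier R. \<exists>t\<in>regular_elements R. x \<otimes> t \<in> I)"
proof (cases "right_ideal R I")
  case True
  note cyc = cyclic_module_simps[OF ring_axioms True]
  have "(I +> x) \<bullet>\<^bsub>cyclic_module R I\<^esub> t = I \<longleftrightarrow> x \<otimes> t \<in> I"
    if "x \<in> carrier R" "t \<in> regular_elements R" for x t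
    using that True regular_elementsD(1)[OF that(2)] by (simp add: cyc(4) coset_eq_ideal_iff)
  then have "(\<exists>t\<in>regular_elements R. (I +> x) \<bullet>\<^bsub>cyclic_module R I\<^esub> t = I) \<longleftrightarrow>
      (\<exists>t\<in>regular_elements R. x \<otimes> t \<in> I)" if "x \<in> carrier R" for x
    using that by (intro bex_cong) auto
  moreover have "(\<forall>C\<in>{I +> x | x. x \<in> carrier R}. P C) \<longleftrightarrow> (\<forall>x\<in>carrier R. P (I +> x))" for P
    by blast
  ultimately have "(\<forall>C\<in>carrier (cyclic_module R I). \<exists>t\<in>regular_elements R.
      C \<bullet>\<^bsub>cyclic_module R I\<^esub> t = \<zero>\<^bsub>cyclic_module R I\<^esub>) \<longleftrightarrow>
      (\<forall>x\<in>carrier R. \<exists>t\<in>regular_elements R. x \<otimes> t \<in> I)"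
    unfolding cyc(1,2) by simp
  then show ?thesis using True unfolding classical_filter_def by simp
qed (simp add: classical_filter_def)

lemma classical_filterE:
  assumes "I \<in> classical_filter R" "x \<in> carrier R"
  obtains t where "t \<in> regular_elements R" "x \<otimes> t \<in> I"
  using assms unfolding classical_filter_alt by blast

text \<open>Every \<open>x\<close> has its own regular multiplier into \<open>I\<close>, not only
  \<open>\<one>\<close>, so colon ideals inherit the property by looking at \<open>r x\<close>. For
  transitivity a multiplier into \<open>I\<close> is followed by one into the colon ideal, and the
  product of the two is regular.\<close>

lemma classical_gabriel: "gabriel_filter R (classical_filter R)"
proof (rule gabriel_filterI)
  show "carrier R \<in> classical_filter R"
    using regular_one by (auto simp: classical_filter_alt)
  show "colon R I r \<in> classical_filter R" if I: "I \<in> classical_filter R" and r: "r \<in> carrier R" for I r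
    unfolding classical_filter_alt
  proof (intro conjI ballI)
    show "right_ideal R (colon R I r)" using I r by (simp add: classical_filter_def right_ideal_colon)
    fix x assume x: "x \<in> carrier R"
    obtain t where "t \<in> regular_elements R" "r \<otimes> x \<otimes> t \<in> I"
      using classical_filterE[OF I m_closed[OF r x]] .
    then show "\<exists>t\<in>regular_elements R. x \<otimes> t \<in> colon R I r"
      using x r regular_elementsD(1)[of t] by (intro bexI[of _ t]) (simp_all add: colon_def m_assoc)
  qed
  show "J \<in> classical_filter R"
    if I: "I \<in> classical_filter R" and J: "right_ideal R J"
      and c: "\<And>a. a \<in> I \<Longrightarrow> colon R J a \<in> classical_filter R" for I J
    unfolding classical_filter_alt
  proof (intro conjI ballI J)
    fix x assume x: "x \<in> carrier R"
    then obtain t where t: "t \<in> regular_elements R" "x \<otimes> t \<in> I"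
      using classical_filterE[OF I] by blast
    then obtain s where s: "s \<in> regular_elements R" "\<one> \<otimes> s \<in> colon R J (x \<otimes> t)"
      using classical_filterE[OF c[OF t(2)] one_closed] by blast
    have "x \<otimes> (t \<otimes> s) \<in> J"
      using s(2) x regular_elementsD(1)[OF t(1)] regular_elementsD(1)[OF s(1)]
      by (simp add: colon_def m_assoc)
    then show "\<exists>t\<in>regular_elements R. x \<otimes> t \<in> J"
      using regular_mult[OF t(1) s(1)] by blast
  qed
qed (simp add: classical_filter_def)

text \<open>A regular \<open>t\<close> with \<open>a t \<in> I\<close> also gives
  \<open>b t \<noteq> 0\<close> for every nonzero \<open>b\<close>.\<close>

lemma classical_subset_lambek: "classical_filter R \<subseteq> lambek_filter R"
proof
  fix I assume I: "I \<in> classical_filter R"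
  have "\<exists>r\<in>carrier R. a \<otimes> r \<in> I \<and> b \<otimes> r \<noteq> \<zero>"
    if ab: "a \<in> carrier R" "b \<in> carrier R" "b \<noteq> \<zero>" for a b
    using classical_filterE[OF I ab(1)] regular_elementsD ab(2,3) by metis
  then show "I \<in> lambek_filter R" using I by (simp add: lambek_filter_def classical_filter_def)
qed

section \<open>Essential right ideals and the second singular filter\<close>

lemma principal_right_ideal: "a \<in> carrier R \<Longrightarrow> right_ideal R {a \<otimes> r | r. r \<in> carrier R}"
  unfolding right_ideal_alt
  by auto (metis r_null zero_closed, metis a_closed r_distr, metis m_assoc m_closed)

text \<open>A nonzero right ideal contains a nonzero principal one, so it is enough to meet the
  ideals \<open>a R\<close>.\<close>

lemma essential_alt:
  "essential_right_ideal R I \<longleftrightarrow> right_ideal R I \<and>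
     (\<forall>a\<in>carrier R. a \<noteq> \<zero> \<longrightarrow> (\<exists>r\<in>carrier R. a \<otimes> r \<in> I \<and> a \<otimes> r \<noteq> \<zero>))"
  (is "_ \<longleftrightarrow> _ \<and> ?A")
proof (cases "right_ideal R I")
  case True
  have ?A if E: "essential_right_ideal R I"
  proof (intro ballI impI)
    fix a assume a: "a \<in> carrier R" "a \<noteq> \<zero>"
    let ?J = "{a \<otimes> r | r. r \<in> carrier R}"
    have "a \<otimes> \<one> \<in> ?J" by blast
    then have "?J \<noteq> {\<zero>}" using a by auto
    then have "I \<inter> ?J \<noteq> {\<zero>}"
      using E principal_right_ideal[OF a(1)] unfolding essential_right_ideal_def by blast
    moreover have "\<zero> \<in> I" "\<zero> \<in> ?J"
      using True principal_right_ideal[OF a(1)] unfolding right_ideal_alt by auto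
    ultimately show "\<exists>r\<in>carrier R. a \<otimes> r \<in> I \<and> a \<otimes> r \<noteq> \<zero>" by blast
  qed
  moreover have "essential_right_ideal R I" if A: ?A
    unfolding essential_right_ideal_def
  proof (intro conjI allI impI True)
    fix J assume J: "right_ideal R J \<and> J \<noteq> {\<zero>}"
    then obtain a where a: "a \<in> J" "a \<noteq> \<zero>" unfolding right_ideal_alt by blast
    then obtain r where "r \<in> carrier R" "a \<otimes> r \<in> I" "a \<otimes> r \<noteq> \<zero>" using A J by blast
    moreover have "a \<otimes> r \<in> J" using J a calculation unfolding right_ideal_alt by blast
    ultimately show "I \<inter> J \<noteq> {\<zero>}" by blast
  qed
  ultimately show ?thesis using True by blast
qed (simp add: essential_right_ideal_def)

lemma essentialE:
  assumes "essential_right_ideal R I" "a \<in> carrier R" "a \<noteq> \<zero>"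
  obtains r where "r \<in> carrier R" "a \<otimes> r \<in> I" "a \<otimes> r \<noteq> \<zero>"
  using assms unfolding essential_alt by meson

lemma essential_right_ideal: "essential_right_ideal R I \<Longrightarrow> right_ideal R I"
  by (simp add: essential_right_ideal_def)

lemma essential_carrier: "essential_right_ideal R (carrier R)"
  unfolding essential_alt by (force intro!: bexI[of _ \<one>])

lemma essential_up:
  "\<lbrakk>essential_right_ideal R I; right_ideal R J; I \<subseteq> J\<rbrakk> \<Longrightarrow> essential_right_ideal R J"
  by (rule essential_alt[THEN iffD2]) (metis essentialE subsetD)

lemma essential_colon:
  assumes I: "essential_right_ideal R I" and r: "r \<in> carrier R"
  shows "essential_right_ideal R (colon R I r)"
  unfolding essential_alt
proof (intro conjI ballI impI)
  have rI: "right_ideal R I" by (rule essential_right_ideal[OF I])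
  then show "right_ideal R (colon R I r)" using r by (simp add: right_ideal_colon)
  fix a assume a: "a \<in> carrier R" "a \<noteq> \<zero>"
  \<comment> \<open>If \<open>r a = 0\<close>, then \<open>a\<close> itself lies in the colon ideal.
    Otherwise essentiality of \<open>I\<close> is applied to \<open>r a\<close>, and
    \<open>(r a) s \<noteq> 0\<close> forces \<open>a s \<noteq> 0\<close>.\<close>
  show "\<exists>s\<in>carrier R. a \<otimes> s \<in> colon R I r \<and> a \<otimes> s \<noteq> \<zero>"
  proof (cases "r \<otimes> a = \<zero>")
    case True
    then show ?thesis using a rI by (intro bexI[of _ \<one>]) (auto simp: colon_def right_ideal_alt)
  next
    case False
    moreover have "r \<otimes> a \<in> carrier R" using a r by auto
    ultimately obtain s where "s \<in> carrier R" "(r \<otimes> a) \<otimes> s \<in> I" "(r \<otimes> a) \<otimes> s \<noteq> \<zero>"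
      using essentialE[OF I] by blast
    then show ?thesis using a r by (intro bexI[of _ s]) (auto simp: colon_def m_assoc)
  qed
qed

text \<open>The cosets \<open>I + x\<close> with \<open>(I : x)\<close> essential are the singular
  elements of \<open>R/I\<close>. The condition says that they contain the image of an essential
  right ideal, that is, that \<open>R/I\<close> is its own second singular submodule.
  \<open>goldie_filter_eq\<close> identifies this with the Goldie filter.\<close>

definition second_singular_filter :: "'a set set" where
  "second_singular_filter = {I. right_ideal R I \<and>
     (\<exists>J. essential_right_ideal R J \<and> (\<forall>x\<in>J. essential_right_ideal R (colon R I x)))}"

lemma second_singularI:
  "\<lbrakk>right_ideal R I; essential_right_ideal R J; \<And>x. x \<in> J \<Longrightarrow> essential_right_ideal R (colon R I x)\<rbrakk>
    \<Longrightarrow> I \<in> second_singular_filter"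
  by (auto simp: second_singular_filter_def)

lemma essential_second_singular:
  "essential_right_ideal R I \<Longrightarrow> I \<in> second_singular_filter"
  by (rule second_singularI[OF essential_right_ideal essential_carrier essential_colon])

text \<open>The singular submodule of \<open>R/I\<close> is essential in the second singular submodule.\<close>

lemma second_singular_absorb:
  assumes I: "right_ideal R I" and L: "essential_right_ideal R L"
    and IL: "\<And>x. x \<in> L \<Longrightarrow> colon R I x \<in> second_singular_filter"
  shows "I \<in> second_singular_filter"
proof (rule second_singularI[OF I, of "{x \<in> carrier R. essential_right_ideal R (colon R I x)}"])
  let ?Z = "{x \<in> carrier R. essential_right_ideal R (colon R I x)}"
  show "essential_right_ideal R ?Z" unfolding essential_alt[of ?Z]
  proof (intro conjI ballI impI)
    have sum: "essential_right_ideal R (colon R I (x \<oplus> y))"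
      if x: "x \<in> ?Z" and y: "y \<in> ?Z" for x y
    proof (unfold essential_alt, intro conjI ballI impI)
      show "right_ideal R (colon R I (x \<oplus> y))" using x y I by (auto intro: right_ideal_colon)
      fix a assume a: "a \<in> carrier R" "a \<noteq> \<zero>"
      then obtain r where r: "r \<in> carrier R" "a \<otimes> r \<in> colon R I x" "a \<otimes> r \<noteq> \<zero>"
        using essentialE[of "colon R I x"] x by blast
      then obtain s where s: "s \<in> carrier R" "a \<otimes> r \<otimes> s \<in> colon R I y" "a \<otimes> r \<otimes> s \<noteq> \<zero>"
        using essentialE[of "colon R I y" "a \<otimes> r"] y a by blast
      have "x \<otimes> (a \<otimes> r) \<otimes> s \<in> I" using I r s by (auto simp: colon_def right_ideal_alt)
      then show "\<exists>r\<in>carrier R. a \<otimes> r \<in> colon R I (x \<oplus> y) \<and> a \<otimes> r \<noteq> \<zero>"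
        using r s x y a I
        by (intro bexI[of _ "r \<otimes> s"]) (auto simp: colon_def l_distr right_ideal_alt m_assoc)
    qed
    show "right_ideal R ?Z"
      unfolding right_ideal_alt[of ?Z]
      using sum colon_member[OF I] I essential_carrier essential_colon
      by (auto simp: right_ideal_alt simp flip: colon_colon)
    fix a assume a: "a \<in> carrier R" "a \<noteq> \<zero>"
    then obtain r where r: "r \<in> carrier R" "a \<otimes> r \<in> L" "a \<otimes> r \<noteq> \<zero>"
      using essentialE[OF L] by blast
    have ar: "a \<otimes> r \<in> carrier R" using a r by auto
    obtain L' where L': "essential_right_ideal R L'"
      "\<And>y. y \<in> L' \<Longrightarrow> essential_right_ideal R (colon R (colon R I (a \<otimes> r)) y)"
      using IL[OF r(2)] by (auto simp: second_singular_filter_def)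
    have L'c: "L' \<subseteq> carrier R" using essential_right_ideal[OF L'(1)] by (rule right_ideal_subset)
    \<comment> \<open>Either some \<open>a r y\<close> with \<open>y \<in> L'\<close> is a nonzero
      element of \<open>?Z\<close>, or \<open>a r\<close> kills \<open>L'\<close>; then
      \<open>(I : a r)\<close> contains \<open>L'\<close>, so it is essential and \<open>a r\<close>
      itself lies in \<open>?Z\<close>.\<close>
    show "\<exists>r\<in>carrier R. a \<otimes> r \<in> ?Z \<and> a \<otimes> r \<noteq> \<zero>"
    proof (cases "\<exists>y\<in>L'. a \<otimes> r \<otimes> y \<noteq> \<zero>")
      case True
      then obtain y where y: "y \<in> L'" "a \<otimes> r \<otimes> y \<noteq> \<zero>" by blast
      then show ?thesis using L'(2)[OF y(1)] L'c a r ar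
        by (intro bexI[of _ "r \<otimes> y"]) (auto simp: colon_colon m_assoc)
    next
      case False
      then have "L' \<subseteq> colon R I (a \<otimes> r)" using L'c I by (auto simp: colon_def right_ideal_alt)
      then have "a \<otimes> r \<in> ?Z"
        using essential_up[OF L'(1) right_ideal_colon[OF I ar]] ar by blast
      then show ?thesis using r by blast
    qed
  qed
qed auto

text \<open>Transitivity is two absorptions: for \<open>x \<in> J\<close> the ideal
  \<open>(K : x)\<close> is reached from the essential ideal \<open>(I : x)\<close>, and then
  \<open>K\<close> is reached from the essential ideal \<open>J\<close>.\<close>

lemma second_singular_gabriel: "gabriel_filter R second_singular_filter"
proof (rule gabriel_filterI)
  show "carrier R \<in> second_singular_filter"
    by (rule essential_second_singular[OF essential_carrier])
  show "colon R I r \<in> second_singular_filter" if I: "I \<in> second_singular_filter" and r: "r \<in> carrier R" for I r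
  proof -
    obtain J where J: "right_ideal R I" "essential_right_ideal R J"
      "\<And>x. x \<in> J \<Longrightarrow> essential_right_ideal R (colon R I x)"
      using I by (auto simp: second_singular_filter_def)
    show ?thesis
      by (rule second_singularI[OF right_ideal_colon[OF J(1) r] essential_colon[OF J(2) r]])
         (use J r in \<open>auto simp: colon_def[of R J] colon_colon\<close>)
  qed
  show "K \<in> second_singular_filter"
    if I: "I \<in> second_singular_filter" and K: "right_ideal R K"
      and c: "\<And>a. a \<in> I \<Longrightarrow> colon R K a \<in> second_singular_filter" for I K
  proof -
    obtain J where J: "right_ideal R I" "essential_right_ideal R J"
      "\<And>x. x \<in> J \<Longrightarrow> essential_right_ideal R (colon R I x)"
      using I by (auto simp: second_singular_filter_def)
    show ?thesis
    proof (rule second_singular_absorb[OF K J(2)])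
      fix x assume x: "x \<in> J"
      then have xc: "x \<in> carrier R" using essential_right_ideal[OF J(2)] by blast
      show "colon R K x \<in> second_singular_filter"
      proof (rule second_singular_absorb[OF right_ideal_colon[OF K xc] J(3)[OF x]])
        fix y assume "y \<in> colon R I x"
        then show "colon R (colon R K x) y \<in> second_singular_filter"
          using c xc by (auto simp: colon_def[of R I] colon_colon)
      qed
    qed
  qed
qed (simp add: second_singular_filter_def)

end

section \<open>Right modules and the identification of the Goldie filter\<close>

context right_module
begin

lemma act_zero [simp]: "x \<in> carrier M \<Longrightarrow> x \<bullet>\<^bsub>M\<^esub> \<zero> = \<zero>\<^bsub>M\<^esub>"
  using act_r_distr[of x \<zero> \<zero>] M.add.r_cancel_one' by fastforce

lemma zero_act [simp]: "r \<in> carrier R \<Longrightarrow> \<zero>\<^bsub>M\<^esub> \<bullet>\<^bsub>M\<^esub> r = \<zero>\<^bsub>M\<^esub>"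
  using act_l_distr[of "\<zero>\<^bsub>M\<^esub>" "\<zero>\<^bsub>M\<^esub>" r] M.add.r_cancel_one' by fastforce

lemma minus_act: "\<lbrakk>x \<in> carrier M; r \<in> carrier R\<rbrakk> \<Longrightarrow> (\<ominus>\<^bsub>M\<^esub> x) \<bullet>\<^bsub>M\<^esub> r = \<ominus>\<^bsub>M\<^esub> (x \<bullet>\<^bsub>M\<^esub> r)"
  by (rule M.minus_equality[symmetric]) (simp_all add: M.l_neg flip: act_l_distr)

lemma act_minus: "\<lbrakk>x \<in> carrier M; r \<in> carrier R\<rbrakk> \<Longrightarrow> x \<bullet>\<^bsub>M\<^esub> (\<ominus> r) = \<ominus>\<^bsub>M\<^esub> (x \<bullet>\<^bsub>M\<^esub> r)"
  by (rule M.minus_equality[symmetric]) (simp_all add: R.l_neg flip: act_r_distr)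

lemma ann_act:
  "\<lbrakk>x \<in> carrier M; r \<in> carrier R\<rbrakk> \<Longrightarrow> ann R M (x \<bullet>\<^bsub>M\<^esub> r) = colon R (ann R M x) r"
  by (rule Set.set_eqI) (simp add: ann_def colon_def act_assoc cong: conj_cong)

lemma right_ideal_ann_elem: "x \<in> carrier M \<Longrightarrow> right_ideal R (ann R M x)"
  by (auto simp: R.right_ideal_alt ann_def act_r_distr act_assoc)

end

text \<open>Transports a cyclic module, whose carrier has type \<open>'a set\<close>, into the type
  \<open>'a set + 'u\<close> over which the definitions of the Goldie filter and of perfect filters
  quantify.\<close>

definition Inl_copy :: "('a, 'm, 'c) rmodule_scheme \<Rightarrow> ('a, 'm + 'u) rmodule" where
  "Inl_copy M = \<lparr>carrier = Inl ` carrier M, monoid.mult = undefined, one = undefined,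
     ring.zero = Inl \<zero>\<^bsub>M\<^esub>, add = (\<lambda>x y. Inl (projl x \<oplus>\<^bsub>M\<^esub> projl y)),
     act = (\<lambda>x r. Inl (projl x \<bullet>\<^bsub>M\<^esub> r))\<rparr>"

lemma Inl_copy_simps [simp]:
  "carrier (Inl_copy M) = Inl ` carrier M" "\<zero>\<^bsub>Inl_copy M\<^esub> = Inl \<zero>\<^bsub>M\<^esub>"
  "x \<oplus>\<^bsub>Inl_copy M\<^esub> y = Inl (projl x \<oplus>\<^bsub>M\<^esub> projl y)" "x \<bullet>\<^bsub>Inl_copy M\<^esub> r = Inl (projl x \<bullet>\<^bsub>M\<^esub> r)"
  by (simp_all add: Inl_copy_def)

lemma ann_Inl_copy: "ann R (Inl_copy M) (Inl x) = ann R M x"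
  by (simp add: ann_def)

lemma right_module_Inl_copy:
  assumes "right_module R M"
  shows "right_module R (Inl_copy M)"
proof -
  interpret right_module R M by fact
  have "abelian_group (Inl_copy M)"
    by (rule abelian_groupI) (auto simp: M.a_ac intro!: bexI[of _ "\<ominus>\<^bsub>M\<^esub> _"] M.l_neg)
  then show ?thesis
    by (intro right_module.intro right_module_axioms.intro R.ring_axioms)
       (auto simp: act_l_distr act_r_distr act_assoc)
qed

text \<open>A homomorphism into a nonsingular module kills the elements with essential annihilator.
  On \<open>R/I\<close> it thus kills the image of \<open>J\<close>, and then every coset, since the
  essential ideal \<open>(J : r)\<close> carries the coset of \<open>r\<close> into that image.
  Conversely, dividing \<open>R/I\<close> by its torsion submodule gives one nonsingular module
  whose single projection already tests membership of \<open>I\<close>.\<close>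

lemma (in ring) goldie_filter_eq: "goldie_filter TYPE('u) R = second_singular_filter"
proof (intro equalityI subsetI)
  fix I assume I: "I \<in> second_singular_filter"
  then obtain J where J: "right_ideal R I" "essential_right_ideal R J"
      "\<And>x. x \<in> J \<Longrightarrow> essential_right_ideal R (colon R I x)"
    by (auto simp: second_singular_filter_def)
  note cyc = cyclic_module_simps[OF ring_axioms J(1)]
  show "I \<in> goldie_filter TYPE('u) R"
    unfolding goldie_filter_def cogenerated_filter_def
  proof (intro CollectI conjI allI impI ballI J(1))
    fix N :: "('a, 'a set + 'u) rmodule" and h x
    assume N: "right_module R N \<and> nonsingular R N" and h: "h \<in> rhom R (cyclic_module R I) N"
      and x: "x \<in> carrier (cyclic_module R I)"
    interpret N: right_module R N using N by simp
    have ess0: "n = \<zero>\<^bsub>N\<^esub>" if "n \<in> carrier N" "essential_right_ideal R (ann R N n)" for n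
      using N that by (auto simp: nonsingular_def)
    have hc: "h (I +> r) \<in> carrier N" if "r \<in> carrier R" for r
      using h that cyc(1) by (auto simp: rhom_def)
    have hact: "h (I +> (r \<otimes> s)) = h (I +> r) \<bullet>\<^bsub>N\<^esub> s" if "r \<in> carrier R" "s \<in> carrier R" for r s
    proof -
      have "I +> r \<in> carrier (cyclic_module R I)" using that cyc(1) by auto
      then have "h ((I +> r) \<bullet>\<^bsub>cyclic_module R I\<^esub> s) = h (I +> r) \<bullet>\<^bsub>N\<^esub> s"
        using h that by (auto simp: rhom_def)
      then show ?thesis using cyc(4) that by simp
    qed
    have h0: "h (I +> r) = \<zero>\<^bsub>N\<^esub>" if "r \<in> I" for r
    proof -
      have rc: "r \<in> carrier R" using that J(1) by auto
      have "I +> r = I +> (r \<otimes> \<zero>)" using that J(1) rc cyc(5)[of r \<zero>] by (simp add: minus_eq)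
      then show ?thesis using hact[OF rc zero_closed]  hc rc by simp
    qed
    have hJ: "h (I +> r) = \<zero>\<^bsub>N\<^esub>" if r: "r \<in> J" for r
    proof -
      have rc: "r \<in> carrier R" using r J(2) by (auto simp: essential_alt)
      have "colon R I r \<subseteq> ann R N (h (I +> r))"
        using hact[OF rc, symmetric] h0 by (auto simp: colon_def ann_def)
      then show ?thesis using essential_up[OF J(3)[OF r] N.right_ideal_ann_elem] ess0 hc[OF rc] by blast
    qed
    have all: "h (I +> r) = \<zero>\<^bsub>N\<^esub>" if rc: "r \<in> carrier R" for r
    proof -
      have "colon R J r \<subseteq> ann R N (h (I +> r))"
        using hact[OF rc, symmetric] hJ by (auto simp: colon_def ann_def)
      then show ?thesis using essential_up[OF essential_colon[OF J(2) rc] N.right_ideal_ann_elem] ess0 hc[OF rc] by blast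
    qed
    then show "h x = \<zero>\<^bsub>N\<^esub>" using x cyc(1) by auto
  qed
next
  interpret G: gabriel R second_singular_filter
    by unfold_locales (rule second_singular_gabriel)
  fix I assume I: "I \<in> goldie_filter TYPE('u) R"
  then have rI: "right_ideal R I" by (simp add: goldie_filter_def)
  \<comment> \<open>\<open>J/I\<close> is the torsion submodule of \<open>R/I\<close> for the second
    singular filter. Transitivity of that filter makes \<open>R/J\<close> nonsingular.\<close>
  define J where "J = {x \<in> carrier R. colon R I x \<in> second_singular_filter}"
  have rJ: "right_ideal R J" unfolding right_ideal_alt
  proof (intro conjI ballI)
    show "\<zero> \<in> J" using rI colon_member[OF rI] by (auto simp: J_def right_ideal_alt)
    fix x assume x: "x \<in> J"
    { fix y assume y: "y \<in> J"
      have "colon R I x \<inter> colon R I y \<subseteq> colon R I (x \<oplus> y)"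
        using x y rI by (auto simp: colon_def J_def l_distr right_ideal_alt)
      then show "x \<oplus> y \<in> J"
        using x y rI G.filter_up[OF G.filter_Int right_ideal_colon] unfolding J_def by blast }
    fix r assume "r \<in> carrier R"
    then show "x \<otimes> r \<in> J" using x G.filter_colon by (auto simp: J_def simp flip: colon_colon)
  qed (auto simp: J_def)
  note cycI = cyclic_module_simps[OF ring_axioms rI]
  note cycJ = cyclic_module_simps[OF ring_axioms rJ]
  let ?N = "Inl_copy (cyclic_module R J) :: ('a, 'a set + 'u) rmodule"
  note Jeq = coset_eq_ideal_iff[OF rJ]
  have IJ: "I \<subseteq> J" using rI colon_member[OF rI] by (auto simp: J_def)
  have N: "right_module R ?N"
    by (rule right_module_Inl_copy[OF right_module_cyclic[OF ring_axioms rJ]])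
  have annN: "ann R ?N (Inl (J +> x)) = colon R J x" if "x \<in> carrier R" for x
    using that by (simp add: ann_Inl_copy ann_cyclic_coset[OF rJ])
  have "nonsingular R ?N"
  proof -
    have "x \<in> J" if x: "x \<in> carrier R" and e: "essential_right_ideal R (colon R J x)" for x
    proof -
      have "colon R I x \<in> second_singular_filter"
        by (rule G.filter_trans[OF essential_second_singular[OF e] right_ideal_colon[OF rI x]])
           (use x in \<open>auto simp: colon_colon J_def colon_def[of R "{y \<in> carrier R. P y}" for P]\<close>)
      then show ?thesis using x by (simp add: J_def)
    qed
    then have unique: "y = Inl J" if y: "y \<in> carrier ?N" "essential_right_ideal R (ann R ?N y)" for y
    proof -
      obtain x where x: "x \<in> carrier R" "y = Inl (J +> x)" using y(1) by (auto simp: cycJ(1))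
      then have "x \<in> J" using \<open>\<And>x. \<lbrakk>x \<in> carrier R; essential_right_ideal R (colon R J x)\<rbrakk> \<Longrightarrow> x \<in> J\<close> y(2) annN
        by simp
      then show ?thesis using x Jeq by simp
    qed
    have z: "J +> \<zero> = J" "\<zero> \<in> J" using rJ by (simp_all add: Jeq right_ideal_alt)
    have InlJ: "Inl J \<in> carrier ?N" unfolding Inl_copy_simps cycJ(1) using z(1) by blast
    have annJ: "ann R ?N (Inl J) = carrier R"
      using annN[of \<zero>] colon_member[OF rJ z(2)] z(1) by simp
    have "{y \<in> carrier ?N. essential_right_ideal R (ann R ?N y)} = {Inl J}"
    proof (intro equalityI subsetI)
      show "y \<in> {Inl J}" if "y \<in> {y \<in> carrier ?N. essential_right_ideal R (ann R ?N y)}" for y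
        using unique[of y] that unfolding mem_Collect_eq singleton_iff by blast
      show "y \<in> {y \<in> carrier ?N. essential_right_ideal R (ann R ?N y)}" if "y \<in> {Inl J}" for y
        using that InlJ annJ essential_carrier unfolding mem_Collect_eq singleton_iff by metis
    qed
    then show ?thesis by (simp only: nonsingular_def Inl_copy_simps(2) cycJ(2))
  qed
  then have IN: "I \<in> cogenerated_filter R ?N" using I N by (simp add: goldie_filter_def)
  \<comment> \<open>The projection from \<open>R/I\<close> to \<open>R/J\<close>. Its vanishing puts
    \<open>\<one>\<close> into \<open>J\<close>, which means that \<open>I = (I : \<one>)\<close>
    lies in the filter.\<close>
  define h where "h = (\<lambda>C\<in>carrier (cyclic_module R I). Inl (J +> (SOME r. r \<in> carrier R \<and> C = I +> r)) :: 'a set + 'u)"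
  have h: "h (I +> r) = Inl (J +> r)" if r: "r \<in> carrier R" for r
  proof -
    define s where "s = (SOME s. s \<in> carrier R \<and> I +> r = I +> s)"
    have s: "s \<in> carrier R \<and> I +> r = I +> s" unfolding s_def by (rule someI[of _ r]) (simp add: r)
    then have "J +> s = J +> r" using cycI(5)[of s r] cycJ(5)[of s r] r IJ by auto
    then show ?thesis using r by (auto simp: h_def cycI(1) simp flip: s_def)
  qed
  have "h \<in> rhom R (cyclic_module R I) ?N"
    unfolding rhom_def
  proof (intro CollectI conjI ballI)
    show "h \<in> carrier (cyclic_module R I) \<rightarrow>\<^sub>E carrier ?N"
    proof (rule PiE_I)
      fix C assume "C \<in> carrier (cyclic_module R I)"
      then obtain x where x: "x \<in> carrier R" "C = I +> x" unfolding cycI(1) by blast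
      show "h C \<in> carrier ?N" unfolding x(2) h[OF x(1)] Inl_copy_simps cycJ(1) using x(1) by blast
    qed (simp add: h_def)
    fix C assume "C \<in> carrier (cyclic_module R I)"
    then obtain x where x: "x \<in> carrier R" "C = I +> x" unfolding cycI(1) by blast
    { fix D assume "D \<in> carrier (cyclic_module R I)"
      then obtain y where y: "y \<in> carrier R" "D = I +> y" unfolding cycI(1) by blast
      show "h (C \<oplus>\<^bsub>cyclic_module R I\<^esub> D) = h C \<oplus>\<^bsub>?N\<^esub> h D"
        using x y by (simp add: cycI(3) cycJ(3) h) }
    fix r assume r: "r \<in> carrier R"
    then show "h (C \<bullet>\<^bsub>cyclic_module R I\<^esub> r) = h C \<bullet>\<^bsub>?N\<^esub> r"
      using x by (simp add: cycI(4) cycJ(4) h)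
  qed
  moreover have "I +> \<one> \<in> carrier (cyclic_module R I)" unfolding cycI(1) by blast
  ultimately have "h (I +> \<one>) = \<zero>\<^bsub>?N\<^esub>"
    using IN unfolding cogenerated_filter_def by blast
  then have "\<one> \<in> J" using h[of \<one>] Jeq[of \<one>] by (simp add: cycJ(2))
  then show "I \<in> second_singular_filter" using rI by (simp add: J_def colon_one)
qed

text \<open>Density at a pair \<open>a\<close>, \<open>a\<close> is the elementwise form of
  essentiality.\<close>

lemma (in ring) lambek_subset_second_singular: "lambek_filter R \<subseteq> second_singular_filter"
proof
  fix I assume "I \<in> lambek_filter R"
  then have "essential_right_ideal R I"
    unfolding essential_alt
  proof (intro conjI ballI impI)
    show "\<exists>r\<in>carrier R. a \<otimes> r \<in> I \<and> a \<otimes> r \<noteq> \<zero>" if "a \<in> carrier R" "a \<noteq> \<zero>" for a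
      using lambek_filterE[OF \<open>I \<in> lambek_filter R\<close> that(1) that] by blast
  qed (simp add: lambek_filter_def)
  then show "I \<in> second_singular_filter" by (rule essential_second_singular)
qed

section \<open>Modules of quotients\<close>

lemma (in ring) right_module_self: "right_module R (self_module R)"
proof (intro right_module.intro right_module_axioms.intro ring_axioms)
  show "abelian_group (self_module R)"
    by (rule abelian_groupI) (auto simp: a_ac intro!: bexI[of _ "\<ominus> _"] l_neg)
qed (auto simp: l_distr r_distr m_assoc)

text \<open>
  An element of \<open>M\<^sub>F\<close> is handled through a map \<open>\<nu> : J \<rightarrow> M\<close> that is linear modulo the torsion
  submodule; \<open>qgerm\<close> is the class of the induced homomorphism into \<open>M/T(M)\<close>.
\<close>

definition tcoset ::
    "('a, 'b) ring_scheme \<Rightarrow> 'a set set \<Rightarrow> ('a, 'm, 'c) rmodule_scheme \<Rightarrow> 'm \<Rightarrow> 'm set" where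
  "tcoset R F M x = torsion R F M +>\<^bsub>M\<^esub> x"

definition tlin ::
    "('a, 'b) ring_scheme \<Rightarrow> 'a set set \<Rightarrow> ('a, 'm, 'c) rmodule_scheme \<Rightarrow> 'a set \<Rightarrow> ('a \<Rightarrow> 'm) \<Rightarrow> bool" where
  "tlin R F M J \<nu> \<longleftrightarrow> (\<forall>a\<in>J. \<nu> a \<in> carrier M) \<and>
     (\<forall>a\<in>J. \<forall>b\<in>J. tcoset R F M (\<nu> (a \<oplus>\<^bsub>R\<^esub> b)) = tcoset R F M (\<nu> a \<oplus>\<^bsub>M\<^esub> \<nu> b)) \<and>
     (\<forall>a\<in>J. \<forall>r\<in>carrier R. tcoset R F M (\<nu> (a \<otimes>\<^bsub>R\<^esub> r)) = tcoset R F M (\<nu> a \<bullet>\<^bsub>M\<^esub> r))"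

definition qgerm ::
    "('a, 'b) ring_scheme \<Rightarrow> 'a set set \<Rightarrow> ('a, 'm, 'c) rmodule_scheme \<Rightarrow> 'a set \<Rightarrow> ('a \<Rightarrow> 'm)
      \<Rightarrow> ('a, 'm) germ" where
  "qgerm R F M J \<nu> = germ R F M J (\<lambda>a. tcoset R F M (\<nu> a))"

section \<open>Calculus of germs for a fixed filter\<close>

locale quotients = right_module R M + G?: gabriel R F
  for R :: "('a, 'b) ring_scheme" (structure) and M :: "('a, 'm, 'c) rmodule_scheme" (structure)
    and F :: "'a set set"
begin

abbreviation "T \<equiv> torsion R F M"
abbreviation "cl \<equiv> tcoset R F M"
abbreviation "N \<equiv> mod_torsion R F M"
abbreviation "Q \<equiv> module_of_quotients R F M"
abbreviation "lin \<equiv> tlin R F M"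
abbreviation "qg \<equiv> qgerm R F M"

lemma torsion_act: "\<lbrakk>x \<in> T; r \<in> carrier R\<rbrakk> \<Longrightarrow> x \<bullet>\<^bsub>M\<^esub> r \<in> T"
proof -
  assume x: "x \<in> T" and r: "r \<in> carrier R"
  then have "ann R M (x \<bullet>\<^bsub>M\<^esub> r) = colon R (ann R M x) r"
    by (simp add: ann_act torsion_def)
  then show ?thesis using x r G.filter_colon by (auto simp: torsion_def)
qed

lemma torsion_zero: "\<zero>\<^bsub>M\<^esub> \<in> T"
proof -
  have "ann R M \<zero>\<^bsub>M\<^esub> = carrier R" by (auto simp: ann_def)
  then show ?thesis by (simp add: torsion_def)
qed

sublocale T: abelian_subgroup T M
proof (rule abelian_subgroupI3)
  have "x \<oplus>\<^bsub>M\<^esub> y \<in> T" if "x \<in> T" "y \<in> T" for x y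
  proof -
    have "ann R M x \<inter> ann R M y \<subseteq> ann R M (x \<oplus>\<^bsub>M\<^esub> y)"
      using that by (auto simp: ann_def torsion_def act_l_distr)
    then show ?thesis
      using G.filter_up[OF G.filter_Int right_ideal_ann_elem, of "ann R M x" "ann R M y" "x \<oplus>\<^bsub>M\<^esub> y"] that
      by (simp add: torsion_def)
  qed
  moreover have "\<ominus>\<^bsub>M\<^esub> x \<in> T" if "x \<in> T" for x
    using torsion_act[OF that, of "\<ominus> \<one>"] that by (simp add: act_minus torsion_def)
  ultimately show "additive_subgroup T M"
    using torsion_zero by (intro additive_subgroup.intro M.add.subgroupI) (auto simp: torsion_def)
qed (rule M.abelian_group_axioms)

lemma cl_eq_iff: "\<lbrakk>x \<in> carrier M; y \<in> carrier M\<rbrakk> \<Longrightarrow> cl x = cl y \<longleftrightarrow> x \<ominus>\<^bsub>M\<^esub> y \<in> T"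
  unfolding tcoset_def
proof
  assume xy: "x \<in> carrier M" "y \<in> carrier M"
  { assume "T +>\<^bsub>M\<^esub> x = T +>\<^bsub>M\<^esub> y"
    then obtain t where "t \<in> T" "x = t \<oplus>\<^bsub>M\<^esub> y" using T.a_rcos_self[OF xy(1)] by (auto simp: a_r_coset_def')
    then show "x \<ominus>\<^bsub>M\<^esub> y \<in> T" using xy by (simp add: M.minus_eq M.a_assoc M.r_neg) }
  assume "x \<ominus>\<^bsub>M\<^esub> y \<in> T"
  moreover have "x = (x \<ominus>\<^bsub>M\<^esub> y) \<oplus>\<^bsub>M\<^esub> y" using xy by (simp add: M.minus_eq M.a_assoc M.l_neg)
  ultimately have "x \<in> T +>\<^bsub>M\<^esub> y" unfolding a_r_coset_def' by blast
  then show "T +>\<^bsub>M\<^esub> x = T +>\<^bsub>M\<^esub> y" using T.a_repr_independence' xy by simp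
qed

lemma cl_zero_iff: "x \<in> carrier M \<Longrightarrow> cl x = cl \<zero>\<^bsub>M\<^esub> \<longleftrightarrow> x \<in> T"
  using M.add.inv_one by (simp add: cl_eq_iff M.minus_eq a_inv_def)

lemma mem_clE:
  assumes "y \<in> cl x" "x \<in> carrier M"
  obtains t where "t \<in> T" "y = t \<oplus>\<^bsub>M\<^esub> x" "y \<in> carrier M" "cl y = cl x"
proof -
  obtain t where t: "t \<in> T" "y = t \<oplus>\<^bsub>M\<^esub> x" using assms by (auto simp: tcoset_def a_r_coset_def')
  then have "y \<in> carrier M" "y \<ominus>\<^bsub>M\<^esub> x = t" using assms(2) by (auto simp: M.minus_eq M.a_assoc M.r_neg)
  with t show thesis using that cl_eq_iff assms(2) by auto
qed

lemma mem_cl_self: "x \<in> carrier M \<Longrightarrow> x \<in> cl x"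
  unfolding tcoset_def by (rule T.a_rcos_self)

lemma quot_carrier: "carrier N = cl ` carrier M"
  by (auto simp: quot_rmodule_def A_RCOSETS_def' tcoset_def)

lemma quot_zero: "\<zero>\<^bsub>N\<^esub> = cl \<zero>\<^bsub>M\<^esub>"
  using M.a_coset_add_zero[OF T.a_subset] by (simp add: quot_rmodule_def tcoset_def)

lemma cl_add: "\<lbrakk>x \<in> carrier M; y \<in> carrier M\<rbrakk> \<Longrightarrow> cl (x \<oplus>\<^bsub>M\<^esub> y) = cl x \<oplus>\<^bsub>N\<^esub> cl y"
  by (simp add: quot_rmodule_def tcoset_def T.a_rcos_sum)

lemma cl_act: "\<lbrakk>x \<in> carrier M; r \<in> carrier R\<rbrakk> \<Longrightarrow> cl (x \<bullet>\<^bsub>M\<^esub> r) = cl x \<bullet>\<^bsub>N\<^esub> r"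
proof -
  assume x: "x \<in> carrier M" and r: "r \<in> carrier R"
  have "cl (y \<bullet>\<^bsub>M\<^esub> r) = cl (x \<bullet>\<^bsub>M\<^esub> r)" if y: "y \<in> cl x" for y
  proof -
    obtain t where t: "t \<in> T" "y = t \<oplus>\<^bsub>M\<^esub> x" using mem_clE[OF y x] by blast
    have "y \<bullet>\<^bsub>M\<^esub> r \<ominus>\<^bsub>M\<^esub> x \<bullet>\<^bsub>M\<^esub> r = t \<bullet>\<^bsub>M\<^esub> r"
      using t x r by (simp add: act_l_distr M.minus_eq M.a_assoc M.r_neg)
    then show ?thesis using t x r torsion_act by (simp add: cl_eq_iff)
  qed
  then have "(\<Union>y\<in>cl x. cl (y \<bullet>\<^bsub>M\<^esub> r)) = cl (x \<bullet>\<^bsub>M\<^esub> r)"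
    using mem_cl_self[OF x] by blast
  then show ?thesis by (simp add: quot_rmodule_def tcoset_def)
qed

sublocale N: right_module R N
proof (intro right_module.intro right_module_axioms.intro R.ring_axioms)
  show "abelian_group N"
  proof (rule abelian_groupI)
    show "\<exists>y\<in>carrier N. y \<oplus>\<^bsub>N\<^esub> x = \<zero>\<^bsub>N\<^esub>" if x: "x \<in> carrier N" for x
    proof -
      obtain m where "m \<in> carrier M" "x = cl m" using x by (auto simp: quot_carrier)
      then show ?thesis
        by (intro bexI[of _ "cl (\<ominus>\<^bsub>M\<^esub> m)"]) (simp_all add: quot_carrier quot_zero M.l_neg flip: cl_add)
    qed
  qed (auto simp: quot_carrier quot_zero M.a_ac simp flip: cl_add)
qed (auto simp: quot_carrier act_l_distr act_r_distr act_assoc simp flip: cl_add cl_act)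

lemma cl_closed [simp]: "x \<in> carrier M \<Longrightarrow> cl x \<in> carrier N"
  by (simp add: quot_carrier)

lemma cl_minus: "x \<in> carrier M \<Longrightarrow> cl (\<ominus>\<^bsub>M\<^esub> x) = \<ominus>\<^bsub>N\<^esub> cl x"
  by (rule N.M.minus_equality[symmetric]) (simp_all add: quot_zero M.l_neg flip: cl_add)

lemma linD:
  assumes "lin J \<nu>"
  shows lin_closed: "a \<in> J \<Longrightarrow> \<nu> a \<in> carrier M"
    and lin_add: "\<lbrakk>a \<in> J; b \<in> J\<rbrakk> \<Longrightarrow> cl (\<nu> (a \<oplus> b)) = cl (\<nu> a) \<oplus>\<^bsub>N\<^esub> cl (\<nu> b)"
    and lin_act: "\<lbrakk>a \<in> J; r \<in> carrier R\<rbrakk> \<Longrightarrow> cl (\<nu> (a \<otimes> r)) = cl (\<nu> a) \<bullet>\<^bsub>N\<^esub> r"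
  using assms by (simp_all add: tlin_def cl_add cl_act)

lemma linI:
  assumes "\<And>a. a \<in> J \<Longrightarrow> \<nu> a \<in> carrier M"
    and "\<And>a b. \<lbrakk>a \<in> J; b \<in> J\<rbrakk> \<Longrightarrow> cl (\<nu> (a \<oplus> b)) = cl (\<nu> a) \<oplus>\<^bsub>N\<^esub> cl (\<nu> b)"
    and "\<And>a r. \<lbrakk>a \<in> J; r \<in> carrier R\<rbrakk> \<Longrightarrow> cl (\<nu> (a \<otimes> r)) = cl (\<nu> a) \<bullet>\<^bsub>N\<^esub> r"
  shows "lin J \<nu>"
  using assms by (simp add: tlin_def cl_add cl_act)

lemma lin_subset: "\<lbrakk>lin J \<nu>; K \<subseteq> J\<rbrakk> \<Longrightarrow> lin K \<nu>"
  unfolding tlin_def by blast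

lemma lin_plus:
  assumes "I \<in> F" "J \<in> F" "lin I \<nu>" "lin J \<mu>"
  shows "lin (I \<inter> J) (\<lambda>a. \<nu> a \<oplus>\<^bsub>M\<^esub> \<mu> a)"
  using assms(1,2)
  by (intro linI)
     (auto simp: cl_add linD[OF assms(3)] linD[OF assms(4)] G.filter_add G.filter_mult N.M.a_ac N.act_l_distr)

lemma lin_minus:
  assumes "J \<in> F" "lin J \<nu>"
  shows "lin J (\<lambda>a. \<ominus>\<^bsub>M\<^esub> \<nu> a)"
  using assms(1)
  by (intro linI)
     (auto simp: cl_minus linD[OF assms(2)] G.filter_add G.filter_mult N.M.minus_add N.minus_act)

lemma lin_zero: "lin J (\<lambda>_. \<zero>\<^bsub>M\<^esub>)"
  by (intro linI) (auto simp: quot_zero[symmetric])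

lemma lin_mult: "m \<in> carrier M \<Longrightarrow> J \<subseteq> carrier R \<Longrightarrow> lin J (\<lambda>a. m \<bullet>\<^bsub>M\<^esub> a)"
  by (intro linI) (auto simp: subset_iff N.act_r_distr N.act_assoc cl_act)

lemma lin_colon:
  assumes "J \<in> F" "lin J \<nu>" "r \<in> carrier R"
  shows "lin (colon R J r) (\<lambda>a. \<nu> (r \<otimes> a))"
  using assms(1,3)
  by (intro linI) (auto simp: colon_def linD[OF assms(2)] R.r_distr simp flip: R.m_assoc)

text \<open>Choosing a representative of each value lifts a homomorphism into \<open>M/T(M)\<close>
  to a map into \<open>M\<close>; the choices spoil linearity only by torsion elements.\<close>

lemma local_homs_iff:
  "(I, f) \<in> local_homs R F M \<longleftrightarrow> I \<in> F \<and> (\<exists>\<nu>. lin I \<nu> \<and> f = restrict (\<lambda>a. cl (\<nu> a)) I)"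
proof
  assume L: "(I, f) \<in> local_homs R F M"
  then have I: "I \<in> F" and f: "f \<in> I \<rightarrow>\<^sub>E carrier N"
    and fa: "\<And>x y. \<lbrakk>x \<in> I; y \<in> I\<rbrakk> \<Longrightarrow> f (x \<oplus> y) = f x \<oplus>\<^bsub>N\<^esub> f y"
    and fr: "\<And>x r. \<lbrakk>x \<in> I; r \<in> carrier R\<rbrakk> \<Longrightarrow> f (x \<otimes> r) = f x \<bullet>\<^bsub>N\<^esub> r"
    by (auto simp: local_homs_def rhom_def)
  define \<nu> where "\<nu> a = (SOME m. m \<in> carrier M \<and> cl m = f a)" for a
  have \<nu>: "\<nu> a \<in> carrier M \<and> cl (\<nu> a) = f a" if "a \<in> I" for a
  proof -
    have "f a \<in> cl ` carrier M" using f that unfolding quot_carrier by (rule PiE_mem)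
    then have "\<exists>m. m \<in> carrier M \<and> cl m = f a" by auto
    then show ?thesis unfolding \<nu>_def by (rule someI_ex)
  qed
  have "lin I \<nu>"
    using I by (intro linI) (simp_all add: \<nu> fa fr G.filter_add G.filter_mult)
  moreover have "f = restrict (\<lambda>a. cl (\<nu> a)) I"
    using f \<nu> by (auto simp: fun_eq_iff PiE_def extensional_def)
  ultimately show "I \<in> F \<and> (\<exists>\<nu>. lin I \<nu> \<and> f = restrict (\<lambda>a. cl (\<nu> a)) I)" using I by blast
next
  assume "I \<in> F \<and> (\<exists>\<nu>. lin I \<nu> \<and> f = restrict (\<lambda>a. cl (\<nu> a)) I)"
  then obtain \<nu> where I: "I \<in> F" and \<nu>: "lin I \<nu>" and f: "f = restrict (\<lambda>a. cl (\<nu> a)) I" by blast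
  show "(I, f) \<in> local_homs R F M"
    using I unfolding f local_homs_def rhom_def
    by (auto simp: linD[OF \<nu>] G.filter_add G.filter_mult)
qed

lemma germ_rel_equiv: "equiv (local_homs R F M) (germ_rel R F M)"
proof (rule equivI)
  show "germ_rel R F M \<subseteq> local_homs R F M \<times> local_homs R F M"
    unfolding germ_rel_def by blast
  show "refl_on (local_homs R F M) (germ_rel R F M)"
  proof (rule refl_onI)
    fix x assume x: "x \<in> local_homs R F M"
    obtain I f where e: "x = (I, f)" by (cases x)
    then have "I \<in> F" using x by (simp add: local_homs_iff)
    then show "(x, x) \<in> germ_rel R F M" using x unfolding e germ_rel_def by blast
  qed
  show "sym (germ_rel R F M)"
    by (rule symI) (force simp: germ_rel_def)
  show "trans (germ_rel R F M)"
  proof (rule transI)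
    fix x y z assume xy: "(x, y) \<in> germ_rel R F M" and yz: "(y, z) \<in> germ_rel R F M"
    obtain I f J g K h where e: "x = (I, f)" "y = (J, g)" "z = (K, h)" by (cases x, cases y, cases z)
    obtain A B where "A \<in> F" "A \<subseteq> I \<inter> J" "\<forall>a\<in>A. f a = g a" "B \<in> F" "B \<subseteq> J \<inter> K" "\<forall>a\<in>B. g a = h a"
      using xy yz unfolding e germ_rel_def by blast
    then have "A \<inter> B \<in> F" "A \<inter> B \<subseteq> I \<inter> K" "\<forall>a\<in>A \<inter> B. f a = h a" by auto
    then show "(x, z) \<in> germ_rel R F M" using xy yz unfolding e germ_rel_def by blast
  qed
qed

lemma quotients_carrier: "carrier Q = local_homs R F M // germ_rel R F M"
  by (simp add: module_of_quotients_def)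

lemma lin_local_hom: "\<lbrakk>J \<in> F; lin J \<nu>\<rbrakk> \<Longrightarrow> (J, restrict (\<lambda>a. cl (\<nu> a)) J) \<in> local_homs R F M"
  by (auto simp: local_homs_iff)

lemma qg_closed [intro]: "\<lbrakk>J \<in> F; lin J \<nu>\<rbrakk> \<Longrightarrow> qg J \<nu> \<in> carrier Q"
  unfolding qgerm_def germ_def quotients_carrier by (intro quotientI lin_local_hom)

lemma qg_cases:
  assumes "x \<in> carrier Q"
  obtains J \<nu> where "J \<in> F" "lin J \<nu>" "x = qg J \<nu>"
  using assms unfolding quotients_carrier qgerm_def germ_def
  by (elim quotientE) (auto simp: local_homs_iff)

lemma qg_eq_iff:
  assumes "I \<in> F" "lin I \<nu>" "J \<in> F" "lin J \<mu>"
  shows "qg I \<nu> = qg J \<mu> \<longleftrightarrow> (\<exists>K\<in>F. K \<subseteq> I \<inter> J \<and> (\<forall>a\<in>K. cl (\<nu> a) = cl (\<mu> a)))"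
proof -
  have "qg I \<nu> = qg J \<mu> \<longleftrightarrow>
      ((I, restrict (\<lambda>a. cl (\<nu> a)) I), (J, restrict (\<lambda>a. cl (\<mu> a)) J)) \<in> germ_rel R F M"
    unfolding qgerm_def germ_def
    using eq_equiv_class_iff[OF germ_rel_equiv lin_local_hom lin_local_hom] assms by simp
  also have "\<dots> \<longleftrightarrow> (\<exists>K\<in>F. K \<subseteq> I \<inter> J \<and> (\<forall>a\<in>K. cl (\<nu> a) = cl (\<mu> a)))"
    using lin_local_hom assms unfolding germ_rel_def
    by (auto intro!: bex_cong simp: subset_iff)
  finally show ?thesis .
qed

lemma qg_eqI:
  assumes "I \<in> F" "lin I \<nu>" "J \<in> F" "lin J \<mu>" "K \<in> F" "K \<subseteq> I" "K \<subseteq> J"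
    "\<And>a. a \<in> K \<Longrightarrow> cl (\<nu> a) = cl (\<mu> a)"
  shows "qg I \<nu> = qg J \<mu>"
  unfolding qg_eq_iff[OF assms(1-4)] using assms(5-8) by (intro bexI[of _ K]) auto

text \<open>The operations on germs are unions over all representatives; such a union collapses as
  soon as its terms coincide, and every representative comes from a lift.\<close>

lemma qg_Union:
  assumes J: "J \<in> F" "lin J \<nu>"
    and c: "\<And>I \<mu>. \<lbrakk>I \<in> F; lin I \<mu>; qg I \<mu> = qg J \<nu>\<rbrakk> \<Longrightarrow> H I (restrict (\<lambda>a. cl (\<mu> a)) I) = c"
  shows "(\<Union>(I, f)\<in>qg J \<nu>. H I f) = c"
proof -
  have "H I f = c" if m: "(I, f) \<in> qg J \<nu>" for I f
  proof -
    have r: "((J, restrict (\<lambda>a. cl (\<nu> a)) J), (I, f)) \<in> germ_rel R F M"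
      using m by (simp add: qgerm_def germ_def)
    then have "(I, f) \<in> local_homs R F M" by (auto simp: germ_rel_def)
    then obtain \<mu> where \<mu>: "I \<in> F" "lin I \<mu>" "f = restrict (\<lambda>a. cl (\<mu> a)) I"
      by (auto simp: local_homs_iff)
    have "qg I \<mu> = qg J \<nu>"
      using equiv_class_eq[OF germ_rel_equiv r] by (simp add: qgerm_def germ_def \<mu>(3))
    then show ?thesis using c \<mu> by blast
  qed
  moreover have "(J, restrict (\<lambda>a. cl (\<nu> a)) J) \<in> qg J \<nu>"
    unfolding qgerm_def germ_def by (rule equiv_class_self[OF germ_rel_equiv lin_local_hom[OF J]])
  ultimately show ?thesis by fast
qed

lemma germ_cong: "(\<And>a. a \<in> I \<Longrightarrow> f a = g a) \<Longrightarrow> germ R F M I f = germ R F M I g"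
  unfolding germ_def by (metis restrict_ext)

lemma qg_add:
  assumes IJ: "I \<in> F" "lin I \<nu>" "J \<in> F" "lin J \<mu>"
  shows "qg I \<nu> \<oplus>\<^bsub>Q\<^esub> qg J \<mu> = qg (I \<inter> J) (\<lambda>a. \<nu> a \<oplus>\<^bsub>M\<^esub> \<mu> a)"
proof -
  have "(\<Union>(I, f)\<in>qg I \<nu>. \<Union>(J, g)\<in>qg J \<mu>. germ R F M (I \<inter> J) (\<lambda>a. f a \<oplus>\<^bsub>N\<^esub> g a)) =
      qg (I \<inter> J) (\<lambda>a. \<nu> a \<oplus>\<^bsub>M\<^esub> \<mu> a)"
  proof (rule qg_Union[OF IJ(1,2)], rule qg_Union[OF IJ(3,4)])
    fix I' \<nu>' J' \<mu>'
    assume *: "I' \<in> F" "lin I' \<nu>'" "qg I' \<nu>' = qg I \<nu>" "J' \<in> F" "lin J' \<mu>'" "qg J' \<mu>' = qg J \<mu>"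
    have "germ R F M (I' \<inter> J') (\<lambda>a. restrict (\<lambda>a. cl (\<nu>' a)) I' a \<oplus>\<^bsub>N\<^esub> restrict (\<lambda>a. cl (\<mu>' a)) J' a)
        = qg (I' \<inter> J') (\<lambda>a. \<nu>' a \<oplus>\<^bsub>M\<^esub> \<mu>' a)"
      unfolding qgerm_def
      by (rule germ_cong) (simp add: cl_add linD[OF *(2)] linD[OF *(5)])
    also have "\<dots> = qg (I \<inter> J) (\<lambda>a. \<nu> a \<oplus>\<^bsub>M\<^esub> \<mu> a)"
    proof -
      obtain A B where AB: "A \<in> F" "A \<subseteq> I' \<inter> I" "\<forall>a\<in>A. cl (\<nu>' a) = cl (\<nu> a)"
        "B \<in> F" "B \<subseteq> J' \<inter> J" "\<forall>a\<in>B. cl (\<mu>' a) = cl (\<mu> a)"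
        using * IJ by (auto simp: qg_eq_iff)
      show ?thesis
      proof (rule qg_eqI[where K = "A \<inter> B"])
        fix a assume a: "a \<in> A \<inter> B"
        then have "a \<in> I'" "a \<in> I" "a \<in> J'" "a \<in> J" using AB by auto
        then show "cl (\<nu>' a \<oplus>\<^bsub>M\<^esub> \<mu>' a) = cl (\<nu> a \<oplus>\<^bsub>M\<^esub> \<mu> a)"
          using a AB(3,6) by (simp add: cl_add linD[OF *(2)] linD[OF *(5)] linD[OF IJ(2)] linD[OF IJ(4)])
      qed (use AB * IJ in \<open>auto intro!: lin_plus\<close>)
    qed
    finally show "germ R F M (I' \<inter> J') (\<lambda>a. restrict (\<lambda>a. cl (\<nu>' a)) I' a \<oplus>\<^bsub>N\<^esub> restrict (\<lambda>a. cl (\<mu>' a)) J' a)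
        = qg (I \<inter> J) (\<lambda>a. \<nu> a \<oplus>\<^bsub>M\<^esub> \<mu> a)" .
  qed
  then show ?thesis by (simp add: module_of_quotients_def)
qed

lemma qg_act:
  assumes J: "J \<in> F" "lin J \<nu>" and r: "r \<in> carrier R"
  shows "qg J \<nu> \<bullet>\<^bsub>Q\<^esub> r = qg (colon R J r) (\<lambda>a. \<nu> (r \<otimes> a))"
proof -
  have "(\<Union>(I, f)\<in>qg J \<nu>. germ R F M (colon R I r) (\<lambda>a. f (r \<otimes> a))) =
      qg (colon R J r) (\<lambda>a. \<nu> (r \<otimes> a))"
  proof (rule qg_Union[OF J])
    fix I \<mu> assume *: "I \<in> F" "lin I \<mu>" "qg I \<mu> = qg J \<nu>"
    have "germ R F M (colon R I r) (\<lambda>a. restrict (\<lambda>a. cl (\<mu> a)) I (r \<otimes> a)) =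
        qg (colon R I r) (\<lambda>a. \<mu> (r \<otimes> a))"
      unfolding qgerm_def by (rule germ_cong) (simp add: colon_def)
    also have "\<dots> = qg (colon R J r) (\<lambda>a. \<nu> (r \<otimes> a))"
    proof -
      obtain K where K: "K \<in> F" "K \<subseteq> I \<inter> J" "\<forall>a\<in>K. cl (\<mu> a) = cl (\<nu> a)"
        using * J by (auto simp: qg_eq_iff)
      show ?thesis
        by (rule qg_eqI[where K = "colon R K r"])
           (use * J r K in \<open>simp_all add: lin_colon G.filter_colon, auto simp: colon_def\<close>)
    qed
    finally show "germ R F M (colon R I r) (\<lambda>a. restrict (\<lambda>a. cl (\<mu> a)) I (r \<otimes> a)) =
        qg (colon R J r) (\<lambda>a. \<nu> (r \<otimes> a))" .
  qed
  then show ?thesis by (simp add: module_of_quotients_def)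
qed

lemma qg_zero: "\<zero>\<^bsub>Q\<^esub> = qg (carrier R) (\<lambda>_. \<zero>\<^bsub>M\<^esub>)"
  by (simp add: module_of_quotients_def qgerm_def quot_zero)

lemma qg_zero_iff:
  assumes "J \<in> F" "lin J \<nu>"
  shows "qg J \<nu> = \<zero>\<^bsub>Q\<^esub> \<longleftrightarrow> (\<exists>K\<in>F. K \<subseteq> J \<and> (\<forall>a\<in>K. \<nu> a \<in> T))"
proof -
  have "qg J \<nu> = \<zero>\<^bsub>Q\<^esub> \<longleftrightarrow> (\<exists>K\<in>F. K \<subseteq> J \<inter> carrier R \<and> (\<forall>a\<in>K. cl (\<nu> a) = cl \<zero>\<^bsub>M\<^esub>))"
    unfolding qg_zero by (rule qg_eq_iff[OF assms G.filter_carrier lin_zero])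
  also have "\<dots> \<longleftrightarrow> (\<exists>K\<in>F. K \<subseteq> J \<and> (\<forall>a\<in>K. \<nu> a \<in> T))"
  proof (rule bex_cong[OF refl])
    fix K
    show "(K \<subseteq> J \<inter> carrier R \<and> (\<forall>a\<in>K. cl (\<nu> a) = cl \<zero>\<^bsub>M\<^esub>)) \<longleftrightarrow> (K \<subseteq> J \<and> (\<forall>a\<in>K. \<nu> a \<in> T))"
      using G.filter_subset[OF assms(1)] lin_closed[OF assms(2)] cl_zero_iff by blast
  qed
  finally show ?thesis .
qed

lemma quotient_map_eq: "quotient_map R F M m = qg (carrier R) (\<lambda>a. m \<bullet>\<^bsub>M\<^esub> a)"
  by (simp add: quotient_map_def qgerm_def tcoset_def)

lemma quotients_abelian_group: "abelian_group Q"
proof (rule abelian_groupI)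
  fix x assume x: "x \<in> carrier Q"
  obtain I \<nu> where I: "I \<in> F" "lin I \<nu>" "x = qg I \<nu>" using qg_cases[OF x] .
  show "\<zero>\<^bsub>Q\<^esub> \<oplus>\<^bsub>Q\<^esub> x = x" unfolding qg_zero I(3) qg_add[OF G.filter_carrier lin_zero I(1,2)]
    by (rule qg_eqI[where K = I])
       (use I G.filter_subset[OF I(1)] in \<open>auto intro!: lin_plus lin_zero simp: linD[OF I(2)]\<close>)
  have "qg I (\<lambda>a. \<ominus>\<^bsub>M\<^esub> \<nu> a) \<oplus>\<^bsub>Q\<^esub> x = \<zero>\<^bsub>Q\<^esub>"
    unfolding I(3) qg_add[OF I(1) lin_minus[OF I(1,2)] I(1,2)]
    using lin_plus[OF I(1) I(1) lin_minus[OF I(1,2)] I(2)]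
    by (subst qg_zero_iff) (use I in \<open>auto simp: linD[OF I(2)] M.l_neg torsion_zero\<close>)
  then show "\<exists>y\<in>carrier Q. y \<oplus>\<^bsub>Q\<^esub> x = \<zero>\<^bsub>Q\<^esub>" using I lin_minus by blast
  fix y assume y: "y \<in> carrier Q"
  obtain J \<mu> where J: "J \<in> F" "lin J \<mu>" "y = qg J \<mu>" using qg_cases[OF y] .
  show "x \<oplus>\<^bsub>Q\<^esub> y \<in> carrier Q" unfolding I(3) J(3) using I J by (auto simp: qg_add intro!: lin_plus)
  show "x \<oplus>\<^bsub>Q\<^esub> y = y \<oplus>\<^bsub>Q\<^esub> x" unfolding I(3) J(3) qg_add[OF I(1,2) J(1,2)] qg_add[OF J(1,2) I(1,2)]
    by (rule qg_eqI[where K = "I \<inter> J"])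
       (use I J in \<open>auto intro!: lin_plus simp: M.a_comm linD[OF I(2)] linD[OF J(2)]\<close>)
  fix z assume z: "z \<in> carrier Q"
  obtain K \<kappa> where K: "K \<in> F" "lin K \<kappa>" "z = qg K \<kappa>" using qg_cases[OF z] .
  show "x \<oplus>\<^bsub>Q\<^esub> y \<oplus>\<^bsub>Q\<^esub> z = x \<oplus>\<^bsub>Q\<^esub> (y \<oplus>\<^bsub>Q\<^esub> z)"
    unfolding I(3) J(3) K(3) qg_add[OF I(1,2) J(1,2)] qg_add[OF J(1,2) K(1,2)]
      qg_add[OF G.filter_Int[OF I(1) J(1)] lin_plus[OF I(1) J(1) I(2) J(2)] K(1,2)]
      qg_add[OF I(1,2) G.filter_Int[OF J(1) K(1)] lin_plus[OF J(1) K(1) J(2) K(2)]]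
    by (rule qg_eqI[where K = "I \<inter> J \<inter> K"])
       (use I J K in \<open>auto intro!: lin_plus simp: M.a_assoc linD[OF I(2)] linD[OF J(2)] linD[OF K(2)]\<close>)
next
  show "\<zero>\<^bsub>Q\<^esub> \<in> carrier Q" unfolding qg_zero by (rule qg_closed[OF G.filter_carrier lin_zero])
qed

sublocale Q: abelian_group Q by (rule quotients_abelian_group)

end

section \<open>Extending derivations\<close>

text \<open>For use with associative-commutative rewriting, which can leave another summand between
  \<open>x\<close> and its inverse.\<close>

lemma (in abelian_group) a_cancel:
  assumes "x \<in> carrier G" "y \<in> carrier G" "z \<in> carrier G"
  shows "x \<oplus> (y \<oplus> (\<ominus> x \<oplus> z)) = y \<oplus> z" "x \<oplus> (y \<oplus> (z \<oplus> \<ominus> x)) = y \<oplus> z"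
  using assms a_lcomm[of x y] by (simp_all add: r_neg2 a_comm[of z "\<ominus> x"])

locale quotients_derivation = quotients R M F
  for R :: "('a, 'b) ring_scheme" (structure) and M :: "('a, 'm, 'c) rmodule_scheme" (structure)
    and F :: "'a set set" +
  fixes \<delta> :: "'a \<Rightarrow> 'a" and d :: "'m \<Rightarrow> 'm"
  assumes \<delta>: "derivation R \<delta>" and d: "module_derivation R \<delta> M d"
begin

lemma \<delta>_closed [simp]: "a \<in> carrier R \<Longrightarrow> \<delta> a \<in> carrier R"
  and \<delta>_add: "\<lbrakk>a \<in> carrier R; b \<in> carrier R\<rbrakk> \<Longrightarrow> \<delta> (a \<oplus> b) = \<delta> a \<oplus> \<delta> b"
  and \<delta>_mult: "\<lbrakk>a \<in> carrier R; b \<in> carrier R\<rbrakk> \<Longrightarrow> \<delta> (a \<otimes> b) = \<delta> a \<otimes> b \<oplus> a \<otimes> \<delta> b"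
  using \<delta> by (auto simp: derivation_def)

lemma d_closed [simp]: "x \<in> carrier M \<Longrightarrow> d x \<in> carrier M"
  and d_add: "\<lbrakk>x \<in> carrier M; y \<in> carrier M\<rbrakk> \<Longrightarrow> d (x \<oplus>\<^bsub>M\<^esub> y) = d x \<oplus>\<^bsub>M\<^esub> d y"
  and d_act: "\<lbrakk>x \<in> carrier M; r \<in> carrier R\<rbrakk> \<Longrightarrow> d (x \<bullet>\<^bsub>M\<^esub> r) = d x \<bullet>\<^bsub>M\<^esub> r \<oplus>\<^bsub>M\<^esub> x \<bullet>\<^bsub>M\<^esub> \<delta> r"
  using d by (auto simp: module_derivation_def)

lemma d_zero: "d \<zero>\<^bsub>M\<^esub> = \<zero>\<^bsub>M\<^esub>"
  using d_add[of "\<zero>\<^bsub>M\<^esub>" "\<zero>\<^bsub>M\<^esub>"] M.add.r_cancel_one'[of "d \<zero>\<^bsub>M\<^esub>" "d \<zero>\<^bsub>M\<^esub>"] by simp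

text \<open>If \<open>x a = 0\<close> and \<open>x (\<delta> a) = 0\<close>, then
  \<open>0 = d (x a) = (d x) a\<close>. So the annihilator of \<open>d x\<close> contains the part
  of the annihilator of \<open>x\<close> that \<open>\<delta>\<close> maps back into it, and this
  part lies in \<open>F\<close>.\<close>

lemma d_torsion: "x \<in> T \<Longrightarrow> d x \<in> T"
proof -
  assume "x \<in> T"
  then have x: "x \<in> carrier M" and A: "ann R M x \<in> F"
    unfolding torsion_def mem_Collect_eq by blast+
  have "d x \<bullet>\<^bsub>M\<^esub> a = \<zero>\<^bsub>M\<^esub>" if a: "a \<in> ann R M x" "\<delta> a \<in> ann R M x" for a
    using a d_act[OF x, of a] d_zero x by (simp add: ann_def)
  then have "{a \<in> ann R M x. \<delta> a \<in> ann R M x} \<subseteq> ann R M (d x)" by (auto simp: ann_def)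
  then have "ann R M (d x) \<in> F"
    using G.filter_up[OF G.derivation_pullback[OF \<delta> A] right_ideal_ann_elem] x by simp
  then show ?thesis unfolding torsion_def mem_Collect_eq using x by simp
qed

text \<open>Since \<open>d\<close> preserves torsion, it descends to \<open>M/T(M)\<close>; values
  of \<open>d\<close> on lifts may therefore be compared modulo torsion.\<close>

lemma cl_d_cong: "\<lbrakk>x \<in> carrier M; y \<in> carrier M; cl x = cl y\<rbrakk> \<Longrightarrow> cl (d x) = cl (d y)"
proof -
  assume xy: "x \<in> carrier M" "y \<in> carrier M" and e: "cl x = cl y"
  have "x = (x \<ominus>\<^bsub>M\<^esub> y) \<oplus>\<^bsub>M\<^esub> y" using xy by (simp add: M.minus_eq M.a_assoc M.l_neg)
  then have "d x = d (x \<ominus>\<^bsub>M\<^esub> y) \<oplus>\<^bsub>M\<^esub> d y" using d_add[of "x \<ominus>\<^bsub>M\<^esub> y" y] xy by simp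
  then have "d x \<ominus>\<^bsub>M\<^esub> d y = d (x \<ominus>\<^bsub>M\<^esub> y)" using xy by (simp add: M.minus_eq M.a_assoc M.r_neg)
  moreover have "d (x \<ominus>\<^bsub>M\<^esub> y) \<in> T" using e xy d_torsion by (simp add: cl_eq_iff)
  ultimately show ?thesis using xy by (simp add: cl_eq_iff)
qed

text \<open>The domain of \<open>d f - f \<delta>\<close> for \<open>f\<close> defined on
  \<open>J\<close>: both \<open>a\<close> and \<open>\<delta> a\<close> have to lie in
  \<open>J\<close>.\<close>

definition pull :: "'a set \<Rightarrow> 'a set" where "pull J = {a \<in> J. \<delta> a \<in> J}"

lemma pull_filter [simp]: "J \<in> F \<Longrightarrow> pull J \<in> F"
  unfolding pull_def by (rule G.derivation_pullback[OF \<delta>])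

definition dmap :: "('a \<Rightarrow> 'm) \<Rightarrow> 'a \<Rightarrow> 'm" where "dmap \<nu> a = d (\<nu> a) \<ominus>\<^bsub>M\<^esub> \<nu> (\<delta> a)"

lemma cl_dmap: "\<lbrakk>lin J \<nu>; a \<in> pull J\<rbrakk> \<Longrightarrow> cl (dmap \<nu> a) = cl (d (\<nu> a)) \<ominus>\<^bsub>N\<^esub> cl (\<nu> (\<delta> a))"
  by (simp add: pull_def dmap_def M.minus_eq N.M.minus_eq cl_add cl_minus lin_closed)

text \<open>Neither summand is linear: \<open>d (\<nu> (a r))\<close> and
  \<open>\<nu> (\<delta> (a r))\<close> both produce the extra term
  \<open>\<nu> a \<bullet> \<delta> r\<close>, which cancels in the difference.\<close>

lemma lin_dmap:
  assumes J: "J \<in> F" "lin J \<nu>"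
  shows "lin (pull J) (dmap \<nu>)"
proof (rule linI)
  note JF = G.filter_add[OF J(1)] G.filter_mult[OF J(1)] subsetD[OF G.filter_subset[OF J(1)]]
  note PF = G.filter_add[OF pull_filter[OF J(1)]] G.filter_mult[OF pull_filter[OF J(1)]]
  fix a assume a: "a \<in> pull J"
  then have aJ: "a \<in> J" "\<delta> a \<in> J" "a \<in> carrier R" using JF by (auto simp: pull_def)
  note a' = aJ linD(1)[OF J(2) aJ(1)] linD(1)[OF J(2) aJ(2)]
  show "dmap \<nu> a \<in> carrier M" using a' by (simp add: dmap_def)
  { fix b assume b: "b \<in> pull J"
    then have bJ: "b \<in> J" "\<delta> b \<in> J" "b \<in> carrier R" using JF by (auto simp: pull_def)
    note b' = bJ linD(1)[OF J(2) bJ(1)] linD(1)[OF J(2) bJ(2)]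
    have ab: "a \<oplus> b \<in> J" using a' b' JF by simp
    have "cl (d (\<nu> (a \<oplus> b))) = cl (d (\<nu> a \<oplus>\<^bsub>M\<^esub> \<nu> b))"
      using a' b' ab linD[OF J(2)] by (intro cl_d_cong) (simp_all add: cl_add)
    then show "cl (dmap \<nu> (a \<oplus> b)) = cl (dmap \<nu> a) \<oplus>\<^bsub>N\<^esub> cl (dmap \<nu> b)"
      using a' b' linD(2)[OF J(2)]
      by (simp add: cl_dmap[OF J(2)] a b PF d_add cl_add \<delta>_add N.M.minus_eq N.M.minus_add N.M.a_ac) }
  fix r assume r: "r \<in> carrier R"
  have ar: "a \<otimes> r \<in> J" "a \<otimes> \<delta> r \<in> J" "\<delta> a \<otimes> r \<in> J" using a' r JF by simp_all
  have "cl (d (\<nu> (a \<otimes> r))) = cl (d (\<nu> a \<bullet>\<^bsub>M\<^esub> r))"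
    using a' r ar linD[OF J(2)] by (intro cl_d_cong) (simp_all add: cl_act)
  moreover have "cl (\<nu> (\<delta> (a \<otimes> r))) = cl (\<nu> (\<delta> a)) \<bullet>\<^bsub>N\<^esub> r \<oplus>\<^bsub>N\<^esub> cl (\<nu> a) \<bullet>\<^bsub>N\<^esub> \<delta> r"
    using a' r ar linD(2,3)[OF J(2)] by (simp add: \<delta>_mult)
  ultimately show "cl (dmap \<nu> (a \<otimes> r)) = cl (dmap \<nu> a) \<bullet>\<^bsub>N\<^esub> r"
    using a' r
    by (simp add: cl_dmap[OF J(2)] a PF d_act cl_add cl_act N.M.minus_eq N.M.minus_add N.act_l_distr
        N.minus_act N.M.a_ac N.M.a_cancel)
qed

lemma qg_dmap_cong:
  assumes "I \<in> F" "lin I \<nu>" "J \<in> F" "lin J \<mu>" "qg I \<nu> = qg J \<mu>"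
  shows "qg (pull I) (dmap \<nu>) = qg (pull J) (dmap \<mu>)"
proof -
  obtain K where K: "K \<in> F" "K \<subseteq> I \<inter> J" "\<forall>a\<in>K. cl (\<nu> a) = cl (\<mu> a)"
    using assms by (auto simp: qg_eq_iff)
  show ?thesis
  proof (rule qg_eqI[where K = "pull K"])
    show sub: "pull K \<subseteq> pull I" "pull K \<subseteq> pull J" using K by (auto simp: pull_def)
    fix a assume a: "a \<in> pull K"
    then have e: "cl (\<nu> a) = cl (\<mu> a)" "cl (\<nu> (\<delta> a)) = cl (\<mu> (\<delta> a))" and "a \<in> I" "a \<in> J"
      using K by (auto simp: pull_def)
    then have "cl (d (\<nu> a)) = cl (d (\<mu> a))"
      using cl_d_cong lin_closed[OF assms(2)] lin_closed[OF assms(4)] by blast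
    then show "cl (dmap \<nu> a) = cl (dmap \<mu> a)"
      using sub a e by (simp add: cl_dmap[OF assms(2)] cl_dmap[OF assms(4)] subset_iff)
  qed (use assms K lin_dmap in auto)
qed

text \<open>A representative is picked by \<open>SOME\<close>; \<open>qg_dmap_cong\<close> makes the
  value independent of the choice.\<close>

definition dext :: "('a, 'm) germ \<Rightarrow> ('a, 'm) germ" where
  "dext x = (SOME y. \<exists>J \<nu>. J \<in> F \<and> lin J \<nu> \<and> x = qg J \<nu> \<and> y = qg (pull J) (dmap \<nu>))"

lemma dext_qg:
  assumes J: "J \<in> F" "lin J \<nu>"
  shows "dext (qg J \<nu>) = qg (pull J) (dmap \<nu>)"
  unfolding dext_def
proof (rule some_equality)
  show "y = qg (pull J) (dmap \<nu>)"
    if "\<exists>I \<mu>. I \<in> F \<and> lin I \<mu> \<and> qg J \<nu> = qg I \<mu> \<and> y = qg (pull I) (dmap \<mu>)" for y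
    using that qg_dmap_cong[OF _ _ J] by metis
qed (use J in blast)

lemma dext_extends: "extends_to_quotients R F \<delta> M d dext"
  unfolding extends_to_quotients_def module_derivation_def
proof (intro conjI ballI Pi_I)
  fix x assume x: "x \<in> carrier Q"
  obtain I \<nu> where I: "I \<in> F" "lin I \<nu>" "x = qg I \<nu>" using qg_cases[OF x] .
  note Ic = linD(1)[OF I(2)] subsetD[OF G.filter_subset[OF I(1)]]
  show "dext x \<in> carrier Q" unfolding I(3) dext_qg[OF I(1,2)] using I(1,2) by (intro qg_closed lin_dmap pull_filter)
  { fix y assume y: "y \<in> carrier Q"
    obtain J \<mu> where J: "J \<in> F" "lin J \<mu>" "y = qg J \<mu>" using qg_cases[OF y] .
    note Jc = linD(1)[OF J(2)] subsetD[OF G.filter_subset[OF J(1)]]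
    have IJ: "I \<inter> J \<in> F" "lin (I \<inter> J) (\<lambda>a. \<nu> a \<oplus>\<^bsub>M\<^esub> \<mu> a)" using I J lin_plus by auto
    show "dext (x \<oplus>\<^bsub>Q\<^esub> y) = dext x \<oplus>\<^bsub>Q\<^esub> dext y"
      unfolding I(3) J(3) dext_qg[OF I(1,2)] dext_qg[OF J(1,2)] qg_add[OF I(1,2) J(1,2)] dext_qg[OF IJ]
        qg_add[OF pull_filter[OF I(1)] lin_dmap[OF I(1,2)] pull_filter[OF J(1)] lin_dmap[OF J(1,2)]]
    proof (rule qg_eqI[where K = "pull (I \<inter> J)"])
      show "lin (pull I \<inter> pull J) (\<lambda>a. dmap \<nu> a \<oplus>\<^bsub>M\<^esub> dmap \<mu> a)"
        using I J lin_plus lin_dmap by simp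
      show "pull (I \<inter> J) \<subseteq> pull I \<inter> pull J" by (auto simp: pull_def)
      fix a assume "a \<in> pull (I \<inter> J)"
      then have a: "a \<in> I" "a \<in> J" "\<delta> a \<in> I" "\<delta> a \<in> J" by (auto simp: pull_def)
      show "cl (dmap (\<lambda>a. \<nu> a \<oplus>\<^bsub>M\<^esub> \<mu> a) a) = cl (dmap \<nu> a \<oplus>\<^bsub>M\<^esub> dmap \<mu> a)"
        using a Ic Jc by (simp add: dmap_def d_add M.minus_eq M.minus_add M.a_ac)
    qed (use IJ I J lin_dmap[OF IJ] in simp_all) }
  fix r assume r: "r \<in> carrier R"
  let ?A = "colon R I r" and ?\<nu>r = "\<lambda>a. \<nu> (r \<otimes> a)"
  let ?B = "colon R I (\<delta> r)" and ?\<nu>s = "\<lambda>a. \<nu> (\<delta> r \<otimes> a)"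
  let ?C = "colon R (pull I) r" and ?dr = "\<lambda>a. dmap \<nu> (r \<otimes> a)"
  have A: "?A \<in> F" "lin ?A ?\<nu>r" and B: "?B \<in> F" "lin ?B ?\<nu>s" and C: "?C \<in> F" "lin ?C ?dr"
    using I r lin_colon[OF I(1,2)] lin_colon[OF pull_filter[OF I(1)] lin_dmap[OF I(1,2)]] G.filter_colon
    by auto
  have "dext (x \<bullet>\<^bsub>Q\<^esub> r) = qg (pull ?A) (dmap ?\<nu>r)"
    unfolding I(3) qg_act[OF I(1,2) r] by (rule dext_qg[OF A])
  \<comment> \<open>At \<open>a\<close> the left side is
    \<open>d (\<nu> (r a)) - \<nu> (r \<delta> a)\<close>, while \<open>?dr a\<close> subtracts all
    of \<open>\<nu> (\<delta> (r a))\<close>. The product rule for \<open>\<delta> (r a)\<close>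
    leaves \<open>\<nu> (\<delta> r a)\<close> as the difference, and this is the germ of
    \<open>x\<close> acted on by \<open>\<delta> r\<close>.\<close>
  also have "\<dots> = qg (?C \<inter> ?B) (\<lambda>a. ?dr a \<oplus>\<^bsub>M\<^esub> ?\<nu>s a)"
  proof (rule qg_eqI[where K = "pull ?A \<inter> (?C \<inter> ?B)"])
    fix a assume a: "a \<in> pull ?A \<inter> (?C \<inter> ?B)"
    then have a': "a \<in> carrier R" "r \<otimes> a \<in> I" "r \<otimes> \<delta> a \<in> I" "\<delta> r \<otimes> a \<in> I"
      using r by (auto simp: pull_def colon_def)
    have "cl (\<nu> (\<delta> (r \<otimes> a))) = cl (\<nu> (\<delta> r \<otimes> a)) \<oplus>\<^bsub>N\<^esub> cl (\<nu> (r \<otimes> \<delta> a))"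
      using a' r linD(2)[OF I(2)] by (simp add: \<delta>_mult)
    moreover have "r \<otimes> a \<in> pull I" using a by (auto simp: colon_def)
    ultimately show "cl (dmap ?\<nu>r a) = cl (?dr a \<oplus>\<^bsub>M\<^esub> ?\<nu>s a)"
      using a' r Ic a lin_dmap[OF I(1,2), THEN linD(1)] cl_dmap[OF A(2)]
      by (simp add: cl_add cl_dmap[OF I(2)] N.M.minus_eq N.M.minus_add N.M.a_ac N.M.a_cancel)
  qed (use A B C lin_plus[OF C(1) B(1) C(2) B(2)] lin_dmap[OF A] in auto)
  also have "\<dots> = dext x \<bullet>\<^bsub>Q\<^esub> r \<oplus>\<^bsub>Q\<^esub> x \<bullet>\<^bsub>Q\<^esub> \<delta> r"
    unfolding I(3) dext_qg[OF I(1,2)] qg_act[OF I(1,2) \<delta>_closed[OF r]]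
      qg_act[OF pull_filter[OF I(1)] lin_dmap[OF I(1,2)] r]
    by (rule qg_add[OF C(1,2) B(1,2), symmetric])
  finally show "dext (x \<bullet>\<^bsub>Q\<^esub> r) = dext x \<bullet>\<^bsub>Q\<^esub> r \<oplus>\<^bsub>Q\<^esub> x \<bullet>\<^bsub>Q\<^esub> \<delta> r" .
next
  fix m assume m: "m \<in> carrier M"
  have L: "lin (carrier R) (\<lambda>a. m \<bullet>\<^bsub>M\<^esub> a)" "lin (carrier R) (\<lambda>a. d m \<bullet>\<^bsub>M\<^esub> a)"
    using m by (auto intro: lin_mult)
  have pc: "pull (carrier R) = carrier R" by (auto simp: pull_def)
  show "dext (quotient_map R F M m) = quotient_map R F M (d m)"
    unfolding quotient_map_eq dext_qg[OF G.filter_carrier L(1)]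
  proof (rule qg_eqI[where K = "carrier R"])
    fix a assume a: "a \<in> carrier R"
    show "cl (dmap ((\<bullet>\<^bsub>M\<^esub>) m) a) = cl (d m \<bullet>\<^bsub>M\<^esub> a)"
      using a m by (simp add: dmap_def d_act M.minus_eq M.a_assoc M.r_neg)
  qed (use L lin_dmap[OF G.filter_carrier L(1)] in \<open>simp_all add: pc\<close>)
qed

end

section \<open>Comparison of two filters\<close>

locale change_of_filter = A: quotients R M F + B: quotients R M G
  for R :: "('a, 'b) ring_scheme" (structure) and M :: "('a, 'm, 'c) rmodule_scheme" (structure)
    and F G :: "'a set set" +
  assumes sub: "F \<subseteq> G"
begin

lemma torsion_mono: "A.T \<subseteq> B.T"
  using sub unfolding torsion_def by blast

lemma cl_mono: "\<lbrakk>x \<in> carrier M; y \<in> carrier M; A.cl x = A.cl y\<rbrakk> \<Longrightarrow> B.cl x = B.cl y"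
  using torsion_mono by (auto simp: A.cl_eq_iff B.cl_eq_iff)

lemma lin_mono: "\<lbrakk>J \<in> F; A.lin J \<nu>\<rbrakk> \<Longrightarrow> B.lin J \<nu>"
  unfolding tlin_def
  using cl_mono A.G.filter_subset A.G.filter_add A.G.filter_mult
  by (meson A.M.a_closed A.act_closed subsetD)

text \<open>On lifts the comparison map is the identity: the same \<open>\<nu>\<close> is read
  modulo the larger torsion submodule.\<close>

lemma change_filter_qg:
  assumes J: "J \<in> F" "A.lin J \<nu>"
  shows "change_filter R F G M (A.qg J \<nu>) = B.qg J \<nu>"
  unfolding change_filter_def
proof (rule A.qg_Union[OF J])
  fix I \<mu> assume I: "I \<in> F" "A.lin I \<mu>" "A.qg I \<mu> = A.qg J \<nu>"
  have "(\<Union>m\<in>A.cl x. B.T +>\<^bsub>M\<^esub> m) = B.cl x" if x: "x \<in> carrier M" for x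
  proof -
    have "B.T +>\<^bsub>M\<^esub> m = B.cl x" if m: "m \<in> A.cl x" for m
    proof -
      have "m \<in> carrier M" "A.cl m = A.cl x" using A.mem_clE[OF m x] by blast+
      then show ?thesis using cl_mono[OF _ x] by (simp add: tcoset_def[of R G])
    qed
    then show ?thesis using A.mem_cl_self[OF x] by blast
  qed
  then have "germ R G M I (\<lambda>a. \<Union>m\<in>restrict (\<lambda>a. A.cl (\<mu> a)) I a. B.T +>\<^bsub>M\<^esub> m) = B.qg I \<mu>"
    unfolding qgerm_def by (intro B.germ_cong) (simp add: A.lin_closed[OF I(2)])
  also have "\<dots> = B.qg J \<nu>"
  proof -
    obtain K where K: "K \<in> F" "K \<subseteq> I \<inter> J" "\<forall>a\<in>K. A.cl (\<mu> a) = A.cl (\<nu> a)"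
      using I J by (auto simp: A.qg_eq_iff)
    show ?thesis
    proof (rule B.qg_eqI[where K = K])
      show "B.cl (\<mu> a) = B.cl (\<nu> a)" if "a \<in> K" for a
        using that K A.lin_closed[OF I(2)] A.lin_closed[OF J(2)] by (intro cl_mono) auto
    qed (use K I J sub lin_mono in auto)
  qed
  finally show "germ R G M I (\<lambda>a. \<Union>m\<in>restrict (\<lambda>a. A.cl (\<mu> a)) I a. B.T +>\<^bsub>M\<^esub> m) = B.qg J \<nu>" .
qed

end

theorem extensions_agree_gabriel:
  assumes "gabriel_filter R F" "gabriel_filter R G" "F \<subseteq> G"
    and "right_module R M" "derivation R \<delta>" "module_derivation R \<delta> M d"
  shows "extensions_agree R F G \<delta> M d"
proof -
  interpret right_module R M by fact
  interpret change_of_filter R M F G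
    using assms by unfold_locales auto
  interpret DA: quotients_derivation R M F \<delta> d using assms by unfold_locales auto
  interpret DB: quotients_derivation R M G \<delta> d using assms by unfold_locales auto
  have "DB.dext (change_filter R F G M x) = change_filter R F G M (DA.dext x)"
    if x: "x \<in> carrier (module_of_quotients R F M)" for x
  proof -
    obtain J \<nu> where J: "J \<in> F" "A.lin J \<nu>" "x = A.qg J \<nu>" using A.qg_cases[OF x] .
    have "J \<in> G" "B.lin J \<nu>" using J sub lin_mono by auto
    \<comment> \<open>The bodies of \<open>pull\<close> and \<open>dmap\<close> do not mention the
      filter, so after unfolding both extensions use the same map on representatives; folding back
      allows \<open>change_filter_qg\<close> to be applied to it.\<close>
    then show ?thesis
      using J(1,2) DA.lin_dmap[OF J(1,2)]
      by (simp add: J(3) change_filter_qg DA.dext_qg DB.dext_qg DA.pull_def DB.pull_def DA.dmap_def DB.dmap_def)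
         (simp flip: DA.pull_def DA.dmap_def add: change_filter_qg)
  qed
  then show ?thesis
    unfolding extensions_agree_def using assms(1-3) DA.dext_extends DB.dext_extends by blast
qed

section \<open>Perfect filters without tensor products\<close>

text \<open>
  For a faithful filter the elements of \<open>R\<^sub>F\<close> are germs of linear maps \<open>g : K \<rightarrow> R\<close>, and \<open>F\<close> is
  perfect iff \<open>I R\<^sub>F = R\<^sub>F\<close> for all \<open>I \<in> F\<close>. The latter means that \<open>1 = \<Sum> i\<^sub>k g\<^sub>k\<close> with \<open>i\<^sub>k \<in> I\<close>, that
  is, \<open>\<Sum> i\<^sub>k g\<^sub>k(a) = a\<close> on some member of \<open>F\<close>.
\<close>

context ring
begin

definition rlin :: "'a set \<Rightarrow> ('a \<Rightarrow> 'a) \<Rightarrow> bool" where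
  "rlin J g \<longleftrightarrow> (\<forall>a\<in>J. g a \<in> carrier R) \<and> (\<forall>a\<in>J. \<forall>b\<in>J. g (a \<oplus> b) = g a \<oplus> g b) \<and>
     (\<forall>a\<in>J. \<forall>r\<in>carrier R. g (a \<otimes> r) = g a \<otimes> r)"

primrec csum :: "('a \<times> ('a \<Rightarrow> 'a)) list \<Rightarrow> 'a \<Rightarrow> 'a" where
  "csum [] a = \<zero>"
| "csum (p # ps) a = fst p \<otimes> snd p a \<oplus> csum ps a"

text \<open>A list of pairs \<open>(i_k, g_k)\<close> encodes the element
  \<open>\<Sum> i_k g_k\<close> of \<open>I R_F\<close>. All \<open>g_k\<close> live on one common
  domain \<open>K\<close>, which finite intersections in the filter always provide.\<close>

definition combo :: "'a set \<Rightarrow> 'a set \<Rightarrow> ('a \<times> ('a \<Rightarrow> 'a)) list \<Rightarrow> bool" where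
  "combo I K ps \<longleftrightarrow> (\<forall>p\<in>set ps. fst p \<in> I \<and> rlin K (snd p))"

definition exhausts :: "'a set set \<Rightarrow> 'a set \<Rightarrow> bool" where
  "exhausts F I \<longleftrightarrow> (\<exists>K\<in>F. \<exists>ps. combo I K ps \<and> (\<forall>a\<in>K. csum ps a = a))"

lemma rlinD:
  assumes "rlin J g"
  shows "a \<in> J \<Longrightarrow> g a \<in> carrier R" "\<lbrakk>a \<in> J; b \<in> J\<rbrakk> \<Longrightarrow> g (a \<oplus> b) = g a \<oplus> g b"
    "\<lbrakk>a \<in> J; r \<in> carrier R\<rbrakk> \<Longrightarrow> g (a \<otimes> r) = g a \<otimes> r"
  using assms by (simp_all add: rlin_def)

lemma rlin_subset: "\<lbrakk>rlin J g; K \<subseteq> J\<rbrakk> \<Longrightarrow> rlin K g"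
  unfolding rlin_def by blast

lemma rlin_id: "J \<subseteq> carrier R \<Longrightarrow> rlin J (\<lambda>a. a)"
  by (auto simp: rlin_def)

lemma rlin_comp: "\<lbrakk>rlin J g; rlin K h\<rbrakk> \<Longrightarrow> rlin {a \<in> J. g a \<in> K} (h \<circ> g)"
  by (auto simp: rlin_def)

lemma rlin_scale: "\<lbrakk>rlin J g; r \<in> carrier R\<rbrakk> \<Longrightarrow> rlin J (\<lambda>a. r \<otimes> g a)"
  by (auto simp: rlin_def r_distr m_assoc)

lemma rlin_plus: "\<lbrakk>rlin J g; rlin J h\<rbrakk> \<Longrightarrow> rlin J (\<lambda>a. g a \<oplus> h a)"
  by (auto simp: rlin_def l_distr a_ac)

lemma rlin_zero: "rlin J (\<lambda>_. \<zero>)"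
  by (auto simp: rlin_def)

lemma combo_Nil [simp]: "combo I K []"
  and combo_Cons [simp]: "combo I K (p # ps) \<longleftrightarrow> fst p \<in> I \<and> rlin K (snd p) \<and> combo I K ps"
  and combo_append [simp]: "combo I K (ps @ qs) \<longleftrightarrow> combo I K ps \<and> combo I K qs"
  by (auto simp: combo_def)

lemma combo_subset: "\<lbrakk>combo I K ps; L \<subseteq> K\<rbrakk> \<Longrightarrow> combo I L ps"
  using rlin_subset unfolding combo_def by blast

lemma combo_mono: "\<lbrakk>combo I K ps; I \<subseteq> I'\<rbrakk> \<Longrightarrow> combo I' K ps"
  unfolding combo_def by blast

lemma rlin_csum: "\<lbrakk>combo I K ps; I \<subseteq> carrier R\<rbrakk> \<Longrightarrow> rlin K (csum ps)"
proof (induction ps)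
  case Nil
  then show ?case using rlin_zero by simp
next
  case (Cons p ps)
  then have "rlin K (\<lambda>a. fst p \<otimes> snd p a \<oplus> csum ps a)"
    by (intro rlin_plus rlin_scale) auto
  then show ?case by simp
qed

lemma csum_append:
  "\<lbrakk>combo I K ps; combo I K qs; I \<subseteq> carrier R; a \<in> K\<rbrakk> \<Longrightarrow> csum (ps @ qs) a = csum ps a \<oplus> csum qs a"
proof (induction ps)
  case Nil
  then show ?case using rlinD(1)[OF rlin_csum[OF Nil(2,3)]] by simp
next
  case (Cons p ps)
  then show ?case
    using rlinD(1)[OF rlin_csum[of I K ps]] rlinD(1)[OF rlin_csum[of I K qs]] rlinD(1)[of K "snd p"]
    by (auto simp: a_assoc subset_iff)
qed

lemma combo_comp:
  assumes "combo I K ps" "rlin J g"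
  shows "combo I {a \<in> J. g a \<in> K} (map (\<lambda>p. (fst p, snd p \<circ> g)) ps)"
  using assms rlin_comp by (auto simp: combo_def)

lemma csum_comp: "csum (map (\<lambda>p. (fst p, snd p \<circ> g)) ps) a = csum ps (g a)"
  by (induction ps) auto

lemma combo_scale: "combo (colon R J r) K ps \<Longrightarrow> combo J K (map (\<lambda>p. (r \<otimes> fst p, snd p)) ps)"
  by (auto simp: combo_def colon_def)

lemma csum_scale:
  "\<lbrakk>combo I K ps; I \<subseteq> carrier R; r \<in> carrier R; a \<in> K\<rbrakk>
    \<Longrightarrow> csum (map (\<lambda>p. (r \<otimes> fst p, snd p)) ps) a = r \<otimes> csum ps a"
proof (induction ps)
  case (Cons p ps)
  then show ?case
    using rlinD(1)[OF rlin_csum[of I K ps]] rlinD(1)[of K "snd p"]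
    by (auto simp: r_distr m_assoc subset_iff)
qed simp

lemma combo_csum_mem:
  assumes "right_ideal R I"
  shows "\<lbrakk>combo I K ps; a \<in> K\<rbrakk> \<Longrightarrow> csum ps a \<in> I"
proof (induction ps)
  case (Cons p ps)
  then show ?case using assms rlinD(1)[of K "snd p"] by (simp add: right_ideal_alt)
qed (use assms in \<open>simp add: right_ideal_alt\<close>)

lemma exhausts_mono: "\<lbrakk>exhausts F I; F \<subseteq> G\<rbrakk> \<Longrightarrow> exhausts G I"
  unfolding exhausts_def by blast

end

context gabriel
begin

text \<open>As for derivations, the colon ideal at \<open>a \<in> J\<close> is computed exactly: it
  is \<open>(K : g a)\<close>. The lemma supplies the domains of composites.\<close>

lemma rlin_pullback:
  assumes J: "J \<in> F" and g: "rlin J g" and K: "K \<in> F"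
  shows "{a \<in> J. g a \<in> K} \<in> F"
proof (rule filter_trans[OF J])
  have "g \<zero> = \<zero> \<otimes> \<zero>"
    using rlinD(3)[OF g filter_zero[OF J], of \<zero>] rlinD(1)[OF g filter_zero[OF J]] by simp
  then show "right_ideal R {a \<in> J. g a \<in> K}"
    using J K filter_subset[OF J] filter_zero[OF J] filter_zero[OF K]
    by (auto simp: right_ideal_alt rlinD[OF g] filter_add filter_mult)
  fix a assume a: "a \<in> J"
  have "colon R {a \<in> J. g a \<in> K} a = colon R K (g a)"
    using a J by (auto simp: colon_def rlinD[OF g] filter_mult)
  then show "colon R {a \<in> J. g a \<in> K} a \<in> F"
    using filter_colon[OF K] rlinD(1)[OF g a] by simp
qed

text \<open>Substitution of one decomposition into another: if \<open>b = \<Sum> j_k h_k(b)\<close>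
  with \<open>j_k \<in> (J : i)\<close>, then \<open>i g(a) = \<Sum> (i j_k) h_k(g(a))\<close>, and
  the new coefficients \<open>i j_k\<close> lie in \<open>J\<close>. The domain shrinks to the
  points that \<open>g\<close> sends into the domain of the \<open>h_k\<close>.\<close>

lemma combo_trans:
  assumes I: "I \<subseteq> carrier R" and J: "J \<subseteq> carrier R"
    and ex: "\<And>i. i \<in> I \<Longrightarrow> exhausts F (colon R J i)"
  shows "\<lbrakk>combo I K ps; K \<in> F\<rbrakk>
    \<Longrightarrow> \<exists>L\<in>F. L \<subseteq> K \<and> (\<exists>qs. combo J L qs \<and> (\<forall>a\<in>L. csum qs a = csum ps a))"
proof (induction ps)
  case Nil
  then show ?case by (intro bexI[of _ K] conjI exI[of _ "[]"]) auto
next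
  case (Cons p ps)
  define i g where "i = fst p" and "g = snd p"
  have i: "i \<in> I" "i \<in> carrier R" and g: "rlin K g" and ps: "combo I K ps"
    using Cons.prems(1) I by (auto simp: i_def g_def)
  obtain L qs where L: "L \<in> F" "L \<subseteq> K" "combo J L qs" "\<forall>a\<in>L. csum qs a = csum ps a"
    using Cons.IH[OF ps Cons.prems(2)] by blast
  obtain P rs where P: "P \<in> F" "combo (colon R J i) P rs" "\<forall>a\<in>P. csum rs a = a"
    using ex[OF i(1)] unfolding exhausts_def by blast
  define D where "D = {a \<in> K. g a \<in> P}"
  define rs' where "rs' = map (\<lambda>p. (fst p, snd p \<circ> g)) rs"
  have D: "D \<in> F" unfolding D_def by (rule rlin_pullback[OF Cons.prems(2) g P(1)])
  have rs': "combo (colon R J i) D rs'" unfolding D_def rs'_def by (rule combo_comp[OF P(2) g])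
  define ts where "ts = map (\<lambda>p. (i \<otimes> fst p, snd p)) rs'"
  have ts: "combo J D ts" unfolding ts_def by (rule combo_scale[OF rs'])
  have tsv: "csum ts a = i \<otimes> g a" if a: "a \<in> D" for a
  proof -
    have "csum ts a = i \<otimes> csum rs' a"
      unfolding ts_def by (rule csum_scale[OF rs' _ i(2) a]) (auto simp: colon_def)
    then show ?thesis using P(3) a by (simp add: rs'_def csum_comp D_def)
  qed
  have c: "combo J (D \<inter> L) ts" "combo J (D \<inter> L) qs"
    using combo_subset[OF ts] combo_subset[OF L(3)] by auto
  show ?case
  proof (intro bexI conjI exI ballI)
    show "combo J (D \<inter> L) (ts @ qs)" using c by simp
    show "csum (ts @ qs) a = csum (p # ps) a" if "a \<in> D \<inter> L" for a
      using that csum_append[OF c J that] tsv L(4) by (simp add: i_def g_def)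
    show "D \<inter> L \<subseteq> K" using L(2) by auto
  qed (use D L(1) in simp)
qed

lemma exhausts_trans:
  assumes "right_ideal R I" "right_ideal R J" "exhausts F I"
    "\<And>i. i \<in> I \<Longrightarrow> exhausts F (colon R J i)"
  shows "exhausts F J"
proof -
  obtain K ps where K: "K \<in> F" "combo I K ps" "\<forall>a\<in>K. csum ps a = a"
    using assms(3) unfolding exhausts_def by blast
  obtain L qs where L: "L \<in> F" "L \<subseteq> K" "combo J L qs" "\<forall>a\<in>L. csum qs a = csum ps a"
    using combo_trans[OF right_ideal_subset[OF assms(1)] right_ideal_subset[OF assms(2)] assms(4) K(2,1)] by blast
  then have "\<forall>a\<in>L. csum qs a = a" using K(3) by auto
  then show ?thesis using L unfolding exhausts_def by blast
qed

lemma exhausts_carrier: "exhausts F (carrier R)"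
  unfolding exhausts_def
  by (intro bexI[of _ "carrier R"] exI[of _ "[(\<one>, \<lambda>a. a)]"]) (auto simp: rlin_id)

text \<open>A combination with coefficients in the right ideal \<open>I\<close> has its values in
  \<open>I\<close>; if it is the identity on \<open>K\<close>, then
  \<open>K \<subseteq> I\<close>.\<close>

lemma exhausts_member: "\<lbrakk>right_ideal R I; exhausts F I\<rbrakk> \<Longrightarrow> I \<in> F"
proof -
  assume I: "right_ideal R I" and "exhausts F I"
  then obtain K ps where K: "K \<in> F" "combo I K ps" "\<forall>a\<in>K. csum ps a = a"
    unfolding exhausts_def by blast
  have "a \<in> I" if "a \<in> K" for a using combo_csum_mem[OF I K(2) that] K(3)[THEN bspec, OF that] by (rule subst[rotated])
  then show "I \<in> F" using filter_up[OF K(1) I] by blast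
qed

end

section \<open>The largest exhausting filter\<close>

context ring
begin

text \<open>The faithful perfect filters described without tensor products; see
  \<open>perfect_iff_exhausting\<close>.\<close>

definition exhausting_filters :: "'a set set set" where
  "exhausting_filters = {F. gabriel_filter R F \<and> faithful R F \<and> (\<forall>I\<in>F. exhausts F I)}"

text \<open>The largest member of \<^const>\<open>exhausting_filters\<close>: it suffices to close their union under
  the transitivity axiom of Gabriel filters.\<close>

inductive_set tot_closure :: "'a set set" where
  base: "\<lbrakk>F \<in> exhausting_filters; I \<in> F\<rbrakk> \<Longrightarrow> I \<in> tot_closure"
| carrier: "carrier R \<in> tot_closure"
| trans: "\<lbrakk>I \<in> tot_closure; right_ideal R J; \<And>a. a \<in> I \<Longrightarrow> colon R J a \<in> tot_closure\<rbrakk>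
    \<Longrightarrow> J \<in> tot_closure"

lemma tot_closure_right_ideal: "I \<in> tot_closure \<Longrightarrow> right_ideal R I"
proof (induction rule: tot_closure.induct)
  case (base F I)
  then interpret gabriel R F by unfold_locales (simp add: exhausting_filters_def)
  show ?case using filter_right_ideal base(2) .
qed simp_all

text \<open>Colon stability is not among the generating clauses; it propagates through the
  transitivity clause because \<open>((J : r) : a) = (J : r a)\<close>, with
  \<open>r a \<in> I\<close> for \<open>a \<in> (I : r)\<close>.\<close>

lemma tot_closure_colon: "\<lbrakk>I \<in> tot_closure; r \<in> carrier R\<rbrakk> \<Longrightarrow> colon R I r \<in> tot_closure"
proof (induction arbitrary: r rule: tot_closure.induct)
  case (base F I)
  interpret gabriel R F using base(1) by unfold_locales (simp add: exhausting_filters_def)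
  show ?case by (rule tot_closure.base[OF base(1) filter_colon[OF base(2,3)]])
next
  case carrier
  then show ?case using colon_member[OF right_ideal_carrier carrier] tot_closure.carrier by simp
next
  case (trans I J)
  show ?case
  proof (rule tot_closure.trans[OF trans.IH(1)[OF trans.prems] right_ideal_colon[OF trans.hyps(2) trans.prems]])
    fix a assume "a \<in> colon R I r"
    then have a: "a \<in> carrier R" "r \<otimes> a \<in> I" unfolding colon_def by blast+
    show "colon R (colon R J r) a \<in> tot_closure"
      unfolding colon_colon[OF trans.prems a(1)] by (rule trans.hyps(3)[OF a(2)])
  qed
qed

lemma tot_closure_gabriel: "gabriel_filter R tot_closure"
  by (rule gabriel_filterI[OF tot_closure_right_ideal tot_closure.carrier tot_closure_colon tot_closure.trans])

text \<open>The Lambek filter contains all the generators and obeys the transitivity axiom itself,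
  so the closure cannot leave it. This is what keeps the closure faithful.\<close>

lemma tot_closure_subset_lambek: "tot_closure \<subseteq> lambek_filter R"
proof
  interpret L: gabriel R "lambek_filter R" by unfold_locales (rule lambek_gabriel)
  fix I assume "I \<in> tot_closure"
  then show "I \<in> lambek_filter R"
  proof (induction rule: tot_closure.induct)
    case (base F I)
    then have "F \<subseteq> lambek_filter R"
      by (intro faithful_subset_lambek) (simp_all add: exhausting_filters_def)
    then show ?case using base(2) by blast
  next
    case (trans I J)
    show ?case by (rule L.filter_trans[OF trans.IH(1) trans.hyps(2) trans.IH(2)])
  qed simp
qed

text \<open>A decomposition of \<open>\<one>\<close> found over one generating filter remains valid
  over the closure, and there the transitivity step takes place inside a single Gabriel
  filter.\<close>

lemma tot_closure_exhausts: "I \<in> tot_closure \<Longrightarrow> exhausts tot_closure I"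
proof (induction rule: tot_closure.induct)
  interpret H: gabriel R tot_closure by unfold_locales (rule tot_closure_gabriel)
  {
    case (base F I)
    then have "exhausts F I" "F \<subseteq> tot_closure"
      using tot_closure.base[OF base(1)] by (auto simp: exhausting_filters_def)
    then show ?case by (rule exhausts_mono)
  next
    case carrier
    then show ?case by (rule H.exhausts_carrier)
  next
    case (trans I J)
    then show ?case using H.exhausts_trans[OF tot_closure_right_ideal] by blast
  }
qed

lemma tot_closure_exhausting: "tot_closure \<in> exhausting_filters"
  using tot_closure_gabriel faithful_if_subset_lambek[OF tot_closure_gabriel tot_closure_subset_lambek]
    tot_closure_exhausts
  by (simp add: exhausting_filters_def)

text \<open>A regular \<open>t \<in> I\<close> is inverted by the map
  \<open>g : t s \<mapsto> s\<close> on \<open>t R\<close>, so the single product \<open>t g\<close>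
  is already the identity there. The Ore condition at \<open>t\<close> says that \<open>t R\<close>
  belongs to the classical filter.\<close>

lemma classical_exhausts:
  assumes ore: "right_ore R" and I: "I \<in> classical_filter R"
  shows "exhausts (classical_filter R) I"
proof -
  obtain t where t: "t \<in> regular_elements R" "\<one> \<otimes> t \<in> I"
    using classical_filterE[OF I one_closed] .
  note tc = regular_elementsD(1)[OF t(1)]
  let ?K = "{t \<otimes> s | s. s \<in> carrier R}"
  have "\<exists>u\<in>regular_elements R. x \<otimes> u \<in> ?K" if "x \<in> carrier R" for x
    using ore t(1) that unfolding right_ore_def by blast
  then have K: "?K \<in> classical_filter R"
    using principal_right_ideal[OF tc] by (simp add: classical_filter_alt)
  have inj: "r = s" if rs: "r \<in> carrier R" "s \<in> carrier R" "t \<otimes> r = t \<otimes> s" for r s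
  proof -
    have "t \<otimes> (r \<ominus> s) = \<zero>" using rs tc by (simp add: minus_eq r_distr r_minus r_neg)
    then have "r \<ominus> s = \<zero>" using regular_elementsD(2)[OF t(1)] rs by simp
    then show ?thesis using rs by (simp add: r_right_minus_eq)
  qed
  define g where "g a = (THE s. s \<in> carrier R \<and> a = t \<otimes> s)" for a
  have g: "g (t \<otimes> s) = s" if s: "s \<in> carrier R" for s
    unfolding g_def by (rule the_equality) (use s inj in auto)
  have "rlin ?K g"
    unfolding rlin_def
  proof (intro conjI ballI)
    fix a assume "a \<in> ?K"
    then obtain s where s: "s \<in> carrier R" "a = t \<otimes> s" by blast
    show "g a \<in> carrier R" using s g by simp
    { fix b assume "b \<in> ?K"
      then obtain r where r: "r \<in> carrier R" "b = t \<otimes> r" by blast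
      have "a \<oplus> b = t \<otimes> (s \<oplus> r)" using s r tc by (simp add: r_distr)
      then show "g (a \<oplus> b) = g a \<oplus> g b" using s r g by simp }
    fix r assume r: "r \<in> carrier R"
    have "a \<otimes> r = t \<otimes> (s \<otimes> r)" using s r tc by (simp add: m_assoc)
    then show "g (a \<otimes> r) = g a \<otimes> r" using s r g by simp
  qed
  moreover have "csum [(t, g)] a = a" if "a \<in> ?K" for a
    using that tc g by auto
  moreover have "t \<in> I" using t(2) tc by simp
  ultimately show ?thesis
    unfolding exhausts_def by (intro bexI[OF _ K] exI[of _ "[(t, g)]"]) auto
qed

end

section \<open>Left modules and tensor products\<close>

locale left_mod = R?: ring R + N: abelian_group N
  for R :: "('a, 'b) ring_scheme" (structure) and N :: "('a, 'n, 'd) module_scheme" (structure) +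
  assumes smult_closed [simp]: "\<lbrakk>r \<in> carrier R; n \<in> carrier N\<rbrakk> \<Longrightarrow> r \<odot>\<^bsub>N\<^esub> n \<in> carrier N"
    and smult_l_distr: "\<lbrakk>r \<in> carrier R; s \<in> carrier R; n \<in> carrier N\<rbrakk>
      \<Longrightarrow> (r \<oplus> s) \<odot>\<^bsub>N\<^esub> n = r \<odot>\<^bsub>N\<^esub> n \<oplus>\<^bsub>N\<^esub> s \<odot>\<^bsub>N\<^esub> n"
    and smult_r_distr: "\<lbrakk>r \<in> carrier R; n \<in> carrier N; p \<in> carrier N\<rbrakk>
      \<Longrightarrow> r \<odot>\<^bsub>N\<^esub> (n \<oplus>\<^bsub>N\<^esub> p) = r \<odot>\<^bsub>N\<^esub> n \<oplus>\<^bsub>N\<^esub> r \<odot>\<^bsub>N\<^esub> p"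
    and smult_assoc: "\<lbrakk>r \<in> carrier R; s \<in> carrier R; n \<in> carrier N\<rbrakk>
      \<Longrightarrow> (r \<otimes> s) \<odot>\<^bsub>N\<^esub> n = r \<odot>\<^bsub>N\<^esub> (s \<odot>\<^bsub>N\<^esub> n)"
    and smult_one [simp]: "n \<in> carrier N \<Longrightarrow> \<one> \<odot>\<^bsub>N\<^esub> n = n"
begin

lemma smult_zero_left [simp]: "n \<in> carrier N \<Longrightarrow> \<zero> \<odot>\<^bsub>N\<^esub> n = \<zero>\<^bsub>N\<^esub>"
  using smult_l_distr[of \<zero> \<zero> n] N.add.r_cancel_one'[of "\<zero> \<odot>\<^bsub>N\<^esub> n" "\<zero> \<odot>\<^bsub>N\<^esub> n"] by simp

lemma smult_zero_right [simp]: "r \<in> carrier R \<Longrightarrow> r \<odot>\<^bsub>N\<^esub> \<zero>\<^bsub>N\<^esub> = \<zero>\<^bsub>N\<^esub>"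
  using smult_r_distr[of r "\<zero>\<^bsub>N\<^esub>" "\<zero>\<^bsub>N\<^esub>"] N.add.r_cancel_one'[of "r \<odot>\<^bsub>N\<^esub> \<zero>\<^bsub>N\<^esub>" "r \<odot>\<^bsub>N\<^esub> \<zero>\<^bsub>N\<^esub>"] by simp

lemma smult_minus_left: "\<lbrakk>r \<in> carrier R; n \<in> carrier N\<rbrakk> \<Longrightarrow> (\<ominus> r) \<odot>\<^bsub>N\<^esub> n = \<ominus>\<^bsub>N\<^esub> (r \<odot>\<^bsub>N\<^esub> n)"
  by (rule N.minus_equality[symmetric]) (simp_all add: l_neg flip: smult_l_distr)

lemma smult_minus_right: "\<lbrakk>r \<in> carrier R; n \<in> carrier N\<rbrakk> \<Longrightarrow> r \<odot>\<^bsub>N\<^esub> (\<ominus>\<^bsub>N\<^esub> n) = \<ominus>\<^bsub>N\<^esub> (r \<odot>\<^bsub>N\<^esub> n)"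
  by (rule N.minus_equality[symmetric]) (simp_all add: N.l_neg flip: smult_r_distr)

text \<open>The subgroup \<open>I N\<close> of \<open>N\<close>, built from finite sums of products;
  for a right ideal \<open>I\<close> the quotient \<open>N / I N\<close> is
  \<open>R/I \<otimes> N\<close>.\<close>

inductive_set span :: "'a set \<Rightarrow> 'n set" for I :: "'a set" where
  zero: "\<zero>\<^bsub>N\<^esub> \<in> span I"
| step: "\<lbrakk>i \<in> I; n \<in> carrier N; s \<in> span I\<rbrakk> \<Longrightarrow> i \<odot>\<^bsub>N\<^esub> n \<oplus>\<^bsub>N\<^esub> s \<in> span I"

lemma span_closed: "\<lbrakk>s \<in> span I; I \<subseteq> carrier R\<rbrakk> \<Longrightarrow> s \<in> carrier N"
  by (induction rule: span.induct) auto

lemma span_add: "\<lbrakk>s \<in> span I; t \<in> span I; I \<subseteq> carrier R\<rbrakk> \<Longrightarrow> s \<oplus>\<^bsub>N\<^esub> t \<in> span I"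
proof (induction rule: span.induct)
  case zero
  then show ?case using span_closed by simp
next
  case (step i n s)
  have "i \<odot>\<^bsub>N\<^esub> n \<oplus>\<^bsub>N\<^esub> (s \<oplus>\<^bsub>N\<^esub> t) \<in> span I"
    using step by (intro span.step) auto
  then show ?case
    using step span_closed[of s I] span_closed[of t I] by (simp add: N.a_assoc subset_iff)
qed

lemma span_minus: "\<lbrakk>s \<in> span I; I \<subseteq> carrier R\<rbrakk> \<Longrightarrow> \<ominus>\<^bsub>N\<^esub> s \<in> span I"
proof (induction rule: span.induct)
  case zero
  then show ?case using span.zero N.add.inv_one by (simp add: a_inv_def)
next
  case (step i n s)
  have "i \<odot>\<^bsub>N\<^esub> (\<ominus>\<^bsub>N\<^esub> n) \<oplus>\<^bsub>N\<^esub> \<ominus>\<^bsub>N\<^esub> s \<in> span I"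
    using step by (intro span.step) auto
  then show ?case
    using step span_closed[of s I] by (simp add: smult_minus_right N.minus_add subset_iff)
qed

lemma span_single: "\<lbrakk>i \<in> I; n \<in> carrier N; I \<subseteq> carrier R\<rbrakk> \<Longrightarrow> i \<odot>\<^bsub>N\<^esub> n \<in> span I"
  using span.step[OF _ _ span.zero, of i I n] by (simp add: subset_iff)

end

text \<open>The universal property in additive form, with a rule for differences because the tensor
  relations are differences of generators.\<close>

lemma (in abelian_group) free_Abelian_group_hom:
  assumes "\<And>x. x \<in> S \<Longrightarrow> f x \<in> carrier G"
  obtains e where "e \<in> hom (free_Abelian_group S) (add_monoid G)"
    "\<And>x. x \<in> S \<Longrightarrow> e (frag_of x) = f x" "e 0 = \<zero>"
    "\<And>u v. \<lbrakk>u \<in> carrier (free_Abelian_group S); v \<in> carrier (free_Abelian_group S)\<rbrakk> \<Longrightarrow> e (u + v) = e u \<oplus> e v"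
    "\<And>u. u \<in> carrier (free_Abelian_group S) \<Longrightarrow> e (- u) = \<ominus> e u"
    "\<And>u v. \<lbrakk>u \<in> carrier (free_Abelian_group S); v \<in> carrier (free_Abelian_group S)\<rbrakk> \<Longrightarrow> e (u - v) = e u \<ominus> e v"
proof -
  have "f ` S \<subseteq> carrier (add_monoid G)" using assms by auto
  then obtain e where e: "e \<in> hom (free_Abelian_group S) (add_monoid G)"
    "\<And>x. x \<in> S \<Longrightarrow> e (frag_of x) = f x"
    using comm_group.free_Abelian_group_universal[OF a_comm_group] by blast
  interpret E: group_hom "free_Abelian_group S" "add_monoid G" e
    using e(1) by (intro group_hom.intro group_hom_axioms.intro) auto
  have z: "e 0 = \<zero>" using E.hom_one by simp
  have a: "e (u + v) = e u \<oplus> e v"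
    if "u \<in> carrier (free_Abelian_group S)" "v \<in> carrier (free_Abelian_group S)" for u v
    using E.hom_mult[OF that] by simp
  have m: "e (- u) = \<ominus> e u" if "u \<in> carrier (free_Abelian_group S)" for u
    using E.hom_inv[OF that] that by (simp add: a_inv_def)
  have d: "e (u - v) = e u \<ominus> e v"
    if "u \<in> carrier (free_Abelian_group S)" "v \<in> carrier (free_Abelian_group S)" for u v
    using a[OF that(1), of "- v"] m[OF that(2)] that by (simp add: minus_eq)
  show thesis using that[OF e z a m d] .
qed

section \<open>Tensor products with a left module\<close>

locale tensor = right_module R M + L: left_mod R N
  for R :: "('a, 'b) ring_scheme" (structure) and M :: "('a, 'm, 'c) rmodule_scheme" (structure)
    and N :: "('a, 'n, 'd) module_scheme" (structure)
begin

abbreviation "Fr \<equiv> free_Abelian_group (carrier M \<times> carrier N)"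
abbreviation "Ker \<equiv> tensor_kernel R M N"

lemma relations_closed: "tensor_relations R M N \<subseteq> carrier Fr"
proof -
  have "Poly_Mapping.keys (a - b) \<subseteq> S" if "Poly_Mapping.keys a \<subseteq> S" "Poly_Mapping.keys b \<subseteq> S"
    for a b :: "('m \<times> 'n) \<Rightarrow>\<^sub>0 int" and S
    using keys_diff[of a b] that by blast
  note D = this
  show ?thesis
  proof
    fix w assume "w \<in> tensor_relations R M N"
    then show "w \<in> carrier Fr"
      unfolding tensor_relations_def carrier_free_Abelian_group_iff
      by (elim UnE CollectE exE conjE) (simp_all add: D)
  qed
qed

lemma Ker_subgroup: "subgroup Ker Fr"
  unfolding tensor_kernel_def by (rule group.generate_is_subgroup[OF group_free_Abelian_group relations_closed])

lemma Ker_keys: "u \<in> Ker \<Longrightarrow> Poly_Mapping.keys u \<subseteq> carrier M \<times> carrier N"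
  by (rule carrier_free_Abelian_group_iff[THEN iffD1, OF subgroup.mem_carrier[OF Ker_subgroup]])

lemma Ker_zero: "0 \<in> Ker"
  using subgroup.one_closed[OF Ker_subgroup] by simp

lemma Ker_add: "\<lbrakk>u \<in> Ker; v \<in> Ker\<rbrakk> \<Longrightarrow> u + v \<in> Ker"
  using subgroup.m_closed[OF Ker_subgroup] by fastforce

lemma Ker_uminus: "u \<in> Ker \<Longrightarrow> - u \<in> Ker"
  using subgroup.m_inv_closed[OF Ker_subgroup] Ker_keys inv_free_Abelian_group by fastforce

lemma Ker_diff: "\<lbrakk>u \<in> Ker; v \<in> Ker\<rbrakk> \<Longrightarrow> u - v \<in> Ker"
  using Ker_add[OF _ Ker_uminus] by (metis diff_conv_add_uminus)

lemma Ker_add_left: "\<lbrakk>x \<in> carrier M; y \<in> carrier M; n \<in> carrier N\<rbrakk>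
    \<Longrightarrow> frag_of (x \<oplus>\<^bsub>M\<^esub> y, n) - frag_of (x, n) - frag_of (y, n) \<in> Ker"
  and Ker_add_right: "\<lbrakk>x \<in> carrier M; n \<in> carrier N; p \<in> carrier N\<rbrakk>
    \<Longrightarrow> frag_of (x, n \<oplus>\<^bsub>N\<^esub> p) - frag_of (x, n) - frag_of (x, p) \<in> Ker"
  and Ker_act: "\<lbrakk>x \<in> carrier M; r \<in> carrier R; n \<in> carrier N\<rbrakk>
    \<Longrightarrow> frag_of (x \<bullet>\<^bsub>M\<^esub> r, n) - frag_of (x, r \<odot>\<^bsub>N\<^esub> n) \<in> Ker"
  unfolding tensor_kernel_def tensor_relations_def by (rule generate.incl; blast)+

lemma Ker_zero_left: "n \<in> carrier N \<Longrightarrow> frag_of (\<zero>\<^bsub>M\<^esub>, n) \<in> Ker"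
  using Ker_uminus[OF Ker_add_left[of "\<zero>\<^bsub>M\<^esub>" "\<zero>\<^bsub>M\<^esub>" n]] by simp

lemma Ker_zero_right: "x \<in> carrier M \<Longrightarrow> frag_of (x, \<zero>\<^bsub>N\<^esub>) \<in> Ker"
  using Ker_uminus[OF Ker_add_right[of x "\<zero>\<^bsub>N\<^esub>" "\<zero>\<^bsub>N\<^esub>"]] by simp

text \<open>For \<open>i\<close> in the annihilator of \<open>x\<close>,
  \<open>x \<otimes> i n = x i \<otimes> n = 0\<close>; additivity in the second factor handles sums
  of such products.\<close>

lemma Ker_span:
  assumes x: "x \<in> carrier M" and I: "I \<subseteq> ann R M x" and n: "n \<in> L.span I"
  shows "frag_of (x, n) \<in> Ker"
  using n
proof (induction rule: L.span.induct)
  case zero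
  then show ?case by (rule Ker_zero_right[OF x])
next
  case (step i n s)
  have i: "i \<in> carrier R" "x \<bullet>\<^bsub>M\<^esub> i = \<zero>\<^bsub>M\<^esub>" using step I by (auto simp: ann_def)
  have sc: "s \<in> carrier N" using step(3) I by (intro L.span_closed) (auto simp: ann_def)
  let ?p = "i \<odot>\<^bsub>N\<^esub> n"
  have "frag_of (\<zero>\<^bsub>M\<^esub>, n) - (frag_of (x \<bullet>\<^bsub>M\<^esub> i, n) - frag_of (x, ?p)) \<in> Ker"
    by (rule Ker_diff[OF Ker_zero_left Ker_act]) (use x i step in auto)
  then have "frag_of (x, ?p) \<in> Ker" using i by simp
  then have "frag_of (x, ?p \<oplus>\<^bsub>N\<^esub> s) - frag_of (x, ?p) - frag_of (x, s) + frag_of (x, ?p) + frag_of (x, s) \<in> Ker"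
    by (intro Ker_add Ker_add_right) (use x i step sc in auto)
  then show ?case by simp
qed

lemma Ker_normal: "Ker \<lhd> Fr"
  by (rule comm_group.subgroup_imp_normal[OF abelian_free_Abelian_group Ker_subgroup])

lemma trivial_tensorI:
  assumes "\<And>x n. \<lbrakk>x \<in> carrier M; n \<in> carrier N\<rbrakk> \<Longrightarrow> frag_of (x, n) \<in> Ker"
  shows "trivial_group (tensor_product R M N)"
proof -
  interpret Ker: normal Ker Fr by (rule Ker_normal)
  have "u \<in> Ker" if u: "u \<in> carrier Fr" for u
    by (rule free_Abelian_group_induct[of u]) (use u assms Ker_zero Ker_diff in auto)
  then have "Ker #>\<^bsub>Fr\<^esub> u = Ker" if "u \<in> carrier Fr" for u
    using that subgroup.rcos_const[OF Ker_subgroup group_free_Abelian_group] by blast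
  moreover have "0 \<in> carrier Fr" by simp
  ultimately have "carrier (Fr Mod Ker) = {Ker}"
    unfolding FactGroup_def RCOSETS_def partial_object.simps by blast
  then show ?thesis
    unfolding trivial_group_def tensor_product_def using Ker.factorgroup_is_group by (simp add: FactGroup_def)
qed

lemma trivial_tensorD:
  assumes t: "carrier (tensor_product R M N) = {z}" and x: "x \<in> carrier M" and n: "n \<in> carrier N"
  shows "frag_of (x, n) \<in> Ker"
proof -
  interpret Ker: normal Ker Fr by (rule Ker_normal)
  have "Ker #>\<^bsub>Fr\<^esub> u \<in> carrier (tensor_product R M N)" if "u \<in> carrier Fr" for u
    using that by (auto simp: tensor_product_def FactGroup_def RCOSETS_def)
  then have "Ker #>\<^bsub>Fr\<^esub> frag_of (x, n) = Ker #>\<^bsub>Fr\<^esub> \<one>\<^bsub>Fr\<^esub>"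
    using t x n by simp
  also have "\<dots> = Ker"
    using Ker.subset by (rule group.coset_mult_one[OF group_free_Abelian_group])
  finally show ?thesis
    using group.rcos_self[OF group_free_Abelian_group _ Ker_subgroup, of "frag_of (x, n)"] x n by simp
qed

text \<open>Half of \<open>R/I \<otimes> N = N / I N\<close>, for a cyclic module \<open>c R\<close>
  with \<open>I\<close> the annihilator of \<open>c\<close>: sending \<open>c r \<otimes> p\<close>
  to \<open>r p\<close> is well defined modulo \<open>I N\<close>, so a vanishing
  \<open>c \<otimes> n\<close> forces \<open>n \<in> I N\<close>.\<close>

lemma span_if_Ker_cyclic:
  assumes c: "c \<in> carrier M" and cyc: "\<And>m. m \<in> carrier M \<Longrightarrow> \<exists>r\<in>carrier R. m = c \<bullet>\<^bsub>M\<^esub> r"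
    and n: "n \<in> carrier N" and k: "frag_of (c, n) \<in> Ker"
  shows "n \<in> L.span (ann R M c)"
proof -
  define I where "I = ann R M c"
  have I: "I \<subseteq> carrier R" by (auto simp: I_def ann_def)
  \<comment> \<open>A chosen coefficient with \<open>m = c r\<close>. It need not be additive in
    \<open>m\<close>, but by \<open>mem\<close> below two coefficients of one element differ by an
    element of \<open>I\<close>.\<close>
  define lift where "lift m = (SOME r. r \<in> carrier R \<and> m = c \<bullet>\<^bsub>M\<^esub> r)" for m
  have lift: "lift m \<in> carrier R \<and> m = c \<bullet>\<^bsub>M\<^esub> lift m" if "m \<in> carrier M" for m
    unfolding lift_def by (rule someI_ex) (use cyc that in blast)
  have lc [simp]: "lift m \<in> carrier R" if "m \<in> carrier M" for m using lift that by blast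
  have mem: "r \<ominus> s \<in> I" if "r \<in> carrier R" "s \<in> carrier R" "c \<bullet>\<^bsub>M\<^esub> r = c \<bullet>\<^bsub>M\<^esub> s" for r s
    using that c by (simp add: I_def ann_def R.minus_eq act_r_distr act_minus M.r_neg)
  have closed: "(\<lambda>(m, p). lift m \<odot>\<^bsub>N\<^esub> p) x \<in> carrier N" if "x \<in> carrier M \<times> carrier N" for x
    using that by auto
  obtain e
    where "e \<in> hom Fr (add_monoid N)"
    and e': "\<And>x. x \<in> carrier M \<times> carrier N \<Longrightarrow> e (frag_of x) = (\<lambda>(m, p). lift m \<odot>\<^bsub>N\<^esub> p) x"
    and e_zero: "e 0 = \<zero>\<^bsub>N\<^esub>"
    and e_add: "\<And>u v. \<lbrakk>u \<in> carrier Fr; v \<in> carrier Fr\<rbrakk> \<Longrightarrow> e (u + v) = e u \<oplus>\<^bsub>N\<^esub> e v"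
    and e_uminus: "\<And>u. u \<in> carrier Fr \<Longrightarrow> e (- u) = \<ominus>\<^bsub>N\<^esub> e u"
    and e_diff: "\<And>u v. \<lbrakk>u \<in> carrier Fr; v \<in> carrier Fr\<rbrakk> \<Longrightarrow> e (u - v) = e u \<ominus>\<^bsub>N\<^esub> e v"
    by (rule L.N.free_Abelian_group_hom[where S = "carrier M \<times> carrier N", OF closed]) (assumption, rule that)
  have e: "e (frag_of (m, p)) = lift m \<odot>\<^bsub>N\<^esub> p" if "m \<in> carrier M" "p \<in> carrier N" for m p
    using e'[of "(m, p)"] that by simp
  \<comment> \<open>In place of a map into the quotient \<open>N / I N\<close>, the preimage of
    \<open>I N\<close> under \<open>e\<close> is shown to be a subgroup containing all tensor
    relations.\<close>
  define S where "S = {u \<in> carrier Fr. e u \<in> L.span I}"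
  have "subgroup S Fr"
  proof (rule group.subgroupI[OF group_free_Abelian_group])
    show "S \<noteq> {}" using e_zero L.span.zero by (auto simp: S_def intro!: exI[of _ 0])
    show "inv\<^bsub>Fr\<^esub> u \<in> S" if "u \<in> S" for u
      using that e_uminus[of u] L.span_minus[OF _ I] by (auto simp: S_def)
    show "u \<otimes>\<^bsub>Fr\<^esub> v \<in> S" if "u \<in> S" "v \<in> S" for u v
      using that e_add[of u v] L.span_add[OF _ _ I] monoid.m_closed[OF group.is_monoid[OF group_free_Abelian_group], of u "carrier M \<times> carrier N" v]
      by (auto simp: S_def)
  qed (auto simp: S_def)
  moreover have "tensor_relations R M N \<subseteq> S"
  proof
    fix w assume w: "w \<in> tensor_relations R M N"
    then have "w \<in> carrier Fr" using relations_closed by blast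
    moreover have "e w \<in> L.span I"
    proof -
      consider (a) x y p where "w = frag_of (x \<oplus>\<^bsub>M\<^esub> y, p) - frag_of (x, p) - frag_of (y, p)"
          "x \<in> carrier M" "y \<in> carrier M" "p \<in> carrier N"
        | (b) x p q where "w = frag_of (x, p \<oplus>\<^bsub>N\<^esub> q) - frag_of (x, p) - frag_of (x, q)"
          "x \<in> carrier M" "p \<in> carrier N" "q \<in> carrier N"
        | (c) x r p where "w = frag_of (x \<bullet>\<^bsub>M\<^esub> r, p) - frag_of (x, r \<odot>\<^bsub>N\<^esub> p)"
          "x \<in> carrier M" "r \<in> carrier R" "p \<in> carrier N"
        using w unfolding tensor_relations_def by blast
      then show ?thesis
      proof cases
        case a
        have "frag_of (x \<oplus>\<^bsub>M\<^esub> y, p) - frag_of (x, p) \<in> carrier Fr"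
          using a keys_diff[of "frag_of (x \<oplus>\<^bsub>M\<^esub> y, p)" "frag_of (x, p)"] by auto
        then have "e w = lift (x \<oplus>\<^bsub>M\<^esub> y) \<odot>\<^bsub>N\<^esub> p \<ominus>\<^bsub>N\<^esub> lift x \<odot>\<^bsub>N\<^esub> p \<ominus>\<^bsub>N\<^esub> lift y \<odot>\<^bsub>N\<^esub> p"
          using a by (simp add: e_diff e)
        also have "\<dots> = (lift (x \<oplus>\<^bsub>M\<^esub> y) \<ominus> (lift x \<oplus> lift y)) \<odot>\<^bsub>N\<^esub> p"
          using a by (simp add: R.minus_eq R.minus_add L.N.minus_eq L.smult_l_distr L.smult_minus_left L.N.a_assoc)
        finally show ?thesis
          using a lift[of "x \<oplus>\<^bsub>M\<^esub> y"] lift[of x] lift[of y] c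
            L.span_single[OF mem[of "lift (x \<oplus>\<^bsub>M\<^esub> y)" "lift x \<oplus> lift y"] _ I, of p]
          by (simp add: act_r_distr)
      next
        case b
        have "frag_of (x, p \<oplus>\<^bsub>N\<^esub> q) - frag_of (x, p) \<in> carrier Fr"
          using b keys_diff[of "frag_of (x, p \<oplus>\<^bsub>N\<^esub> q)" "frag_of (x, p)"] by auto
        then have "e w = \<zero>\<^bsub>N\<^esub>"
          using b by (simp add: e_diff e L.smult_r_distr L.N.minus_eq L.N.a_ac L.N.r_neg L.N.a_cancel L.N.r_neg1 L.N.r_neg2)
        then show ?thesis using L.span.zero by simp
      next
        case c: c
        have "e w = lift (x \<bullet>\<^bsub>M\<^esub> r) \<odot>\<^bsub>N\<^esub> p \<ominus>\<^bsub>N\<^esub> lift x \<odot>\<^bsub>N\<^esub> (r \<odot>\<^bsub>N\<^esub> p)"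
          using c by (simp add: e_diff e)
        also have "\<dots> = (lift (x \<bullet>\<^bsub>M\<^esub> r) \<ominus> lift x \<otimes> r) \<odot>\<^bsub>N\<^esub> p"
          using c by (simp add: R.minus_eq L.N.minus_eq L.smult_l_distr L.smult_minus_left L.smult_assoc)
        finally show ?thesis
          using c lift[of "x \<bullet>\<^bsub>M\<^esub> r"] lift[of x] assms(1)
            L.span_single[OF mem[of "lift (x \<bullet>\<^bsub>M\<^esub> r)" "lift x \<otimes> r"] _ I, of p]
          by (simp add: act_assoc)
      qed
    qed
    ultimately show "w \<in> S" by (simp add: S_def)
  qed
  ultimately have "Ker \<subseteq> S"
    unfolding tensor_kernel_def using group.generate_subgroup_incl[OF group_free_Abelian_group] by blast
  then have "lift c \<odot>\<^bsub>N\<^esub> n \<in> L.span I" using k e c n by (auto simp: S_def)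
  \<comment> \<open>The coefficient chosen for \<open>c\<close> need not be \<open>\<one>\<close>,
    but the two differ by an element of \<open>I\<close>, so \<open>n\<close> and
    \<open>lift c \<odot> n\<close> agree modulo the span.\<close>
  moreover have "(\<one> \<ominus> lift c) \<odot>\<^bsub>N\<^esub> n \<in> L.span I"
    using mem[of \<one> "lift c"] lift[OF c] c n by (intro L.span_single I) auto
  moreover have "(\<one> \<ominus> lift c) \<odot>\<^bsub>N\<^esub> n \<oplus>\<^bsub>N\<^esub> lift c \<odot>\<^bsub>N\<^esub> n = n"
    using c n by (simp add: R.minus_eq R.a_assoc R.l_neg flip: L.smult_l_distr)
  ultimately show ?thesis using L.span_add[OF _ _ I] unfolding I_def by metis
qed

end

section \<open>Faithful filters\<close>

lemma (in ring) csum_fun: "csum [] = (\<lambda>_. \<zero>)" "csum (p # ps) = (\<lambda>a. fst p \<otimes> snd p a \<oplus> csum ps a)"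
  by (rule ext, simp)+

locale faithful_gabriel = gabriel R F for R :: "('a, 'b) ring_scheme" (structure) and F +
  assumes faithful: "faithful R F"
begin

sublocale S: quotients R "self_module R" F
  by (intro quotients.intro right_module_self gabriel_axioms)

abbreviation "rg \<equiv> qgerm R F (self_module R)"
abbreviation "LQ \<equiv> left_quotients R F"

lemma torsion_self: "torsion R F (self_module R) = {\<zero>}"
  using faithful by (simp add: faithful_def)

lemma cl_self: "x \<in> carrier R \<Longrightarrow> tcoset R F (self_module R) x = {x}"
  by (simp add: tcoset_def torsion_self a_r_coset_def')

text \<open>Cosets of the zero torsion submodule are singletons, so linearity modulo torsion is
  linearity.\<close>

lemma lin_self_iff: "J \<in> F \<Longrightarrow> tlin R F (self_module R) J g \<longleftrightarrow> rlin J g"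
proof
  assume J: "J \<in> F"
  { assume g: "tlin R F (self_module R) J g"
    note c = S.linD(1)[OF g, simplified]
    have "g (a \<oplus> b) = g a \<oplus> g b" if "a \<in> J" "b \<in> J" for a b
    proof -
      have "tcoset R F (self_module R) (g (a \<oplus> b)) = tcoset R F (self_module R) (g a \<oplus> g b)"
        using g that by (simp add: tlin_def)
      then show ?thesis using that c filter_add[OF J that] by (simp add: cl_self)
    qed
    moreover have "g (a \<otimes> r) = g a \<otimes> r" if "a \<in> J" "r \<in> carrier R" for a r
    proof -
      have "tcoset R F (self_module R) (g (a \<otimes> r)) = tcoset R F (self_module R) (g a \<otimes> r)"
        using g that by (simp add: tlin_def)
      then show ?thesis using that c filter_mult[OF J that] by (simp add: cl_self)
    qed
    ultimately show "rlin J g" using c by (simp add: rlin_def) }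
  assume "rlin J g"
  then show "tlin R F (self_module R) J g" by (simp add: rlin_def tlin_def)
qed

lemma carrier_LQ: "carrier LQ = {rg J g | J g. J \<in> F \<and> rlin J g}"
proof (intro equalityI subsetI)
  fix x assume "x \<in> carrier LQ"
  then have "x \<in> carrier S.Q" by (simp add: left_quotients_def)
  then obtain J g where "J \<in> F" "tlin R F (self_module R) J g" "x = rg J g" by (rule S.qg_cases)
  then show "x \<in> {rg J g | J g. J \<in> F \<and> rlin J g}" by (auto simp: lin_self_iff)
next
  fix x assume "x \<in> {rg J g | J g. J \<in> F \<and> rlin J g}"
  then obtain J g where "J \<in> F" "rlin J g" "x = rg J g" by blast
  then show "x \<in> carrier LQ" using S.qg_closed by (simp add: left_quotients_def lin_self_iff)
qed

lemma rg_eqI: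
  assumes "I \<in> F" "rlin I g" "J \<in> F" "rlin J h" "K \<in> F" "K \<subseteq> I" "K \<subseteq> J"
    "\<And>a. a \<in> K \<Longrightarrow> g a = h a"
  shows "rg I g = rg J h"
  using assms by (intro S.qg_eqI[where K = K]) (simp_all add: lin_self_iff)

lemma rg_cong:
  assumes "J \<in> F" "rlin J g" "K \<in> F" "K \<subseteq> J" "\<And>a. a \<in> K \<Longrightarrow> g a = h a"
  shows "rg J g = rg K h"
proof (rule rg_eqI[OF assms(1,2,3) _ assms(3,4) subset_refl assms(5)])
  show "rlin K h"
    using assms rlin_subset[OF assms(2,4)] filter_add[OF assms(3)] filter_mult[OF assms(3)]
    by (simp add: rlin_def)
qed

lemma rg_eqD:
  assumes "I \<in> F" "rlin I g" "J \<in> F" "rlin J h" "rg I g = rg J h"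
  obtains K where "K \<in> F" "K \<subseteq> I" "K \<subseteq> J" "\<And>a. a \<in> K \<Longrightarrow> g a = h a"
proof -
  obtain K where K: "K \<in> F" "K \<subseteq> I \<inter> J"
    "\<forall>a\<in>K. tcoset R F (self_module R) (g a) = tcoset R F (self_module R) (h a)"
    using S.qg_eq_iff[of I g J h] assms by (auto simp: lin_self_iff)
  have "g a = h a" if "a \<in> K" for a
  proof -
    have "a \<in> I" "a \<in> J" using K(2) that by auto
    then have "{g a} = {h a}"
      using K(3)[THEN bspec, OF that] rlinD(1)[OF assms(2)] rlinD(1)[OF assms(4)]
      by (simp only: cl_self)
    then show ?thesis by simp
  qed
  then show thesis using that[OF K(1)] K(2) by simp
qed

text \<open>The difference \<open>g a - h a\<close> is annihilated by \<open>(K : a)\<close>, which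
  lies in \<open>F\<close>; it is therefore torsion, and zero by faithfulness. Equality of germs
  thus spreads to the whole common domain.\<close>

lemma rlin_eq_extend:
  assumes "J \<in> F" "rlin J g" "rlin J h" "K \<in> F" "\<And>a. a \<in> K \<Longrightarrow> g a = h a" and a: "a \<in> J"
  shows "g a = h a"
proof -
  note c = rlinD(1)[OF assms(2) a] rlinD(1)[OF assms(3) a] filter_mem[OF assms(1) a]
  have "(g a \<ominus> h a) \<otimes> r = \<zero>" if r: "r \<in> colon R K a" for r
  proof -
    have r': "r \<in> carrier R" "g (a \<otimes> r) = h (a \<otimes> r)" using r assms(5) by (auto simp: colon_def)
    then have "g a \<otimes> r = h a \<otimes> r" using rlinD(3)[OF assms(2) a] rlinD(3)[OF assms(3) a] by simp
    then show ?thesis using c r' by (simp add: minus_eq l_distr l_minus r_neg)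
  qed
  then have "colon R K a \<subseteq> ann R (self_module R) (g a \<ominus> h a)" by (auto simp: ann_def colon_def)
  then have "ann R (self_module R) (g a \<ominus> h a) \<in> F"
    using filter_up[OF filter_colon[OF assms(4) c(3)] right_ideal_ann] c by simp
  then have "g a \<ominus> h a \<in> torsion R F (self_module R)" unfolding torsion_def using c by simp
  then show ?thesis using c by (simp add: torsion_self r_right_minus_eq)
qed

lemma rg_add:
  assumes "I \<in> F" "rlin I g" "J \<in> F" "rlin J h"
  shows "rg I g \<oplus>\<^bsub>LQ\<^esub> rg J h = rg (I \<inter> J) (\<lambda>a. g a \<oplus> h a)"
  using assms S.qg_add[of I g J h] by (simp add: left_quotients_def lin_self_iff)

lemma rg_zero: "\<zero>\<^bsub>LQ\<^esub> = rg (carrier R) (\<lambda>_. \<zero>)"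
  using S.qg_zero by (simp add: left_quotients_def)

end

section \<open>The product of a module with a faithful ring of quotients\<close>

locale faithful_quotients = quotients R M F + FG: faithful_gabriel R F
  for R :: "('a, 'b) ring_scheme" (structure) and M :: "('a, 'm, 'c) rmodule_scheme" (structure) and F
begin

lemma lin_scale: "\<lbrakk>m \<in> carrier M; rlin J g\<rbrakk> \<Longrightarrow> lin J (\<lambda>a. m \<bullet>\<^bsub>M\<^esub> g a)"
  by (intro linI) (auto simp: R.rlinD cl_act N.act_r_distr N.act_assoc)

lemma scale_rg:
  assumes m: "m \<in> carrier M" and J: "J \<in> F" "rlin J g"
  shows "scale R F M m (FG.rg J g) = qg J (\<lambda>a. m \<bullet>\<^bsub>M\<^esub> g a)"
  unfolding scale_def
proof (rule FG.S.qg_Union)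
  show "tlin R F (self_module R) J g" using J by (simp add: FG.lin_self_iff)
  fix I h assume I: "I \<in> F" "tlin R F (self_module R) I h" "FG.rg I h = FG.rg J g"
  then have h: "rlin I h" by (simp add: FG.lin_self_iff)
  have "germ R F M I (\<lambda>a. \<Union>r\<in>restrict (\<lambda>a. tcoset R F (self_module R) (h a)) I a. T +>\<^bsub>M\<^esub> (m \<bullet>\<^bsub>M\<^esub> r))
      = qg I (\<lambda>a. m \<bullet>\<^bsub>M\<^esub> h a)"
    unfolding qgerm_def
    by (rule germ_cong) (simp add: FG.cl_self R.rlinD(1)[OF h] tcoset_def[of R F M])
  also have "\<dots> = qg J (\<lambda>a. m \<bullet>\<^bsub>M\<^esub> g a)"
  proof -
    obtain K where K: "K \<in> F" "K \<subseteq> I" "K \<subseteq> J" "\<And>a. a \<in> K \<Longrightarrow> h a = g a"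
      using FG.rg_eqD[OF I(1) h J I(3)] by blast
    show ?thesis by (rule qg_eqI[OF I(1) lin_scale[OF m h] J(1) lin_scale[OF m J(2)] K(1-3)]) (simp add: K(4))
  qed
  finally show "germ R F M I (\<lambda>a. \<Union>r\<in>restrict (\<lambda>a. tcoset R F (self_module R) (h a)) I a. T +>\<^bsub>M\<^esub> (m \<bullet>\<^bsub>M\<^esub> r))
      = qg J (\<lambda>a. m \<bullet>\<^bsub>M\<^esub> g a)" .
qed (rule J(1))

end

lemma (in faithful_gabriel) rg_scale:
  assumes "r \<in> carrier R" "J \<in> F" "rlin J g"
  shows "r \<odot>\<^bsub>LQ\<^esub> rg J g = rg J (\<lambda>a. r \<otimes> g a)"
proof -
  interpret faithful_quotients R "self_module R" F by unfold_locales
  show ?thesis using scale_rg[of r J g] assms by (simp add: left_quotients_def)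
qed

text \<open>The left \<open>R\<close>-submodule \<open>R\<^sub>H\<close> of \<open>R\<^sub>F\<close>, for a filter \<open>H \<subseteq> F\<close>.\<close>

locale sub_quotients = faithful_gabriel R F + H: gabriel R H
  for R :: "('a, 'b) ring_scheme" (structure) and F H +
  assumes sub: "H \<subseteq> F"
begin

text \<open>The elements remain germs for \<open>F\<close>; only their representatives are required
  to have a domain in \<open>H\<close>. With \<open>F\<close> the Lambek filter and \<open>H\<close>
  the closure \<open>tot_closure\<close>, this is \<open>Q_tot\<close>.\<close>

definition "SQ = LQ\<lparr>carrier := {rg J g | J g. J \<in> H \<and> rlin J g}\<rparr>"

lemma SQ_simps [simp]: "carrier SQ = {rg J g | J g. J \<in> H \<and> rlin J g}"
  "x \<oplus>\<^bsub>SQ\<^esub> y = x \<oplus>\<^bsub>LQ\<^esub> y" "\<zero>\<^bsub>SQ\<^esub> = \<zero>\<^bsub>LQ\<^esub>" "r \<odot>\<^bsub>SQ\<^esub> x = r \<odot>\<^bsub>LQ\<^esub> x"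
  by (simp_all add: SQ_def)

lemma mem_sub: "J \<in> H \<Longrightarrow> J \<in> F"
  using sub by blast

lemma rlin_Int_plus: "\<lbrakk>rlin I g; rlin J h\<rbrakk> \<Longrightarrow> rlin (I \<inter> J) (\<lambda>a. g a \<oplus> h a)"
  by (intro rlin_plus) (auto intro: rlin_subset)

lemma SQ_closed: "\<lbrakk>J \<in> H; rlin J g\<rbrakk> \<Longrightarrow> rg J g \<in> carrier SQ"
  by auto

lemma SQ_cases:
  assumes "x \<in> carrier SQ"
  obtains J g where "J \<in> H" "J \<in> F" "rlin J g" "x = rg J g"
  using assms mem_sub by auto

lemma SQ_left_mod: "left_mod R SQ"
proof (intro left_mod.intro left_mod_axioms.intro ring_axioms)
  show "abelian_group SQ"
  proof (rule abelian_groupI)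
    show "\<zero>\<^bsub>SQ\<^esub> \<in> carrier SQ"
      unfolding SQ_simps(3) rg_zero by (rule SQ_closed[OF H.filter_carrier rlin_zero])
    fix x assume "x \<in> carrier SQ"
    then obtain I g where I: "I \<in> H" "I \<in> F" "rlin I g" "x = rg I g" by (rule SQ_cases)
    show "\<zero>\<^bsub>SQ\<^esub> \<oplus>\<^bsub>SQ\<^esub> x = x"
      unfolding SQ_simps(2,3) I(4) rg_zero rg_add[OF filter_carrier rlin_zero I(2,3)]
      by (rule rg_cong[symmetric, OF I(2,3)]) (use I filter_subset rlinD(1)[OF I(3)] in auto)
    have m: "rlin I (\<lambda>a. \<ominus> \<one> \<otimes> g a)" using I by (intro rlin_scale) auto
    have "rg I (\<lambda>a. \<ominus> \<one> \<otimes> g a) \<oplus>\<^bsub>SQ\<^esub> x = \<zero>\<^bsub>SQ\<^esub>"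
      unfolding SQ_simps(2,3) I(4) rg_zero rg_add[OF I(2) m I(2,3)]
      by (rule rg_cong[symmetric, OF filter_carrier rlin_zero])
         (use I filter_subset rlinD(1)[OF I(3)] in \<open>auto simp: l_minus l_neg\<close>)
    then show "\<exists>y\<in>carrier SQ. y \<oplus>\<^bsub>SQ\<^esub> x = \<zero>\<^bsub>SQ\<^esub>" using SQ_closed[OF I(1) m] by blast
    fix y assume "y \<in> carrier SQ"
    then obtain J h where J: "J \<in> H" "J \<in> F" "rlin J h" "y = rg J h" by (rule SQ_cases)
    note IJ = filter_Int[OF I(2) J(2)] rlin_Int_plus[OF I(3) J(3)]
    show "x \<oplus>\<^bsub>SQ\<^esub> y \<in> carrier SQ"
      unfolding SQ_simps(2) I(4) J(4) rg_add[OF I(2,3) J(2,3)]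
      by (rule SQ_closed[OF H.filter_Int[OF I(1) J(1)] IJ(2)])
    show "x \<oplus>\<^bsub>SQ\<^esub> y = y \<oplus>\<^bsub>SQ\<^esub> x"
      unfolding SQ_simps(2) I(4) J(4) rg_add[OF I(2,3) J(2,3)] rg_add[OF J(2,3) I(2,3)]
      by (rule rg_cong[OF IJ]) (use I J rlinD(1)[OF I(3)] rlinD(1)[OF J(3)] in \<open>auto simp: a_comm\<close>)
    fix z assume "z \<in> carrier SQ"
    then obtain K k where K: "K \<in> H" "K \<in> F" "rlin K k" "z = rg K k" by (rule SQ_cases)
    note JK = filter_Int[OF J(2) K(2)] rlin_Int_plus[OF J(3) K(3)]
    show "x \<oplus>\<^bsub>SQ\<^esub> y \<oplus>\<^bsub>SQ\<^esub> z = x \<oplus>\<^bsub>SQ\<^esub> (y \<oplus>\<^bsub>SQ\<^esub> z)"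
      unfolding SQ_simps(2) I(4) J(4) K(4) rg_add[OF I(2,3) J(2,3)] rg_add[OF J(2,3) K(2,3)]
        rg_add[OF IJ K(2,3)] rg_add[OF I(2,3) JK]
      by (rule rg_cong[OF filter_Int[OF IJ(1) K(2)] rlin_Int_plus[OF IJ(2) K(3)]])
         (use I J K rlinD(1)[OF I(3)] rlinD(1)[OF J(3)] rlinD(1)[OF K(3)] in \<open>auto simp: a_assoc\<close>)
  qed
next
  fix r x assume r: "r \<in> carrier R" and "x \<in> carrier SQ"
  then obtain I g where I: "I \<in> H" "I \<in> F" "rlin I g" "x = rg I g" by (elim SQ_cases)
  note g = rlinD(1)[OF I(3)]
  note rI = rg_scale[OF r I(2,3)] rlin_scale[OF I(3) r]
  show "r \<odot>\<^bsub>SQ\<^esub> x \<in> carrier SQ"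
    unfolding SQ_simps(4) I(4) rI(1) by (rule SQ_closed[OF I(1) rI(2)])
  { fix y assume "y \<in> carrier SQ"
    then obtain J h where J: "J \<in> H" "J \<in> F" "rlin J h" "y = rg J h" by (rule SQ_cases)
    note IJ = filter_Int[OF I(2) J(2)] rlin_Int_plus[OF I(3) J(3)]
    show "r \<odot>\<^bsub>SQ\<^esub> (x \<oplus>\<^bsub>SQ\<^esub> y) = r \<odot>\<^bsub>SQ\<^esub> x \<oplus>\<^bsub>SQ\<^esub> r \<odot>\<^bsub>SQ\<^esub> y"
      unfolding SQ_simps(2,4) I(4) J(4) rg_add[OF I(2,3) J(2,3)] rg_scale[OF r IJ] rI(1) rg_scale[OF r J(2,3)]
        rg_add[OF I(2) rI(2) J(2) rlin_scale[OF J(3) r]]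
      by (rule rg_cong[OF IJ(1) rlin_scale[OF IJ(2) r]])
         (use I J r g rlinD(1)[OF J(3)] in \<open>auto simp: r_distr\<close>) }
  fix s assume s: "s \<in> carrier R"
  note sI = rg_scale[OF s I(2,3)] rlin_scale[OF I(3) s]
  show "(r \<oplus> s) \<odot>\<^bsub>SQ\<^esub> x = r \<odot>\<^bsub>SQ\<^esub> x \<oplus>\<^bsub>SQ\<^esub> s \<odot>\<^bsub>SQ\<^esub> x"
    unfolding SQ_simps(2,4) I(4) rI(1) sI(1) rg_scale[OF a_closed[OF r s] I(2,3)]
      rg_add[OF I(2) rI(2) I(2) sI(2)] Int_absorb
    by (rule rg_cong[OF I(2) rlin_scale[OF I(3) a_closed[OF r s]]]) (use I r s g in \<open>auto simp: l_distr\<close>)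
  show "(r \<otimes> s) \<odot>\<^bsub>SQ\<^esub> x = r \<odot>\<^bsub>SQ\<^esub> (s \<odot>\<^bsub>SQ\<^esub> x)"
    unfolding SQ_simps(4) I(4) sI(1) rg_scale[OF r I(2) sI(2)] rg_scale[OF m_closed[OF r s] I(2,3)]
    by (rule rg_cong[OF I(2) rlin_scale[OF I(3) m_closed[OF r s]]]) (use I r s g in \<open>auto simp: m_assoc\<close>)
next
  fix x assume "x \<in> carrier SQ"
  then obtain I g where I: "I \<in> H" "I \<in> F" "rlin I g" "x = rg I g" by (elim SQ_cases)
  show "\<one> \<odot>\<^bsub>SQ\<^esub> x = x"
    unfolding SQ_simps(4) I(4) rg_scale[OF one_closed I(2,3)]
    by (rule rg_cong[symmetric, OF I(2,3)]) (use I rlinD(1)[OF I(3)] in auto)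
qed

sublocale SQ: left_mod R SQ by (rule SQ_left_mod)

text \<open>Together with \<open>span_combo\<close> it translates between the submodule
  \<open>I R_H\<close> and combinations with coefficients in \<open>I\<close>.\<close>

lemma combo_span:
  assumes K: "K \<in> H" and I: "I \<subseteq> carrier R"
  shows "combo I K ps \<Longrightarrow> rg K (csum ps) \<in> SQ.span I"
proof (induction ps)
  case Nil
  have "rg K (csum []) = \<zero>\<^bsub>SQ\<^esub>"
    unfolding SQ_simps(3) rg_zero
    by (rule rg_cong[symmetric, OF filter_carrier rlin_zero mem_sub[OF K] H.filter_subset[OF K]]) simp
  then show ?case using SQ.span.zero by (simp only:)
next
  case (Cons p ps)
  then have p: "fst p \<in> I" "fst p \<in> carrier R" "rlin K (snd p)" and ps: "combo I K ps" using I by auto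
  have "fst p \<odot>\<^bsub>SQ\<^esub> rg K (snd p) \<oplus>\<^bsub>SQ\<^esub> rg K (csum ps) = rg K (csum (p # ps))"
    unfolding SQ_simps(2,4) rg_scale[OF p(2) mem_sub[OF K] p(3)]
      rg_add[OF mem_sub[OF K] rlin_scale[OF p(3,2)] mem_sub[OF K] rlin_csum[OF ps I]] by (simp add: csum_fun)
  moreover have "fst p \<odot>\<^bsub>SQ\<^esub> rg K (snd p) \<oplus>\<^bsub>SQ\<^esub> rg K (csum ps) \<in> SQ.span I"
    by (rule SQ.span.step[OF p(1) SQ_closed[OF K p(3)] Cons.IH[OF ps]])
  ultimately show ?case by (simp only:)
qed

lemma span_combo:
  assumes I: "I \<subseteq> carrier R"
  shows "n \<in> SQ.span I \<Longrightarrow> \<exists>K\<in>H. \<exists>ps. combo I K ps \<and> n = rg K (csum ps)"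
proof (induction rule: SQ.span.induct)
  case zero
  have "\<zero>\<^bsub>SQ\<^esub> = rg (carrier R) (csum [])" unfolding SQ_simps(3) rg_zero csum_fun ..
  show ?case
    by (rule bexI[OF _ H.filter_carrier], rule exI, rule conjI[OF combo_Nil], fact)
next
  case (step i n s)
  obtain K ps where K: "K \<in> H" "combo I K ps" "s = rg K (csum ps)" using step.IH by blast
  obtain J g where J: "J \<in> H" "J \<in> F" "rlin J g" "n = rg J g" using step(2) by (rule SQ_cases)
  have i: "i \<in> carrier R" using step I by blast
  have "combo I (J \<inter> K) ((i, g) # ps)"
    using combo_subset[OF K(2), of "J \<inter> K"] rlin_subset[OF J(3), of "J \<inter> K"] step(1) by simp
  moreover have "i \<odot>\<^bsub>SQ\<^esub> n \<oplus>\<^bsub>SQ\<^esub> s = rg (J \<inter> K) (csum ((i, g) # ps))"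
    unfolding SQ_simps(2,4) J(4) K(3) rg_scale[OF i J(2,3)]
      rg_add[OF J(2) rlin_scale[OF J(3) i] mem_sub[OF K(1)] rlin_csum[OF K(2) I]]
    by (simp add: csum_fun)
  ultimately show ?case using H.filter_Int[OF J(1) K(1)] by blast
qed

text \<open>Composing a decomposition of \<open>\<one>\<close> with \<open>g\<close> decomposes the
  germ of \<open>g\<close>: \<open>g(a) = \<Sum> i_k h_k(g(a))\<close>.\<close>

lemma span_if_exhausts:
  assumes ex: "exhausts H I" and I: "I \<subseteq> carrier R" and n: "n \<in> carrier SQ"
  shows "n \<in> SQ.span I"
proof -
  obtain J g where J: "J \<in> H" "J \<in> F" "rlin J g" "n = rg J g" using n by (rule SQ_cases)
  obtain K ps where K: "K \<in> H" "combo I K ps" "\<forall>a\<in>K. csum ps a = a"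
    using ex unfolding exhausts_def by blast
  let ?D = "{a \<in> J. g a \<in> K}" and ?ps = "map (\<lambda>p. (fst p, snd p \<circ> g)) ps"
  have D: "?D \<in> H" by (rule H.rlin_pullback[OF J(1,3) K(1)])
  have "n = rg ?D (csum ?ps)"
    unfolding J(4) by (rule rg_cong[OF J(2,3) mem_sub[OF D]]) (use K(3) in \<open>auto simp: csum_comp\<close>)
  then show ?thesis using combo_span[OF D I combo_comp[OF K(2) J(3)]] by simp
qed

lemma one_closed_SQ: "rg (carrier R) (\<lambda>a. a) \<in> carrier SQ"
  by (rule SQ_closed[OF H.filter_carrier rlin_id[OF subset_refl]])

lemma exhausts_if_span:
  assumes I: "I \<subseteq> carrier R" and n: "rg (carrier R) (\<lambda>a. a) \<in> SQ.span I"
  shows "exhausts H I"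
proof -
  obtain K ps where K: "K \<in> H" "combo I K ps" "rg (carrier R) (\<lambda>a. a) = rg K (csum ps)"
    using span_combo[OF I n] by blast
  have l: "rlin K (csum ps)" "rlin K (\<lambda>a. a)"
    using rlin_csum[OF K(2) I] rlin_id[OF H.filter_subset[OF K(1)]] by auto
  obtain D where D: "D \<in> F" "\<And>a. a \<in> D \<Longrightarrow> a = csum ps a"
    by (rule rg_eqD[OF filter_carrier rlin_id[OF subset_refl] mem_sub[OF K(1)] l(1) K(3)]) (rule that)
  \<comment> \<open>The germs coincide only on some \<open>D \<in> F\<close>, which need not belong
    to \<open>H\<close>. Faithfulness extends the equality from \<open>D\<close> back to
    \<open>K \<in> H\<close>.\<close>
  have "csum ps a = a" if "a \<in> K" for a
    by (rule rlin_eq_extend[OF mem_sub[OF K(1)] l D(1) D(2)[symmetric] that])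
  then show ?thesis using K(1,2) unfolding exhausts_def by blast
qed

end

section \<open>Perfect filters\<close>

context faithful_gabriel
begin

lemma sub_quotients_self: "sub_quotients R F F"
  by (intro sub_quotients.intro sub_quotients_axioms.intro faithful_gabriel_axioms gabriel_axioms) simp

lemma SQ_self: "sub_quotients.SQ R F F = LQ"
  unfolding sub_quotients.SQ_def[OF sub_quotients_self] carrier_LQ[symmetric] by simp

lemmas LQ_left_mod = sub_quotients.SQ_left_mod[OF sub_quotients_self, unfolded SQ_self]
lemmas LQ_span_if_exhausts = sub_quotients.span_if_exhausts[OF sub_quotients_self, unfolded SQ_self]
lemmas exhausts_if_LQ_span = sub_quotients.exhausts_if_span[OF sub_quotients_self, unfolded SQ_self]

lemma rg_closed: "\<lbrakk>J \<in> F; rlin J g\<rbrakk> \<Longrightarrow> rg J g \<in> carrier LQ"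
  by (auto simp: carrier_LQ)

lemma rg_cases:
  assumes "x \<in> carrier LQ"
  obtains J g where "J \<in> F" "rlin J g" "x = rg J g"
  using assms by (auto simp: carrier_LQ)

end

section \<open>The tensor isomorphism for exhausting filters\<close>

locale exhausting_quotients = faithful_quotients R M F
  for R :: "('a, 'b) ring_scheme" (structure) and M :: "('a, 'm, 'c) rmodule_scheme" (structure) and F +
  assumes ex: "I \<in> F \<Longrightarrow> exhausts F I"
begin

sublocale X: tensor R M FG.LQ
  by (intro tensor.intro right_module_axioms FG.LQ_left_mod)

lemma scale_closed: "\<lbrakk>m \<in> carrier M; q \<in> carrier FG.LQ\<rbrakk> \<Longrightarrow> scale R F M m q \<in> carrier Q"
  by (erule FG.rg_cases) (simp add: scale_rg qg_closed lin_scale)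

lemma lin_plus_same: "\<lbrakk>J \<in> F; lin J \<nu>; lin J \<mu>\<rbrakk> \<Longrightarrow> lin J (\<lambda>a. \<nu> a \<oplus>\<^bsub>M\<^esub> \<mu> a)"
  using lin_plus[of J J] by simp

text \<open>With the next two lemmas, \<open>scale\<close> is biadditive and balanced, so it factors
  through the tensor product.\<close>

lemma scale_add_left:
  assumes "x \<in> carrier M" "y \<in> carrier M" "q \<in> carrier FG.LQ"
  shows "scale R F M (x \<oplus>\<^bsub>M\<^esub> y) q = scale R F M x q \<oplus>\<^bsub>Q\<^esub> scale R F M y q"
proof -
  obtain J g where J: "J \<in> F" "rlin J g" "q = FG.rg J g" using FG.rg_cases[OF assms(3)] .
  note l = lin_scale[OF assms(1) J(2)] lin_scale[OF assms(2) J(2)]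
  show ?thesis
    unfolding J(3) scale_rg[OF assms(1) J(1,2)] scale_rg[OF assms(2) J(1,2)]
      scale_rg[OF M.a_closed[OF assms(1,2)] J(1,2)] qg_add[OF J(1) l(1) J(1) l(2)] Int_absorb
    by (rule qg_eqI[OF J(1) lin_scale J(1) lin_plus_same[OF J(1) l] J(1)])
       (use assms J R.rlinD(1)[OF J(2)] in \<open>auto simp: act_l_distr\<close>)
qed

lemma scale_add_right:
  assumes "x \<in> carrier M" "p \<in> carrier FG.LQ" "q \<in> carrier FG.LQ"
  shows "scale R F M x (p \<oplus>\<^bsub>FG.LQ\<^esub> q) = scale R F M x p \<oplus>\<^bsub>Q\<^esub> scale R F M x q"
proof -
  obtain I g where I: "I \<in> F" "rlin I g" "p = FG.rg I g" using FG.rg_cases[OF assms(2)] .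
  obtain J h where J: "J \<in> F" "rlin J h" "q = FG.rg J h" using FG.rg_cases[OF assms(3)] .
  have IJ: "I \<inter> J \<in> F" "rlin (I \<inter> J) (\<lambda>a. g a \<oplus> h a)"
    using I J R.rlin_plus R.rlin_subset[OF I(2), of "I \<inter> J"] R.rlin_subset[OF J(2), of "I \<inter> J"] by auto
  note l = lin_scale[OF assms(1) I(2)] lin_scale[OF assms(1) J(2)]
  show ?thesis
    unfolding I(3) J(3) FG.rg_add[OF I(1,2) J(1,2)] scale_rg[OF assms(1) I(1,2)]
      scale_rg[OF assms(1) J(1,2)] scale_rg[OF assms(1) IJ] qg_add[OF I(1) l(1) J(1) l(2)]
    by (rule qg_eqI[OF IJ(1) lin_scale[OF assms(1) IJ(2)] IJ(1) lin_plus[OF I(1) J(1) l] IJ(1)])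
       (use assms R.rlinD(1)[OF I(2)] R.rlinD(1)[OF J(2)] in \<open>auto simp: act_r_distr\<close>)
qed

lemma scale_act:
  assumes "x \<in> carrier M" "r \<in> carrier R" "q \<in> carrier FG.LQ"
  shows "scale R F M (x \<bullet>\<^bsub>M\<^esub> r) q = scale R F M x (r \<odot>\<^bsub>FG.LQ\<^esub> q)"
proof -
  obtain J g where J: "J \<in> F" "rlin J g" "q = FG.rg J g" using FG.rg_cases[OF assms(3)] .
  note r = R.rlin_scale[OF J(2) assms(2)]
  show ?thesis
    unfolding J(3) FG.rg_scale[OF assms(2) J(1,2)] scale_rg[OF assms(1) J(1) r]
      scale_rg[OF act_closed[OF assms(1,2)] J(1,2)]
    by (rule qg_eqI[OF J(1) lin_scale J(1) lin_scale[OF assms(1) r] J(1)])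
       (use assms J R.rlinD(1)[OF J(2)] in \<open>auto simp: act_assoc\<close>)
qed

lemma lin_comp:
  assumes J: "J \<in> F" and \<nu>: "lin J \<nu>" and g: "rlin K g" and im: "\<And>a. a \<in> K \<Longrightarrow> g a \<in> J"
  shows "lin K (\<lambda>a. \<nu> (g a))"
  by (intro linI) (auto simp: im R.rlinD[OF g] linD[OF \<nu>])

text \<open>A lift need not vanish at zero. The empty combination produces exactly the value
  \<open>\<nu> \<zero>\<close>, which still has to give the zero germ.\<close>

lemma lin_at_zero: "\<lbrakk>J \<in> F; lin J \<nu>\<rbrakk> \<Longrightarrow> \<nu> \<zero> \<in> T"
proof -
  assume J: "J \<in> F" and \<nu>: "lin J \<nu>"
  note z = G.filter_zero[OF J]
  have "cl (\<nu> \<zero>) = cl (\<nu> \<zero>) \<bullet>\<^bsub>N\<^esub> \<zero>" using linD(3)[OF \<nu> z, of \<zero>] by simp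
  also have "\<dots> = cl \<zero>\<^bsub>M\<^esub>" using linD(1)[OF \<nu> z] by (simp add: quot_zero)
  finally show ?thesis using linD(1)[OF \<nu> z] by (simp add: cl_zero_iff)
qed

text \<open>A tensor \<open>\<Sum> \<nu>(i\<^sub>k) \<otimes> g\<^sub>k\<close> representing the germ of \<open>a \<mapsto> \<nu> (\<Sum> i\<^sub>k g\<^sub>k(a))\<close>.\<close>

primrec tens :: "('a \<Rightarrow> 'm) \<Rightarrow> 'a set \<Rightarrow> ('a \<times> ('a \<Rightarrow> 'a)) list \<Rightarrow> ('m \<times> ('a, 'a) germ) \<Rightarrow>\<^sub>0 int" where
  "tens \<nu> K [] = 0"
| "tens \<nu> K (p # ps) = frag_of (\<nu> (fst p), FG.rg K (snd p)) + tens \<nu> K ps"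

lemma carrier_Fr_add: "\<lbrakk>u \<in> carrier X.Fr; v \<in> carrier X.Fr\<rbrakk> \<Longrightarrow> u + v \<in> carrier X.Fr"
  using keys_add[of u v] by auto

lemma tens_closed:
  assumes "lin J \<nu>" "K \<in> F"
  shows "combo J K ps \<Longrightarrow> tens \<nu> K ps \<in> carrier X.Fr"
proof (induction ps)
  case (Cons p ps)
  then have "frag_of (\<nu> (fst p), FG.rg K (snd p)) \<in> carrier X.Fr" "tens \<nu> K ps \<in> carrier X.Fr"
    using linD(1)[OF assms(1)] FG.rg_closed[OF assms(2)] by simp_all
  then show ?case using carrier_Fr_add by simp
qed simp

lemma tens_Ker:
  "(\<And>p. p \<in> set ps \<Longrightarrow> frag_of (\<nu> (fst p), FG.rg K (snd p)) \<in> X.Ker) \<Longrightarrow> tens \<nu> K ps \<in> X.Ker"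
  by (induction ps) (auto intro: X.Ker_zero X.Ker_add)

text \<open>Modulo the relations,
  \<open>(x - y) \<otimes> q = x \<otimes> q - y \<otimes> q\<close>. This serves the difference
  case of the induction in \<open>tensor_iso\<close>.\<close>

lemma tens_diff:
  assumes \<nu>: "lin I \<nu>" and \<mu>: "lin J \<mu>" and K: "K \<in> F"
  shows "combo (I \<inter> J) K ps \<Longrightarrow> tens \<nu> K ps - tens \<mu> K ps - tens (\<lambda>a. \<nu> a \<ominus>\<^bsub>M\<^esub> \<mu> a) K ps \<in> X.Ker"
proof (induction ps)
  case Nil
  then show ?case using X.Ker_zero by simp
next
  case (Cons p ps)
  define x y q where "x = \<nu> (fst p)" and "y = \<mu> (fst p)" and "q = FG.rg K (snd p)"
  have xy: "x \<in> carrier M" "y \<in> carrier M" "q \<in> carrier FG.LQ"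
    using Cons.prems linD(1)[OF \<nu>] linD(1)[OF \<mu>] FG.rg_closed[OF K] by (auto simp: x_def y_def q_def)
  have "(x \<ominus>\<^bsub>M\<^esub> y) \<oplus>\<^bsub>M\<^esub> y = x" using xy by (simp add: M.minus_eq M.a_assoc M.l_neg)
  then have "frag_of (x, q) - frag_of (x \<ominus>\<^bsub>M\<^esub> y, q) - frag_of (y, q) \<in> X.Ker"
    using X.Ker_add_left[of "x \<ominus>\<^bsub>M\<^esub> y" y q] xy by simp
  from X.Ker_add[OF this Cons.IH] show ?case
    using Cons.prems by (simp add: x_def[symmetric] y_def[symmetric] q_def[symmetric] algebra_simps)
qed

text \<open>Linearity gives \<open>g(\<Sum> i_k h_k(a)) = \<Sum> g(i_k) h_k(a)\<close>, and each
  scalar \<open>g(i_k)\<close> then moves across the tensor sign to \<open>m\<close>.\<close>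

lemma frag_tens_Ker:
  assumes m: "m \<in> carrier M" and J: "J \<in> F" "rlin J g" and K: "K \<in> F"
  shows "combo J K ps \<Longrightarrow> frag_of (m, FG.rg K (\<lambda>a. g (csum ps a))) - tens (\<lambda>a. m \<bullet>\<^bsub>M\<^esub> g a) K ps \<in> X.Ker"
proof (induction ps)
  case Nil
  have "g \<zero> = \<zero>" using R.rlinD(3)[OF J(2) G.filter_zero[OF J(1)], of \<zero>] R.rlinD(1)[OF J(2) G.filter_zero[OF J(1)]] by simp
  then have "FG.rg K (\<lambda>a. g (csum [] a)) = \<zero>\<^bsub>FG.LQ\<^esub>"
    unfolding FG.rg_zero
    by (intro FG.rg_cong[symmetric, OF G.filter_carrier R.rlin_zero K G.filter_subset[OF K]]) simp
  then show ?case using X.Ker_zero_right[OF m] by simp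
next
  case (Cons p ps)
  define i h where "i = fst p" and "h = snd p"
  have i: "i \<in> J" "g i \<in> carrier R" and h: "rlin K h" and ps: "combo J K ps"
    using Cons.prems R.rlinD(1)[OF J(2)] by (auto simp: i_def h_def)
  let ?s = "\<lambda>a. g (csum ps a)" and ?t = "\<lambda>a. g i \<otimes> h a"
  have im: "csum ps a \<in> J" if "a \<in> K" for a
    by (rule R.combo_csum_mem[OF G.filter_right_ideal[OF J(1)] ps that])
  have hc: "i \<otimes> h a \<in> J" if "a \<in> K" for a
    using G.filter_mult[OF J(1) i(1)] R.rlinD(1)[OF h that] by simp
  have s: "rlin K ?s"
    using im R.rlinD[OF J(2)] R.rlinD[OF R.rlin_csum[OF ps G.filter_subset[OF J(1)]]]
    by (simp add: R.rlin_def)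
  have t: "rlin K ?t" using R.rlin_scale[OF h i(2)] .
  have "FG.rg K ?t \<oplus>\<^bsub>FG.LQ\<^esub> FG.rg K ?s = FG.rg K (\<lambda>a. g (csum (p # ps) a))"
    unfolding FG.rg_add[OF K t K s] Int_absorb
    by (rule FG.rg_cong[OF K R.rlin_plus[OF t s] K subset_refl])
       (use im hc R.rlinD(2,3)[OF J(2)] i R.rlinD(1)[OF h] in \<open>simp add: i_def[symmetric] h_def[symmetric]\<close>)
  then have k1: "frag_of (m, FG.rg K (\<lambda>a. g (csum (p # ps) a))) - frag_of (m, FG.rg K ?t) - frag_of (m, FG.rg K ?s) \<in> X.Ker"
    using X.Ker_add_right[OF m FG.rg_closed[OF K t] FG.rg_closed[OF K s]] by (simp only:)
  have k2: "frag_of (m \<bullet>\<^bsub>M\<^esub> g i, FG.rg K h) - frag_of (m, FG.rg K ?t) \<in> X.Ker"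
    using X.Ker_act[OF m i(2) FG.rg_closed[OF K h]] by (simp add: FG.rg_scale[OF i(2) K h])
  show ?case
    using X.Ker_add[OF X.Ker_diff[OF k1 k2] Cons.IH[OF ps]]
    by (simp add: i_def[symmetric] h_def[symmetric] algebra_simps)
qed

text \<open>The annihilator \<open>A\<close> of a torsion element lies in \<open>F\<close>, so every
  \<open>q\<close> belongs to \<open>A R_F\<close>, and
  \<open>n \<otimes> A R_F = 0\<close>.\<close>

lemma torsion_frag_Ker:
  assumes "n \<in> T" "q \<in> carrier FG.LQ"
  shows "frag_of (n, q) \<in> X.Ker"
proof -
  have n: "n \<in> carrier M" "ann R M n \<in> F" using assms(1) unfolding torsion_def by blast+
  show ?thesis
    by (rule X.Ker_span[OF n(1) subset_refl])
       (rule FG.LQ_span_if_exhausts[OF ex[OF n(2)] G.filter_subset[OF n(2)] assms(2)])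
qed

text \<open>A decomposition \<open>\<one> = \<Sum> i_k g_k\<close> with coefficients in the domain
  of \<open>\<nu>\<close> yields the preimage \<open>\<Sum> \<nu>(i_k) \<otimes> g_k\<close> of its
  germ. Injectivity holds because every tensor equals, modulo the relations, the preimage so built
  from a lift of its own image.\<close>

theorem tensor_iso:
  "\<exists>\<phi> \<in> iso (tensor_product R M FG.LQ) (add_monoid Q).
     \<forall>m\<in>carrier M. \<forall>q\<in>carrier FG.LQ. \<phi> (pure_tensor R M FG.LQ m q) = scale R F M m q"
proof -
  have closed: "(\<lambda>(m, q). scale R F M m q) x \<in> carrier Q" if "x \<in> carrier M \<times> carrier FG.LQ" for x
    using that scale_closed by auto
  obtain e where e_hom: "e \<in> hom X.Fr (add_monoid Q)"
    and e': "\<And>x. x \<in> carrier M \<times> carrier FG.LQ \<Longrightarrow> e (frag_of x) = (\<lambda>(m, q). scale R F M m q) x"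
    and e_zero: "e 0 = \<zero>\<^bsub>Q\<^esub>"
    and e_add: "\<And>u v. \<lbrakk>u \<in> carrier X.Fr; v \<in> carrier X.Fr\<rbrakk> \<Longrightarrow> e (u + v) = e u \<oplus>\<^bsub>Q\<^esub> e v"
    and e_uminus: "\<And>u. u \<in> carrier X.Fr \<Longrightarrow> e (- u) = \<ominus>\<^bsub>Q\<^esub> e u"
    and e_diff: "\<And>u v. \<lbrakk>u \<in> carrier X.Fr; v \<in> carrier X.Fr\<rbrakk> \<Longrightarrow> e (u - v) = e u \<ominus>\<^bsub>Q\<^esub> e v"
    by (rule Q.free_Abelian_group_hom[where S = "carrier M \<times> carrier FG.LQ", OF closed]) (assumption, rule that)
  have e: "e (frag_of (m, q)) = scale R F M m q" if "m \<in> carrier M" "q \<in> carrier FG.LQ" for m q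
    using e'[of "(m, q)"] that by simp
  interpret E: group_hom X.Fr "add_monoid Q" e
    using e_hom by (intro group_hom.intro group_hom_axioms.intro) (auto intro: Q.a_group)
  have diff_closed: "u - v \<in> carrier X.Fr" if "u \<in> carrier X.Fr" "v \<in> carrier X.Fr" for u v
    using keys_diff[of u v] that by auto
  have Ker_sub: "X.Ker \<subseteq> kernel X.Fr (add_monoid Q) e"
    unfolding tensor_kernel_def
  proof (rule group.generate_subgroup_incl[OF group_free_Abelian_group _ E.subgroup_kernel], rule subsetI)
    fix w assume w: "w \<in> tensor_relations R M FG.LQ"
    have wc: "w \<in> carrier X.Fr" using X.relations_closed w by blast
    have sum0: "(a \<oplus>\<^bsub>Q\<^esub> b) \<ominus>\<^bsub>Q\<^esub> a \<ominus>\<^bsub>Q\<^esub> b = \<zero>\<^bsub>Q\<^esub>" if "a \<in> carrier Q" "b \<in> carrier Q" for a b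
      using that by (simp add: Q.minus_eq Q.a_ac Q.a_cancel Q.r_neg Q.r_neg1 Q.r_neg2)
    consider (a) x y p where "w = frag_of (x \<oplus>\<^bsub>M\<^esub> y, p) - frag_of (x, p) - frag_of (y, p)"
        "x \<in> carrier M" "y \<in> carrier M" "p \<in> carrier FG.LQ"
      | (b) x p q where "w = frag_of (x, p \<oplus>\<^bsub>FG.LQ\<^esub> q) - frag_of (x, p) - frag_of (x, q)"
        "x \<in> carrier M" "p \<in> carrier FG.LQ" "q \<in> carrier FG.LQ"
      | (c) x r p where "w = frag_of (x \<bullet>\<^bsub>M\<^esub> r, p) - frag_of (x, r \<odot>\<^bsub>FG.LQ\<^esub> p)"
        "x \<in> carrier M" "r \<in> carrier R" "p \<in> carrier FG.LQ"
      using w unfolding tensor_relations_def by blast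
    then have "e w = \<zero>\<^bsub>Q\<^esub>"
    proof cases
      case a
      have "frag_of (x \<oplus>\<^bsub>M\<^esub> y, p) - frag_of (x, p) \<in> carrier X.Fr"
        using a by (intro diff_closed) simp_all
      then show ?thesis
        using a by (simp add: e_diff e scale_add_left sum0 scale_closed)
    next
      case b
      have "frag_of (x, p \<oplus>\<^bsub>FG.LQ\<^esub> q) - frag_of (x, p) \<in> carrier X.Fr"
        using b by (intro diff_closed) simp_all
      then show ?thesis
        using b by (simp add: e_diff e scale_add_right sum0 scale_closed)
    next
      case c
      then show ?thesis
        by (simp add: e_diff e scale_act Q.minus_eq Q.r_neg scale_closed)
    qed
    then show "w \<in> kernel X.Fr (add_monoid Q) e" using wc by (simp add: kernel_def)
  qed
  have e_tens: "e (tens \<nu> K ps) = qg K (\<lambda>a. \<nu> (csum ps a))"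
    if J: "J \<in> F" "lin J \<nu>" and K: "K \<in> F" and ps: "combo J K ps" for J \<nu> K ps
    using ps
  proof (induction ps)
    case Nil
    have z: "\<nu> \<zero> \<in> T" "\<nu> \<zero> \<in> carrier M" by (rule lin_at_zero[OF J], rule linD(1)[OF J(2) G.filter_zero[OF J(1)]])
    have "lin K (\<lambda>_. \<nu> \<zero>)"
      by (rule lin_comp[OF J R.rlin_zero[of K]]) (rule G.filter_zero[OF J(1)])
    then have "qg K (\<lambda>_. \<nu> \<zero>) = \<zero>\<^bsub>Q\<^esub>"
      using z(1) K by (subst qg_zero_iff) auto
    then show ?case using e_zero by simp
  next
    case (Cons p ps)
    define i h where "i = fst p" and "h = snd p"
    have i: "i \<in> J" "\<nu> i \<in> carrier M" and h: "rlin K h" and ps: "combo J K ps"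
      using Cons.prems linD(1)[OF J(2)] by (auto simp: i_def h_def)
    note im = R.combo_csum_mem[OF G.filter_right_ideal[OF J(1)] ps]
    have hc: "i \<otimes> h a \<in> J" if "a \<in> K" for a
      using G.filter_mult[OF J(1) i(1)] R.rlinD(1)[OF h that] by simp
    have l: "lin K (\<lambda>a. \<nu> i \<bullet>\<^bsub>M\<^esub> h a)" "lin K (\<lambda>a. \<nu> (csum ps a))"
      "lin K (\<lambda>a. \<nu> (csum (p # ps) a))"
      using lin_scale[OF i(2) h] lin_comp[OF J R.rlin_csum[OF ps G.filter_subset[OF J(1)]] im]
        lin_comp[OF J R.rlin_csum[OF Cons.prems G.filter_subset[OF J(1)]]
          R.combo_csum_mem[OF G.filter_right_ideal[OF J(1)] Cons.prems]] by blast+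
    have "e (tens \<nu> K (p # ps)) = scale R F M (\<nu> i) (FG.rg K h) \<oplus>\<^bsub>Q\<^esub> e (tens \<nu> K ps)"
      using i FG.rg_closed[OF K h] tens_closed[OF J(2) K ps]
      by (simp add: e_add e i_def[symmetric] h_def[symmetric])
    also have "\<dots> = qg K (\<lambda>a. \<nu> i \<bullet>\<^bsub>M\<^esub> h a \<oplus>\<^bsub>M\<^esub> \<nu> (csum ps a))"
      unfolding Cons.IH[OF ps] scale_rg[OF i(2) K h] qg_add[OF K l(1) K l(2)] Int_absorb ..
    also have "\<dots> = qg K (\<lambda>a. \<nu> (csum (p # ps) a))"
      by (rule qg_eqI[OF K lin_plus_same[OF K l(1,2)] K l(3) K subset_refl subset_refl])
         (use i hc im R.rlinD(1)[OF h] linD[OF J(2)] in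
          \<open>simp add: i_def[symmetric] h_def[symmetric] cl_add cl_act\<close>)
    finally show ?case .
  qed
  \<comment> \<open>The lift \<open>\<nu>\<close> is fixed by \<open>w\<close>, while the
    decomposition of \<open>\<one>\<close> stays arbitrary: it is selected only later, once it is
    known where \<open>\<nu>\<close> is torsion.\<close>
  have normal_form: "\<exists>J\<in>F. \<exists>\<nu>. lin J \<nu> \<and> e w = qg J \<nu> \<and>
      (\<forall>K\<in>F. \<forall>ps. combo J K ps \<and> (\<forall>a\<in>K. csum ps a = a) \<longrightarrow> w - tens \<nu> K ps \<in> X.Ker)" (is "?NF w")
    if "Poly_Mapping.keys w \<subseteq> carrier M \<times> carrier FG.LQ" for w
  proof (rule free_Abelian_group_induct[OF that])
    show "?NF 0"
    proof (intro bexI[of _ "carrier R"] exI[of _ "\<lambda>_. \<zero>\<^bsub>M\<^esub>"] conjI ballI allI impI)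
      fix K ps assume K: "K \<in> F" "combo (carrier R) K ps \<and> (\<forall>a\<in>K. csum ps a = a)"
      have "tens (\<lambda>_. \<zero>\<^bsub>M\<^esub>) K ps \<in> X.Ker"
        by (rule tens_Ker) (use K FG.rg_closed[OF K(1)] X.Ker_zero_left in \<open>auto simp: R.combo_def\<close>)
      then show "0 - tens (\<lambda>_. \<zero>\<^bsub>M\<^esub>) K ps \<in> X.Ker" using X.Ker_uminus by simp
    qed (simp_all add: lin_zero e_zero qg_zero)
  next
    fix u v
    assume uv: "Poly_Mapping.keys u \<subseteq> carrier M \<times> carrier FG.LQ" "Poly_Mapping.keys v \<subseteq> carrier M \<times> carrier FG.LQ"
      and "?NF u" and "?NF v"
    from \<open>?NF u\<close> obtain I \<nu> where I: "I \<in> F" "lin I \<nu>" "e u = qg I \<nu>"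
      "\<And>K ps. \<lbrakk>K \<in> F; combo I K ps; \<forall>a\<in>K. csum ps a = a\<rbrakk> \<Longrightarrow> u - tens \<nu> K ps \<in> X.Ker" by blast
    from \<open>?NF v\<close> obtain J \<mu> where J: "J \<in> F" "lin J \<mu>" "e v = qg J \<mu>"
      "\<And>K ps. \<lbrakk>K \<in> F; combo J K ps; \<forall>a\<in>K. csum ps a = a\<rbrakk> \<Longrightarrow> v - tens \<mu> K ps \<in> X.Ker" by blast
    note m = lin_minus[OF J(1,2)]
    have "qg J (\<lambda>a. \<ominus>\<^bsub>M\<^esub> \<mu> a) \<oplus>\<^bsub>Q\<^esub> qg J \<mu> = \<zero>\<^bsub>Q\<^esub>"
      unfolding qg_add[OF J(1) m J(1,2)] Int_absorb qg_zero_iff[OF J(1) lin_plus_same[OF J(1) m J(2)]]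
      by (rule bexI[OF _ J(1)]) (use linD(1)[OF J(2)] torsion_zero in \<open>simp add: M.l_neg\<close>)
    then have minus: "\<ominus>\<^bsub>Q\<^esub> qg J \<mu> = qg J (\<lambda>a. \<ominus>\<^bsub>M\<^esub> \<mu> a)"
      using qg_closed[OF J(1,2)] qg_closed[OF J(1) m] by (rule Q.minus_equality)
    show "?NF (u - v)"
    proof (intro bexI[of _ "I \<inter> J"] exI[of _ "\<lambda>a. \<nu> a \<ominus>\<^bsub>M\<^esub> \<mu> a"] conjI ballI allI impI)
      show "lin (I \<inter> J) (\<lambda>a. \<nu> a \<ominus>\<^bsub>M\<^esub> \<mu> a)" using lin_plus[OF I(1) J(1) I(2) m] by (simp add: M.minus_eq)
      show "e (u - v) = qg (I \<inter> J) (\<lambda>a. \<nu> a \<ominus>\<^bsub>M\<^esub> \<mu> a)"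
        using uv by (simp add: e_diff I(3) J(3) Q.minus_eq M.minus_eq minus qg_add[OF I(1,2) J(1) m])
      fix K ps assume K: "K \<in> F" and "combo (I \<inter> J) K ps \<and> (\<forall>a\<in>K. csum ps a = a)"
      then have ps: "combo (I \<inter> J) K ps" "\<forall>a\<in>K. csum ps a = a" by auto
      have "(u - tens \<nu> K ps) - (v - tens \<mu> K ps) + (tens \<nu> K ps - tens \<mu> K ps - tens (\<lambda>a. \<nu> a \<ominus>\<^bsub>M\<^esub> \<mu> a) K ps) \<in> X.Ker"
        by (intro X.Ker_add X.Ker_diff I(4) J(4) tens_diff[OF I(2) J(2)] K ps R.combo_mono[OF ps(1)]) auto
      then show "u - v - tens (\<lambda>a. \<nu> a \<ominus>\<^bsub>M\<^esub> \<mu> a) K ps \<in> X.Ker" by (simp add: algebra_simps)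
    qed (use I J in simp)
  next
    fix x assume "x \<in> carrier M \<times> carrier FG.LQ"
    then obtain m q where x: "x = (m, q)" and m: "m \<in> carrier M" and q: "q \<in> carrier FG.LQ" by auto
    obtain J g where J: "J \<in> F" "rlin J g" "q = FG.rg J g" using FG.rg_cases[OF q] .
    show "?NF (frag_of x)"
    proof (intro bexI[of _ J] exI[of _ "\<lambda>a. m \<bullet>\<^bsub>M\<^esub> g a"] conjI ballI allI impI J(1))
      show "lin J (\<lambda>a. m \<bullet>\<^bsub>M\<^esub> g a)" by (rule lin_scale[OF m J(2)])
      show "e (frag_of x) = qg J (\<lambda>a. m \<bullet>\<^bsub>M\<^esub> g a)"
        using e[OF m q] scale_rg[OF m J(1,2)] by (simp add: x J(3))
      fix K ps assume K: "K \<in> F" and "combo J K ps \<and> (\<forall>a\<in>K. csum ps a = a)"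
      then have ps: "combo J K ps" and id: "\<And>a. a \<in> K \<Longrightarrow> csum ps a = a" by auto
      have "K \<subseteq> J" using R.combo_csum_mem[OF G.filter_right_ideal[OF J(1)] ps] id by fastforce
      then have "q = FG.rg K (\<lambda>a. g (csum ps a))"
        unfolding J(3) by (intro FG.rg_cong[OF J(1,2) K]) (simp_all add: id)
      then show "frag_of x - tens (\<lambda>a. m \<bullet>\<^bsub>M\<^esub> g a) K ps \<in> X.Ker"
        using frag_tens_Ker[OF m J(1,2) K ps] by (simp add: x)
    qed
  qed
  have "w \<in> X.Ker" if w: "w \<in> carrier X.Fr" and ew: "e w = \<zero>\<^bsub>Q\<^esub>" for w
  proof -
    obtain J \<nu> where J: "J \<in> F" "lin J \<nu>" "e w = qg J \<nu>"
      "\<And>K ps. \<lbrakk>K \<in> F; combo J K ps; \<forall>a\<in>K. csum ps a = a\<rbrakk> \<Longrightarrow> w - tens \<nu> K ps \<in> X.Ker"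
      using normal_form[of w] w by auto
    obtain D where D: "D \<in> F" "D \<subseteq> J" "\<forall>a\<in>D. \<nu> a \<in> T"
      using qg_zero_iff[OF J(1,2)] ew J(3) by auto
    \<comment> \<open>With coefficients taken from \<open>D\<close>, every summand
      \<open>\<nu>(i_k) \<otimes> g_k\<close> has a torsion left factor and vanishes.\<close>
    obtain K ps where K: "K \<in> F" "combo D K ps" "\<forall>a\<in>K. csum ps a = a"
      using ex[OF D(1)] unfolding R.exhausts_def by blast
    have "tens \<nu> K ps \<in> X.Ker"
      by (rule tens_Ker, rule torsion_frag_Ker)
         (use K(2) D(3) FG.rg_closed[OF K(1)] in \<open>auto simp: R.combo_def\<close>)
    from X.Ker_add[OF J(4)[OF K(1) R.combo_mono[OF K(2) D(2)] K(3)] this] show ?thesis by simp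
  qed
  then have ker: "kernel X.Fr (add_monoid Q) e = X.Ker"
    using Ker_sub by (auto simp: kernel_def)
  have "e ` carrier X.Fr = carrier (add_monoid Q)"
  proof (intro equalityI subsetI)
    fix x assume "x \<in> carrier (add_monoid Q)"
    then have "x \<in> carrier Q" by simp
    then obtain J \<nu> where J: "J \<in> F" "lin J \<nu>" "x = qg J \<nu>" by (rule qg_cases)
    obtain K ps where K: "K \<in> F" "combo J K ps" and id: "\<And>a. a \<in> K \<Longrightarrow> csum ps a = a"
      using ex[OF J(1)] unfolding R.exhausts_def by blast
    note im = R.combo_csum_mem[OF G.filter_right_ideal[OF J(1)] K(2)]
    have KJ: "K \<subseteq> J" using im id by fastforce
    \<comment> \<open>The image of \<open>tens \<nu> K ps\<close> is the germ of
      \<open>a \<mapsto> \<nu> (csum ps a)\<close>, and \<open>csum ps\<close> is the identity on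
      \<open>K\<close>.\<close>
    have "e (tens \<nu> K ps) = x"
      unfolding e_tens[OF J(1,2) K] J(3)
      by (rule qg_eqI[OF K(1) lin_comp[OF J(1,2) R.rlin_csum[OF K(2) G.filter_subset[OF J(1)]] im] J(1,2) K(1) subset_refl KJ])
         (simp_all add: id)
    then show "x \<in> e ` carrier X.Fr" using tens_closed[OF J(2) K] by blast
  qed (use E.hom_closed in auto)
  then have iso: "(\<lambda>C. the_elem (e ` C)) \<in> iso (tensor_product R M FG.LQ) (add_monoid Q)"
    using E.FactGroup_iso_set unfolding tensor_product_def ker by blast
  have "the_elem (e ` (pure_tensor R M FG.LQ m q)) = scale R F M m q"
    if m: "m \<in> carrier M" and q: "q \<in> carrier FG.LQ" for m q
  proof -
    have f: "frag_of (m, q) \<in> carrier X.Fr" using m q by simp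
    have const: "e u = e (frag_of (m, q))" if u: "u \<in> pure_tensor R M FG.LQ m q" for u
    proof -
      obtain k where k: "k \<in> X.Ker" "u = k + frag_of (m, q)"
        using u by (auto simp: pure_tensor_def r_coset_def)
      then have "k \<in> carrier X.Fr" "e k = \<zero>\<^bsub>Q\<^esub>" using Ker_sub by (auto simp: kernel_def)
      then show ?thesis using f k(2) E.hom_closed[OF f] by (simp add: e_add)
    qed
    have "frag_of (m, q) \<in> pure_tensor R M FG.LQ m q"
      unfolding pure_tensor_def by (rule group.rcos_self[OF group_free_Abelian_group f X.Ker_subgroup])
    then have "pure_tensor R M FG.LQ m q \<noteq> {}" by auto
    from the_elem_image_unique[OF this const] show ?thesis using e[OF m q] by simp
  qed
  then show ?thesis by (intro bexI[OF _ iso] ballI)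
qed

end

section \<open>The maximal perfect filter\<close>

context ring
begin

lemma cyclic_generator:
  assumes "right_ideal R I" "m \<in> carrier (cyclic_module R I)"
  shows "\<exists>r\<in>carrier R. m = (I +> \<one>) \<bullet>\<^bsub>cyclic_module R I\<^esub> r"
proof -
  note cyc = cyclic_module_simps[OF ring_axioms assms(1)]
  obtain r where r: "r \<in> carrier R" "m = I +> r" using assms(2) unfolding cyc(1) by blast
  then have "m = (I +> \<one>) \<bullet>\<^bsub>cyclic_module R I\<^esub> r" by (simp add: cyc(4))
  then show ?thesis using r(1) by blast
qed

lemma cyclic_one_closed: "right_ideal R I \<Longrightarrow> I +> \<one> \<in> carrier (cyclic_module R I)"
  using cyclic_module_simps(1)[OF ring_axioms] by blast

text \<open>For \<open>I \<in> F\<close> the module \<open>R/I\<close> is torsion, so \<open>R/I \<otimes> R\<^sub>F \<cong> (R/I)\<^sub>F = 0\<close>.\<close>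

lemma exhausts_if_perfect:
  assumes P: "perfect_filter TYPE('u) R F" and "faithful R F" and I: "I \<in> F"
  shows "exhausts F I"
proof -
  interpret faithful_gabriel R F
    using assms by unfold_locales (simp_all add: perfect_filter_def)
  note rI = filter_right_ideal[OF I]
  note cyc = cyclic_module_simps[OF ring_axioms rI]
  define M where "M = (Inl_copy (cyclic_module R I) :: ('a, 'a set + 'u) rmodule)"
  have M: "right_module R M"
    unfolding M_def by (rule right_module_Inl_copy[OF right_module_cyclic[OF ring_axioms rI]])
  interpret A: quotients R M F by (intro quotients.intro M gabriel_axioms)
  interpret X: tensor R M LQ by (intro tensor.intro M LQ_left_mod)
  let ?c = "Inl (I +> \<one>)"
  have tor: "x \<in> A.T" if x: "x \<in> carrier M" for x
  proof -
    obtain r where "r \<in> carrier R" "x = Inl (I +> r)"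
      using x unfolding M_def Inl_copy_simps(1) cyc(1) by blast
    then have "ann R M x = colon R I r" "colon R I r \<in> F"
      using rI I by (simp_all add: M_def ann_Inl_copy ann_cyclic_coset filter_colon)
    then show ?thesis using x unfolding torsion_def by simp
  qed
  have zero: "x = \<zero>\<^bsub>A.Q\<^esub>" if x: "x \<in> carrier A.Q" for x
  proof -
    obtain J \<nu> where J: "J \<in> F" "A.lin J \<nu>" "x = A.qg J \<nu>" using A.qg_cases[OF x] .
    then show ?thesis using A.qg_zero_iff[OF J(1,2)] A.linD(1)[OF J(2)] tor by blast
  qed
  obtain \<phi> where "\<phi> \<in> iso (tensor_product R M LQ) (add_monoid A.Q)"
    using P M unfolding perfect_filter_def by blast
  then have bij: "bij_betw \<phi> (carrier (tensor_product R M LQ)) (carrier A.Q)"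
    by (simp add: iso_def)
  have "carrier A.Q = {\<zero>\<^bsub>A.Q\<^esub>}" using zero A.Q.zero_closed by blast
  then obtain z where z: "carrier (tensor_product R M LQ) = {z}"
    using bij_betw_same_card[OF bij] card_1_singletonE by (metis is_singletonI is_singleton_altdef)
  have c: "?c \<in> carrier M" using cyclic_one_closed[OF rI] by (simp add: M_def)
  have one: "rg (carrier R) (\<lambda>a. a) \<in> carrier LQ"
    by (rule rg_closed[OF filter_carrier rlin_id[OF subset_refl]])
  have "\<exists>r\<in>carrier R. m = ?c \<bullet>\<^bsub>M\<^esub> r" if "m \<in> carrier M" for m
    using that cyclic_generator[OF rI] unfolding M_def by fastforce
  \<comment> \<open>The generator of \<open>R/I\<close> tensored with the identity germ vanishes, so
    the identity germ lies in \<open>I R_F\<close>.\<close>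
  then have "rg (carrier R) (\<lambda>a. a) \<in> X.L.span (ann R M ?c)"
    using X.span_if_Ker_cyclic[OF c _ one X.trivial_tensorD[OF z c one]] by blast
  moreover have "ann R M ?c = I"
    using rI by (simp add: M_def ann_Inl_copy ann_cyclic_coset colon_one)
  ultimately show ?thesis using exhausts_if_LQ_span[OF filter_subset[OF I]] by simp
qed

lemma perfect_iff_exhausting:
  "perfect_filter TYPE('u) R F \<and> faithful R F \<longleftrightarrow> F \<in> exhausting_filters"
proof
  assume "perfect_filter TYPE('u) R F \<and> faithful R F"
  then show "F \<in> exhausting_filters"
    using exhausts_if_perfect by (auto simp: exhausting_filters_def perfect_filter_def)
next
  assume F: "F \<in> exhausting_filters"
  then interpret faithful_gabriel R F
    by unfold_locales (simp_all add: exhausting_filters_def)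
  have "\<exists>\<phi> \<in> iso (tensor_product R M LQ) (add_monoid (module_of_quotients R F M)).
      \<forall>m\<in>carrier M. \<forall>q\<in>carrier LQ. \<phi> (pure_tensor R M LQ m q) = scale R F M m q"
    if M: "right_module R M" for M :: "('a, 'a set + 'u) rmodule"
  proof -
    interpret exhausting_quotients R M F
      using M F
      by (intro exhausting_quotients.intro faithful_quotients.intro quotients.intro
          exhausting_quotients_axioms.intro gabriel_axioms faithful_gabriel_axioms)
         (simp_all add: exhausting_filters_def)
    show ?thesis by (rule tensor_iso)
  qed
  then show "perfect_filter TYPE('u) R F \<and> faithful R F"
    using gabriel faithful unfolding perfect_filter_def by blast
qed

text \<open>Inside the Lambek ring of quotients the image of \<open>R_F\<close> consists of the
  germs with a representative defined on a member of \<open>F\<close>. These images grow with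
  \<open>F\<close>, so \<open>Q_tot\<close> is the one for \<open>tot_closure\<close>. Now
  \<open>R/I \<otimes> Q_tot\<close> vanishes iff the identity germ lies in \<open>I Q_tot\<close>,
  which is the \<open>exhausts\<close> condition and hence membership in
  \<open>tot_closure\<close>.\<close>

lemma tot_filter_eq: "tot_filter TYPE('u) R = tot_closure"
proof -
  interpret L: faithful_gabriel R "lambek_filter R"
    by unfold_locales (simp_all add: lambek_gabriel faithful_if_subset_lambek)
  interpret sub_quotients R "lambek_filter R" tot_closure
    by (intro sub_quotients.intro sub_quotients_axioms.intro L.faithful_gabriel_axioms
        gabriel.intro gabriel_axioms.intro ring_axioms tot_closure_gabriel tot_closure_subset_lambek)
  have img: "change_filter R F (lambek_filter R) (self_module R) ` carrier (left_quotients R F) =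
      {L.rg J g | J g. J \<in> F \<and> rlin J g}" if F: "F \<in> exhausting_filters" for F
  proof -
    interpret F: faithful_gabriel R F
      using F by unfold_locales (simp_all add: exhausting_filters_def)
    interpret change_of_filter R "self_module R" F "lambek_filter R"
      by (intro change_of_filter.intro change_of_filter_axioms.intro F.S.quotients_axioms
          L.S.quotients_axioms faithful_subset_lambek F.gabriel F.faithful)
    have "change_filter R F (lambek_filter R) (self_module R) (F.rg J g) = L.rg J g"
      if "J \<in> F" "rlin J g" for J g
      using change_filter_qg that by (simp add: F.lin_self_iff)
    then show ?thesis unfolding F.carrier_LQ by (force simp: image_iff)
  qed
  have "F \<subseteq> tot_closure" if "F \<in> exhausting_filters" for F
    using tot_closure.base[OF that] by blast
  \<comment> \<open>The union is attained at \<open>tot_closure\<close>, which is itself one of the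
    filters indexing it.\<close>
  then have "(\<Union>F\<in>exhausting_filters. {L.rg J g | J g. J \<in> F \<and> rlin J g}) =
      {L.rg J g | J g. J \<in> tot_closure \<and> rlin J g}"
    using tot_closure_exhausting by blast
  then have Q: "Q_tot TYPE('u) R = SQ"
    unfolding Q_tot_def SQ_def perfect_iff_exhausting by (simp add: img)
  have "trivial_group (tensor_product R (cyclic_module R I) SQ) \<longleftrightarrow> I \<in> tot_closure"
    if rI: "right_ideal R I" for I
  proof -
    note cyc = cyclic_module_simps[OF ring_axioms rI]
    interpret X: tensor R "cyclic_module R I" SQ
      by (intro tensor.intro right_module_cyclic[OF ring_axioms rI] SQ_left_mod)
    let ?c = "I +> \<one>"
    note c = cyclic_one_closed[OF rI]
    show ?thesis
    proof
      assume "trivial_group (tensor_product R (cyclic_module R I) SQ)"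
      then have k: "frag_of (?c, L.rg (carrier R) (\<lambda>a. a)) \<in> X.Ker"
        using X.trivial_tensorD[OF _ c one_closed_SQ] by (auto simp: trivial_group_def)
      have "L.rg (carrier R) (\<lambda>a. a) \<in> SQ.span (ann R (cyclic_module R I) ?c)"
        by (rule X.span_if_Ker_cyclic[OF c cyclic_generator[OF rI] one_closed_SQ k])
      then have "exhausts tot_closure I"
        using exhausts_if_span[OF right_ideal_subset[OF rI]] rI by (simp add: ann_cyclic_coset colon_one)
      then show "I \<in> tot_closure" by (rule H.exhausts_member[OF rI])
    next
      assume I: "I \<in> tot_closure"
      show "trivial_group (tensor_product R (cyclic_module R I) SQ)"
      proof (rule X.trivial_tensorI)
        fix x n assume x: "x \<in> carrier (cyclic_module R I)" and n: "n \<in> carrier SQ"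
        obtain r where r: "r \<in> carrier R" "x = I +> r" using x unfolding cyc(1) by blast
        then have A: "ann R (cyclic_module R I) x \<in> tot_closure"
          using H.filter_colon[OF I] rI by (simp add: ann_cyclic_coset)
        show "frag_of (x, n) \<in> X.Ker"
          by (rule X.Ker_span[OF x subset_refl span_if_exhausts[OF tot_closure_exhausts[OF A] H.filter_subset[OF A] n]])
      qed
    qed
  qed
  then show ?thesis
    unfolding tot_filter_def Q using tot_closure_right_ideal by blast
qed

end

theorem corollary2:
  fixes R :: "('a, 'b) ring_scheme" and M :: "('a, 'm, 'c) rmodule_scheme"
    and \<delta> :: "'a \<Rightarrow> 'a" and d :: "'m \<Rightarrow> 'm"
  assumes "ring R" and "derivation R \<delta>"
    and "right_module R M" and "module_derivation R \<delta> M d"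
  shows
    "((\<forall>F. gabriel_filter R F \<and> faithful R F \<longrightarrow>
          extensions_agree R F (lambek_filter R) \<delta> (self_module R) \<delta>) \<and>
      extensions_agree R (tot_filter TYPE('u) R) (lambek_filter R) \<delta> (self_module R) \<delta>) \<and>
     ((\<forall>F. gabriel_filter R F \<and> faithful R F \<and> differential R F \<longrightarrow>
          extensions_agree R F (lambek_filter R) \<delta> M d) \<and>
      extensions_agree R (tot_filter TYPE('u) R) (lambek_filter R) \<delta> M d) \<and>
     (right_ore R \<longrightarrow>
        extensions_agree R (classical_filter R) (lambek_filter R) \<delta> (self_module R) \<delta> \<and>
        extensions_agree R (classical_filter R) (tot_filter TYPE('u) R) \<delta> (self_module R) \<delta>) \<and>
     (extensions_agree R (lambek_filter R) (goldie_filter TYPE('u) R) \<delta> (self_module R) \<delta> \<and>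
      (\<forall>F. gabriel_filter R F \<and> faithful R F \<longrightarrow>
          extensions_agree R F (goldie_filter TYPE('u) R) \<delta> (self_module R) \<delta>))"
proof -
  interpret ring R by fact
  have self: "module_derivation R \<delta> (self_module R) \<delta>"
    using \<open>derivation R \<delta>\<close> by (simp add: derivation_def module_derivation_def)
  have ring_agree: "extensions_agree R F G \<delta> (self_module R) \<delta>"
    if "gabriel_filter R F" "gabriel_filter R G" "F \<subseteq> G" for F G
    by (rule extensions_agree_gabriel[OF that right_module_self assms(2) self])
  have module_agree: "extensions_agree R F G \<delta> M d"
    if "gabriel_filter R F" "gabriel_filter R G" "F \<subseteq> G" for F G
    by (rule extensions_agree_gabriel[OF that assms(3,2,4)])
  note tot = tot_closure_gabriel[folded tot_filter_eq[where 'u = 'u]]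
    tot_closure_subset_lambek[folded tot_filter_eq[where 'u = 'u]]
  note goldie = second_singular_gabriel[folded goldie_filter_eq[where 'u = 'u]]
    lambek_subset_second_singular[folded goldie_filter_eq[where 'u = 'u]]
  \<comment> \<open>The Ore condition enters here: it makes the classical filter exhausting, hence
    one of the generators of the closure.\<close>
  have classical_tot: "classical_filter R \<subseteq> tot_filter TYPE('u) R" if "right_ore R"
  proof -
    have "classical_filter R \<in> exhausting_filters"
      using classical_gabriel classical_exhausts[OF that]
        faithful_if_subset_lambek[OF classical_gabriel classical_subset_lambek]
      by (simp add: exhausting_filters_def)
    then show ?thesis using tot_closure.base unfolding tot_filter_eq by blast
  qed
  \<comment> \<open>Each clause is an inclusion of Gabriel filters; the last one goes from a
    faithful filter through the Lambek filter to the Goldie filter.\<close>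
  show ?thesis
    using ring_agree module_agree lambek_gabriel faithful_subset_lambek tot goldie
      classical_gabriel classical_subset_lambek classical_tot
    by (intro conjI allI impI) (simp_all, meson subset_trans)
qed

end
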